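(* Let the sequence of functions $F_n:\mathbb{P}(E)^n\to\mathbb{P}(E)$, $0<n\in\mathbb{N}$ (given for every Hilbert space $E$), be an operator mean of discrete probability measures. Then it uniquely extends to a stochastic order preserving function $\hat F:\mathcal{P}^\infty(\mathbb{P}(E))\to\mathbb{P}(E)$, where extending means $\hat F\left(\frac1n\sum_{i=1}^n\delta_{X_i}\right)=F_n(X_1,\dots,X_n)$ for all $n$ and $X_1,\dots,X_n\in\mathbb{P}(E)$.
   Context: $\mathbb{P}(E)$ is the cone of positive invertible bounded operators on the Hilbert space $E$, with the Thompson metric $d_\infty(A,B)=\|\log(A^{-1/2}BA^{-1/2})\|$. $\mathcal{P}(\mathbb{P}(E))$ is the set of fully supported Borel probability measures on $(\mathbb{P}(E),d_\infty)$, i.e. those $\mu$ with $\mu(\mathrm{supp}(\mu))=1$; $\mathcal{P}^\infty(\mathbb{P}(E))$ is the subset of measures with ($d_\infty$-)bounded support. A set $U\subseteq\mathbb{P}(E)$ is upper if $X\in U$, $X\le Y\in\mathbb{P}(E)$ imply $Y\in U$. Stochastic order: $\mu\le\nu$ iff $\mu(U)\le\nu(U)$ for all closed upper sets $U\subseteq\mathbb{P}(E)$. $\hat F$ preserves the stochastic order if $\mu\le\nu$ implies $\hat F(\mu)\le\hat F(\nu)$. A free function $F_n:\mathbb{P}(E)^n\to\mathbb{P}(E)$ is a family of maps indexed by Hilbert spaces $E$ with $F_n(U^*AU)=U^*F_n(A)U$ for unitaries $U:K\to E$ and $F_n(A\oplus B)=F_n(A)\oplus F_n(B)$ (operations coordinatewise);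 it is operator monotone if $A\le B$ coordinatewise implies $F_n(A)\le F_n(B)$. A sequence of operator monotone free functions $F_n:\mathbb{P}(E)^n\to\mathbb{P}(E)$ is an operator mean (of discrete probability measures) if 1) $F_n(X_1,\dots,X_n)=F_n(X_{\sigma(1)},\dots,X_{\sigma(n)})$ for every permutation $\sigma\in S_n$; 2) for every $0<k\in\mathbb{N}$, $F_{nk}(X_1,\dots,X_1,\dots,X_n,\dots,X_n)=F_n(X_1,\dots,X_n)$, each $X_i$ being repeated $k$ times. *)

theory Defs
  imports "HOL-Probability.Probability" "HOL-Combinatorics.Permutations"
begin

section \<open>Complex Hilbert spaces and their closed subspaces\<close>

text \<open>
  The inner product is linear in its first argument. Its real part is the inner product of
  the underlying real Hilbert space, so the norm is the usual one.
\<close>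

class complex_inner = real_inner +
  fixes scaleC :: "complex \<Rightarrow> 'a \<Rightarrow> 'a" (infixr \<open>*\<^sub>C\<close> 75)
    and cinner :: "'a \<Rightarrow> 'a \<Rightarrow> complex"
  assumes scaleC_of_real: "complex_of_real r *\<^sub>C x = r *\<^sub>R x"
    and scaleC_add_right: "c *\<^sub>C (x + y) = c *\<^sub>C x + c *\<^sub>C y"
    and scaleC_add_left: "(c + d) *\<^sub>C x = c *\<^sub>C x + d *\<^sub>C x"
    and scaleC_scaleC: "c *\<^sub>C d *\<^sub>C x = (c * d) *\<^sub>C x"
    and cinner_commute: "cinner x y = cnj (cinner y x)"
    and cinner_add_left: "cinner (x + y) z = cinner x z + cinner y z"
    and cinner_scaleC_left: "cinner (c *\<^sub>C x) y = c * cinner x y"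
    and Re_cinner: "Re (cinner x y) = inner x y"

class chilbert_space = complex_inner + complete_space

text \<open>
  A free function is a family of maps indexed by all Hilbert spaces. HOL cannot quantify over
  types inside a formula, so the Hilbert spaces \<open>E\<close> are rendered as the closed complex
  subspaces of an arbitrary ambient space \<open>'h\<close>; every Hilbert space is unitarily equivalent
  to a closed subspace of some infinite-dimensional \<open>'h\<close>. If \<open>'h\<close> is infinite-dimensional,
  then any two closed subspaces of it have orthogonal copies, up to unitary equivalence, whose
  sum again lies in \<open>'h\<close>, so that this universe of Hilbert spaces is closed under direct sums.
\<close>

definition hilbert :: "'h::chilbert_space set \<Rightarrow> bool" where
  "hilbert E \<longleftrightarrow> 0 \<in> E \<and> (\<forall>x\<in>E. \<forall>y\<in>E. x + y \<in> E) \<and> (\<forall>c. \<forall>x\<in>E. c *\<^sub>C x \<in> E) \<and> closed E"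

definition orthogonal_spaces :: "'h::chilbert_space set \<Rightarrow> 'h set \<Rightarrow> bool" where
  "orthogonal_spaces E K \<longleftrightarrow> (\<forall>x\<in>E. \<forall>y\<in>K. cinner x y = 0)"

definition direct_sum :: "'h::chilbert_space set \<Rightarrow> 'h set \<Rightarrow> 'h set" where
  "direct_sum E K = {x + y |x y. x \<in> E \<and> y \<in> K}"


section \<open>Bounded operators\<close>

type_synonym 'h operator = "'h \<Rightarrow>\<^sub>L 'h"

text \<open>
  A bounded complex-linear operator from \<open>K\<close> to \<open>E\<close> is represented by its extension by
  \<open>0\<close> to the orthogonal complement of \<open>K\<close>. This extension is compatible with the norm,
  the adjoint and composition, and turns \<open>A \<oplus> B\<close> on \<open>direct_sum E K\<close> into the sum \<open>A + B\<close>.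
\<close>

definition bounded_ops :: "'h::chilbert_space set \<Rightarrow> 'h set \<Rightarrow> 'h operator set" where
  "bounded_ops K E = {T. (\<forall>c x. blinfun_apply T (c *\<^sub>C x) = c *\<^sub>C blinfun_apply T x) \<and>
     (\<forall>x. blinfun_apply T x \<in> E) \<and>
     (\<forall>x. (\<forall>y\<in>K. cinner x y = 0) \<longrightarrow> blinfun_apply T x = 0)}"

definition id_op :: "'h::chilbert_space set \<Rightarrow> 'h operator" where
  "id_op E = (THE P. P \<in> bounded_ops E E \<and> (\<forall>x\<in>E. blinfun_apply P x = x))"

definition adj :: "'h::chilbert_space operator \<Rightarrow> 'h operator" where
  "adj T = (THE S. \<forall>x y. cinner (blinfun_apply T x) y = cinner x (blinfun_apply S y))"

definition unitaries :: "'h::chilbert_space set \<Rightarrow> 'h set \<Rightarrow> 'h operator set" where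
  "unitaries K E = {U \<in> bounded_ops K E. adj U o\<^sub>L U = id_op K \<and> U o\<^sub>L adj U = id_op E}"

definition loewner_le :: "'h::chilbert_space operator \<Rightarrow> 'h operator \<Rightarrow> bool" (infix \<open>\<sqsubseteq>\<^sub>L\<close> 50) where
  "A \<sqsubseteq>\<^sub>L B \<longleftrightarrow> (\<forall>x. cinner (blinfun_apply (B - A) x) x \<in> \<real>\<^sub>\<ge>\<^sub>0)"

definition invertible_op :: "'h::chilbert_space set \<Rightarrow> 'h operator \<Rightarrow> bool" where
  "invertible_op E A \<longleftrightarrow> (\<exists>B\<in>bounded_ops E E. A o\<^sub>L B = id_op E \<and> B o\<^sub>L A = id_op E)"

definition pos_ops :: "'h::chilbert_space set \<Rightarrow> 'h operator set" (\<open>\<P>\<close>) where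
  "\<P> E = {A \<in> bounded_ops E E. 0 \<sqsubseteq>\<^sub>L A \<and> invertible_op E A}"


section \<open>Functional calculus and the Thompson metric\<close>

text \<open>
  The complex number \<open>z\<close> is in the spectrum of \<open>A\<close> on \<open>E\<close> iff \<open>A - z\<close> has no bounded inverse on \<open>E\<close>.
\<close>

definition spectrum :: "'h::chilbert_space set \<Rightarrow> 'h operator \<Rightarrow> complex set" where
  "spectrum E A = {z. \<not> (\<exists>B\<in>bounded_ops E E. \<forall>x\<in>E.
     blinfun_apply B (blinfun_apply A x - z *\<^sub>C x) = x \<and>
     blinfun_apply A (blinfun_apply B x) - z *\<^sub>C blinfun_apply B x = x)}"

primrec op_power :: "'h::chilbert_space set \<Rightarrow> 'h operator \<Rightarrow> nat \<Rightarrow> 'h operator" where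
  "op_power E A 0 = id_op E"
| "op_power E A (Suc n) = A o\<^sub>L op_power E A n"

definition poly_op :: "'h::chilbert_space set \<Rightarrow> real poly \<Rightarrow> 'h operator \<Rightarrow> 'h operator" where
  "poly_op E p A = (\<Sum>i\<le>degree p. coeff p i *\<^sub>R op_power E A i)"

text \<open>
  Continuous functional calculus of a self-adjoint operator \<open>A\<close> on \<open>E\<close>: \<open>f(A)\<close> is the norm
  limit of \<open>p\<^sub>n(A)\<close> for every sequence of polynomials converging to \<open>f\<close> uniformly on the spectrum.
\<close>

definition op_fun :: "'h::chilbert_space set \<Rightarrow> (real \<Rightarrow> real) \<Rightarrow> 'h operator \<Rightarrow> 'h operator" where
  "op_fun E f A = (THE T. \<forall>p :: nat \<Rightarrow> real poly.
     uniform_limit {t. complex_of_real t \<in> spectrum E A} (\<lambda>n. poly (p n)) f sequentially \<longrightarrow>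
     (\<lambda>n. poly_op E (p n) A) \<longlonglongrightarrow> T)"

text \<open>
  The value \<open>0\<close> outside \<open>\<P> E\<close> is only there because the locale \<^locale>\<open>Metric_space\<close> asks for
  symmetry and nonnegativity of the distance on the whole type.
\<close>

definition thompson :: "'h::chilbert_space set \<Rightarrow> 'h operator \<Rightarrow> 'h operator \<Rightarrow> real" where
  "thompson E A B =
     (if A \<in> \<P> E \<and> B \<in> \<P> E
      then let R = op_fun E (\<lambda>t. t powr (- 1 / 2)) A in norm (op_fun E ln (R o\<^sub>L B o\<^sub>L R))
      else 0)"

abbreviation thompson_top :: "'h::chilbert_space set \<Rightarrow> 'h operator topology" where
  "thompson_top E \<equiv> Metric_space.mtopology (\<P> E) (thompson E)"


section \<open>Probability measures and the stochastic order\<close>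

definition borel_pos :: "'h::chilbert_space set \<Rightarrow> 'h operator measure" where
  "borel_pos E = sigma (\<P> E) {U. openin (thompson_top E) U}"

definition supp :: "'h::chilbert_space set \<Rightarrow> 'h operator measure \<Rightarrow> 'h operator set" where
  "supp E \<mu> = {X \<in> \<P> E. \<forall>U. openin (thompson_top E) U \<and> X \<in> U \<longrightarrow> emeasure \<mu> U > 0}"

definition prob_measures :: "'h::chilbert_space set \<Rightarrow> 'h operator measure set" where
  "prob_measures E =
     {\<mu>. sets \<mu> = sets (borel_pos E) \<and> prob_space \<mu> \<and> emeasure \<mu> (supp E \<mu>) = 1}"

definition bounded_prob_measures :: "'h::chilbert_space set \<Rightarrow> 'h operator measure set" where
  "bounded_prob_measures E =
     {\<mu> \<in> prob_measures E. Metric_space.mbounded (\<P> E) (thompson E) (supp E \<mu>)}"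

definition upper_set :: "'h::chilbert_space set \<Rightarrow> 'h operator set \<Rightarrow> bool" where
  "upper_set E U \<longleftrightarrow> U \<subseteq> \<P> E \<and> (\<forall>X\<in>U. \<forall>Y\<in>\<P> E. X \<sqsubseteq>\<^sub>L Y \<longrightarrow> Y \<in> U)"

definition stoch_le :: "'h::chilbert_space set \<Rightarrow> 'h operator measure \<Rightarrow> 'h operator measure \<Rightarrow> bool" where
  "stoch_le E \<mu> \<nu> \<longleftrightarrow>
     (\<forall>U. closedin (thompson_top E) U \<and> upper_set E U \<longrightarrow> emeasure \<mu> U \<le> emeasure \<nu> U)"

definition preserves_stoch_order ::
    "'h::chilbert_space set \<Rightarrow> ('h operator measure \<Rightarrow> 'h operator) \<Rightarrow> bool" where
  "preserves_stoch_order E \<Phi> \<longleftrightarrow>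
     (\<forall>\<mu>\<in>bounded_prob_measures E. \<forall>\<nu>\<in>bounded_prob_measures E.
        stoch_le E \<mu> \<nu> \<longrightarrow> \<Phi> \<mu> \<sqsubseteq>\<^sub>L \<Phi> \<nu>)"

text \<open>The measure \<open>(1/n) (\<delta>\<^bsub>X\<^sub>1\<^esub> + \<dots> + \<delta>\<^bsub>X\<^sub>n\<^esub>)\<close> for the tuple \<open>Xs = [X\<^sub>1, \<dots>, X\<^sub>n]\<close>.\<close>

definition empirical :: "'h::chilbert_space set \<Rightarrow> 'h operator list \<Rightarrow> 'h operator measure" where
  "empirical E Xs = measure_of (\<P> E) (sets (borel_pos E))
     (\<lambda>U. (\<Sum>X\<leftarrow>Xs. emeasure (return (borel_pos E) X) U) / of_nat (length Xs))"


section \<open>Free functions and operator means\<close>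

text \<open>The Cartesian power \<open>\<P>(E)\<^sup>n\<close>.\<close>

definition tuples :: "nat \<Rightarrow> 'h::chilbert_space set \<Rightarrow> 'h operator list set" where
  "tuples n E = {Xs. length Xs = n \<and> set Xs \<subseteq> \<P> E}"

type_synonym 'h op_family = "'h set \<Rightarrow> 'h operator list \<Rightarrow> 'h operator"

text \<open>
  Compatibility with direct sums is required for orthogonal subspaces only; together with unitary
  invariance this determines the value on \<open>E \<oplus> K\<close> for arbitrary \<open>E\<close> and \<open>K\<close>.
\<close>

definition free_function :: "nat \<Rightarrow> 'h::chilbert_space op_family \<Rightarrow> bool" where
  "free_function n F \<longleftrightarrow>
     (\<forall>E. hilbert E \<longrightarrow> (\<forall>Xs\<in>tuples n E. F E Xs \<in> \<P> E)) \<and>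
     (\<forall>E K. hilbert E \<and> hilbert K \<longrightarrow> (\<forall>U\<in>unitaries K E. \<forall>Xs\<in>tuples n E.
        F K (map (\<lambda>A. adj U o\<^sub>L A o\<^sub>L U) Xs) = adj U o\<^sub>L F E Xs o\<^sub>L U)) \<and>
     (\<forall>E K. hilbert E \<and> hilbert K \<and> orthogonal_spaces E K \<longrightarrow>
        (\<forall>Xs\<in>tuples n E. \<forall>Ys\<in>tuples n K.
           F (direct_sum E K) (map2 (+) Xs Ys) = F E Xs + F K Ys))"

definition operator_monotone :: "nat \<Rightarrow> 'h::chilbert_space op_family \<Rightarrow> bool" where
  "operator_monotone n F \<longleftrightarrow>
     (\<forall>E. hilbert E \<longrightarrow> (\<forall>Xs\<in>tuples n E. \<forall>Ys\<in>tuples n E.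
        list_all2 loewner_le Xs Ys \<longrightarrow> F E Xs \<sqsubseteq>\<^sub>L F E Ys))"

definition operator_mean :: "(nat \<Rightarrow> 'h::chilbert_space op_family) \<Rightarrow> bool" where
  "operator_mean F \<longleftrightarrow>
     (\<forall>n>0. free_function n (F n) \<and> operator_monotone n (F n)) \<and>
     (\<forall>n>0. \<forall>E. hilbert E \<longrightarrow> (\<forall>Xs\<in>tuples n E. \<forall>\<sigma>. \<sigma> permutes {..<n} \<longrightarrow>
        F n E (permute_list \<sigma> Xs) = F n E Xs)) \<and>
     (\<forall>n>0. \<forall>k>0. \<forall>E. hilbert E \<longrightarrow> (\<forall>Xs\<in>tuples n E.
        F (n * k) E (concat (map (replicate k) Xs)) = F n E Xs))"

definition extends_mean ::
    "'h::chilbert_space set \<Rightarrow> (nat \<Rightarrow> 'h op_family) \<Rightarrow> ('h operator measure \<Rightarrow> 'h operator) \<Rightarrow> bool" where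
  "extends_mean E F \<Phi> \<longleftrightarrow> (\<forall>n>0. \<forall>Xs\<in>tuples n E. \<Phi> (empirical E Xs) = F n E Xs)"

end

(*
  An operator monotone free function F n is concave: rotating the direct sum of A and B, on two orthogonal
  copies of E, by a 2x2 unitary gives an operator dominated by a block diagonal one whose first block is, up to
  a factor 1 + e, a convex combination of A and B. The same holds for the dual function
  X |-> F n (X^-1)^-1. Symmetry and these two concavities show that replacing a fraction q of the
  arguments by the upper bound M of all arguments, instead of the lower bound m, changes the value by
  a factor of at most exp (4 (M/m)^2 q).

  A measure of bounded support can be squeezed in the stochastic order between two uniform discrete
  measures that agree up to a small scaling and a small fraction of atoms placed at m and M,
  so its image is determined by the images of these. By Hall's marriage theorem,
  the stochastic order of uniform discrete measures is the coordinatewise order after repeating and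
  permuting the atoms; hence the lower and upper bounds obtained in this way are consistent and
  converge to a common limit.
*)

theory Submission
  imports Defs "HOL-Computational_Algebra.Fundamental_Theorem_Algebra"
begin

text \<open>Neither continuity nor homogeneity is assumed, so all regularity has to come out of
  monotonicity and direct sums. The rotated block operator has off-diagonal terms;
  \<open>quad_sum_le\<close> absorbs them at the price of a factor 1 + e in the first corner and 1 +
  1/e in the second. The second corner is harmless, because the value at a block diagonal operator
  is block diagonal. The factor 1 + e disappears afterwards: concavity with this loss already gives
  \<phi>(t x) \<le> t \<phi>(x) for t \<ge> 1, which pulls it out.

  Symmetry and concavity bound the growth in one coordinate from M to 2M, but a concave function may
  be steeper further to the left, between m and M. Under t = 1/s the interval [m, M] becomes
  [1/M, 1/m], which lies to the right of [1/(2M), 1/M], so concavity of the dual function transfers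
  the bound. The first step costs 2 (M/m) / n per coordinate, the second multiplies this by (2M - m)
  / m; hence the constant 4 (M/m)^2. The exponential arises by multiplying over the changed
  coordinates.\<close>

instance chilbert_space \<subseteq> banach ..

section \<open>Complex inner products\<close>

lemma cinner_add_right: "cinner x (y + z) = cinner x y + cinner x z"
  for x :: "'a::complex_inner"
  by (metis cinner_add_left cinner_commute complex_cnj_add)

lemma cinner_scaleC_right: "cinner x (c *\<^sub>C y) = cnj c * cinner x y"
  for x :: "'a::complex_inner"
  by (metis cinner_scaleC_left cinner_commute complex_cnj_mult)

lemma cinner_scaleR_left: "cinner (r *\<^sub>R x) y = r *\<^sub>R cinner x y"
  for x :: "'a::complex_inner"
  by (metis cinner_scaleC_left scaleC_of_real scaleR_conv_of_real)

lemma cinner_scaleR_right: "cinner x (r *\<^sub>R y) = r *\<^sub>R cinner x y"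
  for x :: "'a::complex_inner"
  by (metis cinner_scaleC_right complex_cnj_complex_of_real scaleC_of_real scaleR_conv_of_real)

lemma cinner_self: "cinner x x = of_real (inner x x)"
  for x :: "'a::complex_inner"
proof -
  have "Im (cinner x x) = 0"
    using cinner_commute[of x x] by (metis Reals_cnj_iff complex_is_Real_iff)
  then show ?thesis by (simp add: complex_eq_iff Re_cinner)
qed

lemma Im_cinner: "Im (cinner x y) = inner x (\<i> *\<^sub>C y)"
  for x :: "'a::complex_inner"
  by (simp add: Re_cinner[symmetric] cinner_scaleC_right)

lemma norm_scaleC: "norm (c *\<^sub>C x) = cmod c * norm x"
  for x :: "'a::complex_inner"
proof -
  have "complex_of_real ((norm (c *\<^sub>C x))\<^sup>2) = (c * cnj c) * cinner x x"
    using cinner_self[of "c *\<^sub>C x"]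
    by (simp only: power2_norm_eq_inner) (simp add: cinner_scaleC_left cinner_scaleC_right mult_ac)
  also have "\<dots> = of_real ((cmod c * norm x)\<^sup>2)"
    by (simp only: complex_norm_square[symmetric] cinner_self power2_norm_eq_inner[symmetric]
        power_mult_distrib of_real_mult)
  finally have "(norm (c *\<^sub>C x))\<^sup>2 = (cmod c * norm x)\<^sup>2" by (simp only: of_real_eq_iff)
  then show ?thesis by (simp add: power2_eq_iff_nonneg)
qed

lemma cinner_le_norms: "cmod (cinner x y) \<le> norm x * norm y"
  for x :: "'a::complex_inner"
proof -
  \<comment> \<open>The phase that makes the pairing real and nonnegative, so that the real
    Cauchy-Schwarz inequality applies.\<close>
  define c where "c = cnj (sgn (cinner x y))"
  have "Re (cinner (c *\<^sub>C x) y) = cmod (cinner x y)"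
  proof (cases "cinner x y = 0")
    case False
    have "c * cinner x y = (cinner x y * cnj (cinner x y)) / of_real (cmod (cinner x y))"
      by (simp add: c_def sgn_eq mult.commute)
    also have "\<dots> = of_real (cmod (cinner x y))"
      using False by (simp add: complex_norm_square[symmetric] power2_eq_square)
    finally show ?thesis by (simp add: cinner_scaleC_left)
  qed (simp add: cinner_scaleC_left)
  moreover have "Re (cinner (c *\<^sub>C x) y) \<le> norm (c *\<^sub>C x) * norm y"
    unfolding Re_cinner by (rule norm_cauchy_schwarz)
  moreover have "norm (c *\<^sub>C x) \<le> norm x"
    by (auto simp: norm_scaleC c_def norm_sgn)
  ultimately show ?thesis
    by (smt (verit) mult_right_mono norm_ge_zero)
qed

lemma bounded_linear_cinner_left: "bounded_linear (\<lambda>x. cinner x (y::'a::complex_inner))"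
  by (rule bounded_linear_intro[where K = "norm y"])
     (auto simp: cinner_add_left cinner_scaleR_left cinner_le_norms)

lemma bounded_linear_cinner_right: "bounded_linear (cinner (x::'a::complex_inner))"
  by (rule bounded_linear_intro[where K = "norm x"])
     (auto simp: cinner_add_right cinner_scaleR_right cinner_le_norms mult.commute[of "norm _" "norm x"])

lemma bounded_linear_scaleC: "bounded_linear (\<lambda>x. c *\<^sub>C (x::'a::complex_inner))"
proof (rule bounded_linear_intro[where K = "cmod c"])
  show "c *\<^sub>C r *\<^sub>R x = r *\<^sub>R c *\<^sub>C (x::'a)" for r x
    by (metis mult.commute scaleC_of_real scaleC_scaleC)
qed (auto simp: scaleC_add_right norm_scaleC mult.commute)

lemma bounded_linear_scaleC_left: "bounded_linear (\<lambda>c. c *\<^sub>C (x::'a::complex_inner))"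
proof (rule bounded_linear_intro[where K = "norm x"])
  show "(r *\<^sub>R c) *\<^sub>C x = r *\<^sub>R c *\<^sub>C (x::'a)" for r c
    by (metis scaleC_of_real scaleC_scaleC scaleR_conv_of_real)
qed (auto simp: scaleC_add_left norm_scaleC)

lemmas cinner_zero_left [simp] = linear_0[OF bounded_linear.linear[OF bounded_linear_cinner_left]]
lemmas cinner_zero_right [simp] = linear_0[OF bounded_linear.linear[OF bounded_linear_cinner_right]]
lemmas scaleC_zero_right [simp] = linear_0[OF bounded_linear.linear[OF bounded_linear_scaleC]]
lemmas scaleC_zero_left [simp] = linear_0[OF bounded_linear.linear[OF bounded_linear_scaleC_left]]
lemmas cinner_diff_left = linear_diff[OF bounded_linear.linear[OF bounded_linear_cinner_left]]
lemmas cinner_diff_right = linear_diff[OF bounded_linear.linear[OF bounded_linear_cinner_right]]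
lemmas scaleC_diff_right = linear_diff[OF bounded_linear.linear[OF bounded_linear_scaleC]]
lemmas cinner_sum_left = linear_sum[OF bounded_linear.linear[OF bounded_linear_cinner_left]]
lemmas cinner_sum_right = linear_sum[OF bounded_linear.linear[OF bounded_linear_cinner_right]]

lemma scaleC_one [simp]: "1 *\<^sub>C (x::'a::complex_inner) = x"
  by (metis of_real_1 scaleC_of_real scaleR_one)

lemma scaleC_scaleR: "c *\<^sub>C r *\<^sub>R x = r *\<^sub>R c *\<^sub>C (x::'a::complex_inner)"
  by (metis mult.commute scaleC_of_real scaleC_scaleC)

lemma scaleC_eq_Re_Im: "c *\<^sub>C x = Re c *\<^sub>R x + Im c *\<^sub>R (\<i> *\<^sub>C (x::'a::complex_inner))"
proof -
  have "c = complex_of_real (Re c) + complex_of_real (Im c) * \<i>"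
    by (simp add: complex_eq_iff)
  then have "c *\<^sub>C x = (complex_of_real (Re c) + complex_of_real (Im c) * \<i>) *\<^sub>C x"
    by (rule arg_cong)
  also have "\<dots> = Re c *\<^sub>R x + Im c *\<^sub>R (\<i> *\<^sub>C x)"
    by (simp only: scaleC_add_left scaleC_scaleC[symmetric] scaleC_of_real)
  finally show ?thesis .
qed

section \<open>Orthonormal expansions\<close>

text \<open>An indexed family instead of a set: one index set can then carry two families
  \<open>g\<close> and \<open>h\<close>, between which \<open>expansion_op\<close> maps.\<close>

definition orthonormal_family :: "'b set \<Rightarrow> ('b \<Rightarrow> 'a::complex_inner) \<Rightarrow> bool" where
  "orthonormal_family B g \<longleftrightarrow> (\<forall>a\<in>B. \<forall>b\<in>B. cinner (g a) (g b) = (if a = b then 1 else 0))"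

lemma orthonormal_familyD:
  "orthonormal_family B g \<Longrightarrow> a \<in> B \<Longrightarrow> b \<in> B \<Longrightarrow> cinner (g a) (g b) = (if a = b then 1 else 0)"
  unfolding orthonormal_family_def by blast

lemma inner_expansion:
  assumes "orthonormal_family B g" "finite S" "S \<subseteq> B" "b \<in> S"
  shows "cinner (\<Sum>a\<in>S. c a *\<^sub>C g a) (g b) = c b"
proof -
  have "cinner (\<Sum>a\<in>S. c a *\<^sub>C g a) (g b) = (\<Sum>a\<in>S. c a * cinner (g a) (g b))"
    by (simp add: cinner_sum_left cinner_scaleC_left)
  also have "\<dots> = (\<Sum>a\<in>S. if a = b then c a else 0)"
  proof (intro sum.cong refl)
    fix a assume "a \<in> S"
    then show "c a * cinner (g a) (g b) = (if a = b then c a else 0)"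
      using orthonormal_familyD[OF assms(1) subsetD[OF assms(3)] subsetD[OF assms(3)], of a b] assms(4) by auto
  qed
  also have "\<dots> = c b" using assms by simp
  finally show ?thesis .
qed

lemma cinner_expansion_expansion:
  assumes "orthonormal_family B g" "finite S" "S \<subseteq> B"
  shows "cinner x (\<Sum>a\<in>S. cinner x (g a) *\<^sub>C g a) = of_real (\<Sum>a\<in>S. (cmod (cinner x (g a)))\<^sup>2)"
proof -
  have "cinner x (\<Sum>a\<in>S. cinner x (g a) *\<^sub>C g a) = (\<Sum>a\<in>S. cinner x (g a) * cnj (cinner x (g a)))"
    by (simp add: cinner_sum_right cinner_scaleC_right mult.commute)
  then show ?thesis by (simp only: of_real_sum complex_norm_square)
qed

lemma norm_expansion:
  assumes "orthonormal_family B g" "finite S" "S \<subseteq> B"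
  shows "(norm (\<Sum>a\<in>S. c a *\<^sub>C g a))\<^sup>2 = (\<Sum>a\<in>S. (cmod (c a))\<^sup>2)"
proof -
  let ?x = "\<Sum>a\<in>S. c a *\<^sub>C g a"
  have "cinner ?x ?x = (\<Sum>b\<in>S. cnj (c b) * cinner ?x (g b))"
    by (subst cinner_sum_right) (simp add: cinner_scaleC_right)
  also have "\<dots> = (\<Sum>b\<in>S. cnj (c b) * c b)"
    by (intro sum.cong refl) (simp add: inner_expansion[OF assms])
  also have "\<dots> = of_real (\<Sum>a\<in>S. (cmod (c a))\<^sup>2)"
    by (simp only: of_real_sum complex_norm_square mult.commute)
  finally show ?thesis
    unfolding cinner_self power2_norm_eq_inner by (simp only: of_real_eq_iff)
qed

text \<open>The squared distance of \<open>x\<close> from its partial expansion is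
  nonnegative.\<close>

lemma bessel_finite:
  assumes "orthonormal_family B g" "finite S" "S \<subseteq> B"
  shows "(\<Sum>a\<in>S. (cmod (cinner x (g a)))\<^sup>2) \<le> (norm x)\<^sup>2"
proof -
  let ?s = "\<Sum>a\<in>S. (cmod (cinner x (g a)))\<^sup>2" and ?y = "\<Sum>a\<in>S. cinner x (g a) *\<^sub>C g a"
  have "inner x ?y = ?s"
    using cinner_expansion_expansion[OF assms, of x] by (metis Re_cinner Re_complex_of_real)
  moreover have "inner ?y ?y = ?s"
    using norm_expansion[OF assms] by (simp add: power2_norm_eq_inner)
  moreover have "0 \<le> inner (x - ?y) (x - ?y)" by simp
  ultimately show ?thesis
    by (simp add: inner_diff inner_commute power2_norm_eq_inner)
qed

text \<open>By orthonormality the squared norm of a finite sum is the sum of the squared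
  coefficients, so the Cauchy property of the scalar net passes to the vectors. The index set may be
  uncountable, which is why the net of finite subsets is used.\<close>

lemma expansion_summable:
  fixes h :: "'b \<Rightarrow> 'a::chilbert_space"
  assumes h: "orthonormal_family B h" and c: "(\<lambda>b. (cmod (c b))\<^sup>2) summable_on B"
  shows "(\<lambda>b. c b *\<^sub>C h b) summable_on B"
proof -
  let ?f = "\<lambda>b. c b *\<^sub>C h b" and ?n = "\<lambda>b. (cmod (c b))\<^sup>2"
  from c obtain L where lim: "(sum ?n \<longlongrightarrow> L) (finite_subsets_at_top B)"
    unfolding summable_on_def has_sum_def by blast
  have "\<exists>P. eventually P (finite_subsets_at_top B) \<and>
          (\<forall>F F'. P F \<and> P F' \<longrightarrow> dist (sum ?f F) (sum ?f F') < e)" if "e > 0" for e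
  proof -
    \<comment> \<open>Two partial sums within d of the limit differ by less than 2 d = (e/3)^2, a
      bound for the squared norm of the difference of the vectors.\<close>
    define d where "d = (e/3)\<^sup>2 / 2"
    have "d > 0" using that by (simp add: d_def)
    have "\<forall>\<^sub>F F in finite_subsets_at_top B. dist (sum ?n F) L < d"
      using lim \<open>d > 0\<close> by (simp add: tendsto_iff)
    then obtain F0 where F0: "finite F0" "F0 \<subseteq> B"
      and ev: "\<forall>F. finite F \<and> F0 \<subseteq> F \<and> F \<subseteq> B \<longrightarrow> dist (sum ?n F) L < d"
      unfolding eventually_finite_subsets_at_top by (elim exE conjE)
    have F0': "dist (sum ?n F) L < d" if "finite F" "F0 \<subseteq> F" "F \<subseteq> B" for F
      using ev that by simp
    have near: "dist (sum ?f F) (sum ?f F0) \<le> e/3" if F: "finite F" "F0 \<subseteq> F" "F \<subseteq> B" for F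
    proof -
      have "dist (sum ?f F) (sum ?f F0) = norm (sum ?f (F - F0))"
        unfolding dist_norm using F F0 by (subst sum_diff) auto
      moreover have "(norm (sum ?f (F - F0)))\<^sup>2 = sum ?n (F - F0)"
        by (rule norm_expansion[OF h]) (use F in auto)
      moreover have "sum ?n (F - F0) = sum ?n F - sum ?n F0"
        using F F0 by (subst sum_diff) auto
      moreover have "sum ?n F - sum ?n F0 < 2 * d"
        using F0'[OF F] F0'[OF F0(1) order_refl F0(2)] unfolding dist_real_def by linarith
      ultimately have "(dist (sum ?f F) (sum ?f F0))\<^sup>2 \<le> (e/3)\<^sup>2" by (simp add: d_def)
      then show ?thesis using \<open>e > 0\<close> by (simp add: power2_le_iff_abs_le)
    qed
    let ?P = "\<lambda>F. finite F \<and> F0 \<subseteq> F \<and> F \<subseteq> B"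
    have "eventually ?P (finite_subsets_at_top B)"
      unfolding eventually_finite_subsets_at_top using F0 by blast
    moreover have "dist (sum ?f F) (sum ?f F') < e" if "?P F" "?P F'" for F F'
      using near[of F] near[of F'] that dist_triangle2[of "sum ?f F" "sum ?f F'" "sum ?f F0"] \<open>e > 0\<close>
      by linarith
    ultimately show ?thesis by (intro exI[of _ ?P]) blast
  qed
  then have "cauchy_filter (filtermap (sum ?f) (finite_subsets_at_top B))"
    by (simp add: cauchy_filter_metric_filtermap)
  then obtain L' where "(sum ?f \<longlongrightarrow> L') (finite_subsets_at_top B)"
    using complete_uniform[where S="UNIV::'a set"] complete_UNIV by (force simp add: filterlim_def)
  then show ?thesis using summable_on_def has_sum_def by blast
qed

lemma bessel_summable:
  assumes "orthonormal_family B g"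
  shows "(\<lambda>b. (cmod (cinner x (g b)))\<^sup>2) summable_on B"
  by (rule nonneg_bdd_above_summable_on) (auto intro!: bdd_aboveI2 bessel_finite[OF assms])

text \<open>The partial isometry that sends \<open>g b\<close> to \<open>h b\<close> and vanishes on
  the orthogonal complement of all \<open>g b\<close>; for \<open>g = h\<close> it is an orthogonal
  projection. \<open>Blinfun\<close> is meaningful here by \<open>bounded_linear_expansion\<close>,
  where Bessel's inequality gives the norm bound 1.\<close>

definition expansion_op :: "'b set \<Rightarrow> ('b \<Rightarrow> 'h) \<Rightarrow> ('b \<Rightarrow> 'h) \<Rightarrow> 'h::chilbert_space operator" where
  "expansion_op B g h = Blinfun (\<lambda>x. \<Sum>\<^sub>\<infinity>b\<in>B. cinner x (g b) *\<^sub>C h b)"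

context
  fixes B :: "'b set" and g h :: "'b \<Rightarrow> 'h::chilbert_space"
  assumes g: "orthonormal_family B g" and h: "orthonormal_family B h"
begin

lemma expansion_has_sum_aux:
  "((\<lambda>b. cinner x (g b) *\<^sub>C h b) has_sum (\<Sum>\<^sub>\<infinity>b\<in>B. cinner x (g b) *\<^sub>C h b)) B"
  using expansion_summable[OF h bessel_summable[OF g]] by (simp add: summable_iff_has_sum_infsum)

lemma bounded_linear_expansion: "bounded_linear (\<lambda>x. \<Sum>\<^sub>\<infinity>b\<in>B. cinner x (g b) *\<^sub>C h b)"
proof (rule bounded_linear_intro[where K = 1])
  note hs = expansion_has_sum_aux
  show "(\<Sum>\<^sub>\<infinity>b\<in>B. cinner (x + y) (g b) *\<^sub>C h b) =
     (\<Sum>\<^sub>\<infinity>b\<in>B. cinner x (g b) *\<^sub>C h b) + (\<Sum>\<^sub>\<infinity>b\<in>B. cinner y (g b) *\<^sub>C h b)" for x y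
    using has_sum_add[OF hs[of x] hs[of y]]
    by (intro infsumI) (simp add: cinner_add_left scaleC_add_left)
  show "(\<Sum>\<^sub>\<infinity>b\<in>B. cinner (r *\<^sub>R x) (g b) *\<^sub>C h b) = r *\<^sub>R (\<Sum>\<^sub>\<infinity>b\<in>B. cinner x (g b) *\<^sub>C h b)" for r x
    using has_sum_bounded_linear[OF bounded_linear_scaleR_right[of r] hs[of x]]
    by (intro infsumI) (simp add: cinner_scaleR_left o_def scaleR_conv_of_real scaleC_scaleC[symmetric] scaleC_of_real)
  show "norm (\<Sum>\<^sub>\<infinity>b\<in>B. cinner x (g b) *\<^sub>C h b) \<le> norm x * 1" for x
  proof -
    let ?f = "\<lambda>b. cinner x (g b) *\<^sub>C h b"
    have "((\<lambda>F. norm (sum ?f F)) \<longlongrightarrow> norm (infsum ?f B)) (finite_subsets_at_top B)"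
      using hs[of x] unfolding has_sum_def by (rule tendsto_norm)
    moreover have "\<forall>\<^sub>F F in finite_subsets_at_top B. norm (sum ?f F) \<le> norm x"
    proof (rule eventually_finite_subsets_at_top_weakI)
      fix F assume F: "finite F" "F \<subseteq> B"
      have "(norm (sum ?f F))\<^sup>2 \<le> (norm x)\<^sup>2"
        using norm_expansion[OF h F] bessel_finite[OF g F] by simp
      then show "norm (sum ?f F) \<le> norm x" by simp
    qed
    ultimately show ?thesis
      by (simp add: tendsto_upperbound[OF _ _ finite_subsets_at_top_neq_bot])
  qed
qed

lemma expansion_has_sum:
  "((\<lambda>b. cinner x (g b) *\<^sub>C h b) has_sum expansion_op B g h x) B"
  unfolding expansion_op_def bounded_linear_Blinfun_apply[OF bounded_linear_expansion]
  by (rule expansion_has_sum_aux)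

lemma expansion_op_scaleC: "expansion_op B g h (c *\<^sub>C x) = c *\<^sub>C expansion_op B g h x"
proof (rule has_sum_unique[OF expansion_has_sum])
  show "((\<lambda>b. cinner (c *\<^sub>C x) (g b) *\<^sub>C h b) has_sum c *\<^sub>C expansion_op B g h x) B"
    using has_sum_bounded_linear[OF bounded_linear_scaleC[of c] expansion_has_sum[of x]]
    by (simp add: cinner_scaleC_left o_def scaleC_scaleC)
qed

lemma expansion_op_closed:
  assumes "hilbert E" "h ` B \<subseteq> E"
  shows "expansion_op B g h x \<in> E"
proof -
  have "sum (\<lambda>b. cinner x (g b) *\<^sub>C h b) F \<in> E" if "finite F" "F \<subseteq> B" for F
    using that by (induction F rule: finite_induct) (use assms in \<open>auto simp: hilbert_def\<close>)
  then have "\<forall>\<^sub>F F in finite_subsets_at_top B. sum (\<lambda>b. cinner x (g b) *\<^sub>C h b) F \<in> E"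
    by (intro eventually_finite_subsets_at_top_weakI)
  moreover have "closed E" using assms by (simp add: hilbert_def)
  ultimately show ?thesis
    using Lim_in_closed_set[OF _ _ finite_subsets_at_top_neq_bot expansion_has_sum[of x, unfolded has_sum_def]]
    by blast
qed

end

text \<open>Both sides are the sum of the same series; the adjoint exchanges the two
  families.\<close>

lemma cinner_expansion_op:
  assumes g: "orthonormal_family B g" and h: "orthonormal_family B h"
  shows "cinner (expansion_op B g h x) y = cinner x (expansion_op B h g y)"
proof (rule has_sum_unique)
  show "((\<lambda>b. cinner x (g b) * cinner (h b) y) has_sum cinner (expansion_op B g h x) y) B"
    using has_sum_bounded_linear[OF bounded_linear_cinner_left[of y] expansion_has_sum[OF g h, of x]]
    by (simp add: o_def cinner_scaleC_left)
  show "((\<lambda>b. cinner x (g b) * cinner (h b) y) has_sum cinner x (expansion_op B h g y)) B"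
    using has_sum_bounded_linear[OF bounded_linear_cinner_right[of x] expansion_has_sum[OF h g, of y]]
    by (simp add: o_def cinner_scaleC_right mult.commute cinner_commute[of "h _" y])
qed

lemma expansion_op_basis:
  assumes g: "orthonormal_family B g" and h: "orthonormal_family B h" and "b \<in> B"
  shows "expansion_op B g h (g b) = h b"
proof (rule has_sum_unique[OF expansion_has_sum[OF g h]])
  show "((\<lambda>c. cinner (g b) (g c) *\<^sub>C h c) has_sum h b) B"
  proof (rule has_sum_finite_neutralI[of "{b}"])
    show "h b = (\<Sum>c\<in>{b}. cinner (g b) (g c) *\<^sub>C h c)"
      using orthonormal_familyD[OF g \<open>b \<in> B\<close> \<open>b \<in> B\<close>] by simp
    show "cinner (g b) (g x) *\<^sub>C h x = 0" if "x \<in> B - {b}" for x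
      using orthonormal_familyD[OF g \<open>b \<in> B\<close>, of x] that by auto
  qed (use \<open>b \<in> B\<close> in auto)
qed

lemma expansion_op_orthogonal:
  assumes g: "orthonormal_family B g" and h: "orthonormal_family B h"
    and "\<And>b. b \<in> B \<Longrightarrow> cinner x (g b) = 0"
  shows "expansion_op B g h x = 0"
  by (rule has_sum_unique[OF expansion_has_sum[OF g h]], rule has_sum_0) (simp add: assms)

text \<open>Zorn's lemma gives a maximal orthonormal subset of E. A vector of E that differs from
  its expansion leaves a residual in E orthogonal to the subset, and the normalised residual could
  be added.\<close>

lemma exists_maximal_orthonormal:
  assumes E: "hilbert E"
  obtains B where "B \<subseteq> E" "orthonormal_family B (\<lambda>b. b)"
    "\<And>x. x \<in> E \<Longrightarrow> expansion_op B (\<lambda>b. b) (\<lambda>b. b) x = x"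
proof -
  let ?A = "{B. B \<subseteq> E \<and> orthonormal_family B (\<lambda>b. b)}"
  have "\<exists>M\<in>?A. \<forall>X\<in>?A. M \<subseteq> X \<longrightarrow> X = M"
  proof (rule subset_Zorn')
    fix C assume C: "subset.chain ?A C"
    have "orthonormal_family (\<Union>C) (\<lambda>b. b)"
      unfolding orthonormal_family_def
    proof (intro ballI)
      fix a b assume "a \<in> \<Union>C" "b \<in> \<Union>C"
      then obtain X Y where XY: "X \<in> C" "Y \<in> C" "a \<in> X" "b \<in> Y" by blast
      then have "X \<subseteq> Y \<or> Y \<subseteq> X" using C by (auto simp: subset_chain_def)
      then obtain Z where "Z \<in> C" "a \<in> Z" "b \<in> Z" using XY by blast
      moreover have "orthonormal_family Z (\<lambda>b. b)" using C \<open>Z \<in> C\<close> by (auto simp: subset_chain_def)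
      ultimately show "cinner a b = (if a = b then 1 else 0)" by (auto simp: orthonormal_family_def)
    qed
    moreover have "\<Union>C \<subseteq> E" using C by (auto simp: subset_chain_def)
    ultimately show "\<Union>C \<in> ?A" by blast
  qed
  then obtain B where "B \<in> ?A" and max: "\<forall>X\<in>?A. B \<subseteq> X \<longrightarrow> X = B" by (elim bexE)
  then have B: "B \<subseteq> E" "orthonormal_family B (\<lambda>b. b)" by simp_all
  let ?P = "expansion_op B (\<lambda>b. b) (\<lambda>b. b)"
  have "?P x = x" if "x \<in> E" for x
  proof (rule ccontr)
    define z where "z = x - ?P x"
    assume "?P x \<noteq> x"
    then have "z \<noteq> 0" by (simp add: z_def)
    have "?P x \<in> E" using expansion_op_closed[OF B(2,2) E] B by auto
    then have "x + (-1) *\<^sub>C ?P x \<in> E" using that E by (auto simp: hilbert_def)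
    moreover have "(-1) *\<^sub>C ?P x = - ?P x" by (metis of_real_1 of_real_minus scaleC_of_real scaleR_minus1_left)
    ultimately have "z \<in> E" by (simp add: z_def)
    have orth: "cinner z b = 0" if "b \<in> B" for b
      using cinner_expansion_op[OF B(2,2), of x b] expansion_op_basis[OF B(2,2) that]
      by (simp add: z_def cinner_diff_left)
    define u where "u = complex_of_real (1 / norm z) *\<^sub>C z"
    have u: "u \<in> E" using \<open>z \<in> E\<close> E by (auto simp: hilbert_def u_def)
    have "norm u = 1" using \<open>z \<noteq> 0\<close> by (simp add: u_def norm_scaleC norm_divide)
    then have uu: "cinner u u = 1" by (simp add: cinner_self power2_norm_eq_inner[symmetric])
    have ub: "cinner u b = 0" if "b \<in> B" for b
      using orth[OF that] by (simp add: u_def cinner_scaleC_left)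
    have bu: "cinner b u = 0" if "b \<in> B" for b
      using ub[OF that] cinner_commute[of b u] by simp
    have "orthonormal_family (insert u B) (\<lambda>b. b)"
      unfolding orthonormal_family_def
    proof (intro ballI)
      fix a b assume "a \<in> insert u B" "b \<in> insert u B"
      then consider "a = u" "b = u" | "a = u" "b \<in> B" | "a \<in> B" "b = u" | "a \<in> B" "b \<in> B" by blast
      then show "cinner a b = (if a = b then 1 else 0)"
        by cases (use uu ub bu orthonormal_familyD[OF B(2), of a b] in auto)
    qed
    then have "insert u B = B" using max B(1) u by blast
    then have "u \<in> B" by blast
    then show False using ub uu by fastforce
  qed
  then show thesis using that B by blast
qed

section \<open>Two isometric copies of the ambient space with orthogonal ranges\<close>

lemma hilbert_UNIV: "hilbert UNIV" by (simp add: hilbert_def)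

text \<open>The isometries come from a bijection of two copies of an orthonormal basis with that basis.\<close>

lemma exists_orthogonal_isometries:
  assumes inf: "\<not> (\<exists>B :: 'h::chilbert_space set. finite B \<and> span B = UNIV)"
  obtains V1 V2 W1 W2 :: "'h::chilbert_space operator" where
    "\<And>c x. V1 (c *\<^sub>C x) = c *\<^sub>C V1 x" "\<And>c x. V2 (c *\<^sub>C x) = c *\<^sub>C V2 x"
    "\<And>c x. W1 (c *\<^sub>C x) = c *\<^sub>C W1 x" "\<And>c x. W2 (c *\<^sub>C x) = c *\<^sub>C W2 x"
    "\<And>x y. cinner (V1 x) y = cinner x (W1 y)" "\<And>x y. cinner (V2 x) y = cinner x (W2 y)"
    "\<And>x. W1 (V1 x) = x" "\<And>x. W2 (V2 x) = x" "\<And>x. W1 (V2 x) = 0" "\<And>x. W2 (V1 x) = 0"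
proof -
  obtain B :: "'h set" where B: "orthonormal_family B (\<lambda>b. b)"
    and complete: "\<And>x. expansion_op B (\<lambda>b. b) (\<lambda>b. b) x = x"
    using exists_maximal_orthonormal[OF hilbert_UNIV] by (metis UNIV_I)
  have "infinite B"
  proof
    assume fin: "finite B"
    \<comment> \<open>\<open>span\<close> is the real span, so complex coefficients require the
      vectors \<open>\<i> *\<^sub>C b\<close> besides the \<open>b\<close>.\<close>
    have "x \<in> span (B \<union> (\<lambda>b. \<i> *\<^sub>C b) ` B)" for x
    proof -
      have "(\<Sum>b\<in>B. cinner x b *\<^sub>C b) = x"
        using has_sum_unique[OF expansion_has_sum[OF B B, of x] has_sum_finite[OF fin]] unfolding complete by (rule sym)
      then have "x = (\<Sum>b\<in>B. cinner x b *\<^sub>C b)" by (rule sym)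
      also have "\<dots> = (\<Sum>b\<in>B. Re (cinner x b) *\<^sub>R b + Im (cinner x b) *\<^sub>R (\<i> *\<^sub>C b))"
        by (intro sum.cong refl scaleC_eq_Re_Im)
      also have "\<dots> \<in> span (B \<union> (\<lambda>b. \<i> *\<^sub>C b) ` B)"
        by (intro span_sum span_add span_scale span_base) auto
      finally show ?thesis .
    qed
    then have "span (B \<union> (\<lambda>b. \<i> *\<^sub>C b) ` B) = UNIV" by (simp add: set_eq_iff)
    moreover have "finite (B \<union> (\<lambda>b. \<i> *\<^sub>C b) ` B)" using fin by simp
    ultimately show False using inf by (elim notE) (intro exI conjI)
  qed
  then have "\<exists>\<phi>. bij_betw \<phi> (B <+> B) B"
    by (rule iffD2[OF card_of_ordIso card_of_Plus_infinite1[OF _ card_of_mono1[OF subset_refl]]])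
  then obtain \<phi> where \<phi>: "bij_betw \<phi> (B <+> B) B" by (elim exE)
  define f1 f2 where "f1 = \<phi> \<circ> Inl" and "f2 = \<phi> \<circ> Inr"
  have inj: "inj_on \<phi> (B <+> B)" and im: "\<phi> ` (B <+> B) = B" using \<phi> by (auto simp: bij_betw_def)
  have f: "f1 b \<in> B" "f2 b \<in> B" if "b \<in> B" for b using im that by (auto simp: f1_def f2_def)
  have f_eq: "f1 a = f1 b \<longleftrightarrow> a = b" "f2 a = f2 b \<longleftrightarrow> a = b" "f1 a \<noteq> f2 b" if "a \<in> B" "b \<in> B" for a b
    using inj that by (auto simp: f1_def f2_def inj_on_def)
  have F: "orthonormal_family B f1" "orthonormal_family B f2"
    unfolding orthonormal_family_def using orthonormal_familyD[OF B] f f_eq by simp_all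
  have orth: "cinner (f1 a) (f2 b) = 0" "cinner (f2 b) (f1 a) = 0" if "a \<in> B" "b \<in> B" for a b
    using orthonormal_familyD[OF B f(1) f(2), OF that] orthonormal_familyD[OF B f(2) f(1), OF that(2,1)] 
      f_eq(3)[OF that] by (simp_all del: f_eq)
  let ?T = "expansion_op B"
  let ?i = "\<lambda>b::'h. b"
  \<comment> \<open>The coefficients of \<open>?T ?i f x\<close> along \<open>f\<close> are those of
    \<open>x\<close> along the basis, so expanding them in the basis returns
    \<open>x\<close>.\<close>
  have inv: "?T f ?i (?T ?i f x) = x" if f: "orthonormal_family B f" for f x
  proof -
    have "((\<lambda>b. cinner (?T ?i f x) (f b) *\<^sub>C b) has_sum x) B"
    proof -
      have "cinner (?T ?i f x) (f b) = cinner x b" if "b \<in> B" for b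
        using cinner_expansion_op[OF B f] expansion_op_basis[OF f B that] by simp
      then show ?thesis
        using expansion_has_sum[OF B B, of x] unfolding complete by (simp cong: has_sum_cong)
    qed
    then show ?thesis using expansion_has_sum[OF f B] has_sum_unique by blast
  qed
  have zero: "?T f ?i (?T ?i f' x) = 0"
    if f: "orthonormal_family B f" "orthonormal_family B f'"
      and o: "\<And>a b. a \<in> B \<Longrightarrow> b \<in> B \<Longrightarrow> cinner (f b) (f' a) = 0" for f f' x
  proof (rule expansion_op_orthogonal[OF f(1) B])
    fix b assume "b \<in> B"
    then show "cinner (?T ?i f' x) (f b) = 0"
      using cinner_expansion_op[OF B f(2)] expansion_op_orthogonal[OF f(2) B] o by simp
  qed
  show thesis
    by (rule that[of "?T ?i f1" "?T ?i f2" "?T f1 ?i" "?T f2 ?i"])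
       (intro expansion_op_scaleC cinner_expansion_op inv zero B F orth; assumption)+
qed

section \<open>Bounded operators on closed subspaces\<close>

lemma hilbertD:
  assumes "hilbert E"
  shows "0 \<in> E" "x \<in> E \<Longrightarrow> y \<in> E \<Longrightarrow> x + y \<in> E" "x \<in> E \<Longrightarrow> c *\<^sub>C x \<in> E" "x \<in> E \<Longrightarrow> r *\<^sub>R x \<in> E"
    "x \<in> E \<Longrightarrow> y \<in> E \<Longrightarrow> x - y \<in> E" "closed E"
proof -
  show 1: "0 \<in> E" "x \<in> E \<Longrightarrow> y \<in> E \<Longrightarrow> x + y \<in> E" "\<And>c x. x \<in> E \<Longrightarrow> c *\<^sub>C x \<in> E" "closed E" for x y
    using assms by (auto simp: hilbert_def)
  show r: "x \<in> E \<Longrightarrow> r *\<^sub>R x \<in> E" for r x using 1(3) by (metis scaleC_of_real)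
  show "x \<in> E \<Longrightarrow> y \<in> E \<Longrightarrow> x - y \<in> E"
    using 1(2)[of x "(-1) *\<^sub>R y"] r[of y "-1"] by simp
qed

definition clin :: "'h::chilbert_space operator \<Rightarrow> bool" where
  "clin T \<longleftrightarrow> (\<forall>c x. T (c *\<^sub>C x) = c *\<^sub>C T x)"

text \<open>The real inner product suffices: for complex-linear operators
  \<open>selfadj_cinner\<close> recovers the complex identity.\<close>

definition selfadj :: "'h::chilbert_space operator \<Rightarrow> bool" where
  "selfadj T \<longleftrightarrow> (\<forall>x y. inner (T x) y = inner x (T y))"

lemma clinD: "clin T \<Longrightarrow> T (c *\<^sub>C x) = c *\<^sub>C T x"
  unfolding clin_def by blast

lemma selfadjD: "selfadj T \<Longrightarrow> inner (T x) y = inner x (T y)"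
  unfolding selfadj_def by blast

text \<open>The imaginary part is the real inner product with \<open>\<i> *\<^sub>C y\<close>, to
  which the first assumption applies after moving the factor through \<open>g\<close>.\<close>

lemma cinner_eqI:
  assumes "\<And>x y. inner (f x) y = inner x (g y)" "\<And>c y. g (c *\<^sub>C y) = c *\<^sub>C g y"
  shows "cinner (f x) y = cinner x (g y)"
  by (rule complex_eqI) (simp_all only: Re_cinner Im_cinner assms(2)[symmetric] assms(1))

lemma selfadj_cinner: "clin T \<Longrightarrow> selfadj T \<Longrightarrow> cinner (T x) y = cinner x (T y)"
  by (rule cinner_eqI) (auto simp: clinD selfadjD)

lemma ex_projection:
  assumes E: "hilbert E"
  shows "\<exists>P. P \<in> bounded_ops E E \<and> (\<forall>x\<in>E. blinfun_apply P x = x) \<and> (\<forall>x y. inner (P x) y = inner x (P y))"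
proof -
  obtain B where B: "B \<subseteq> E" "orthonormal_family B (\<lambda>b. b)"
    and id: "\<And>x. x \<in> E \<Longrightarrow> expansion_op B (\<lambda>b. b) (\<lambda>b. b) x = x"
    by (rule exists_maximal_orthonormal[OF E]) (assumption | rule that)+
  let ?P = "expansion_op B (\<lambda>b. b) (\<lambda>b. b)"
  have "?P \<in> bounded_ops E E"
    unfolding bounded_ops_def
  proof (intro CollectI conjI allI impI)
    show "?P (c *\<^sub>C x) = c *\<^sub>C ?P x" for c x by (rule expansion_op_scaleC[OF B(2,2)])
    show "?P x \<in> E" for x by (rule expansion_op_closed[OF B(2,2) E]) (use B in auto)
    show "?P x = 0" if "\<forall>y\<in>E. cinner x y = 0" for x
      by (rule expansion_op_orthogonal[OF B(2,2)]) (use B that in auto)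
  qed
  moreover have "inner (?P x) y = inner x (?P y)" for x y
    using arg_cong[OF cinner_expansion_op[OF B(2,2), of x y], of Re] by (simp only: Re_cinner)
  ultimately show ?thesis using id by blast
qed

lemma bounded_opsD:
  assumes "T \<in> bounded_ops K E"
  shows "T (c *\<^sub>C x) = c *\<^sub>C T x" "T x \<in> E" "(\<And>y. y \<in> K \<Longrightarrow> cinner x y = 0) \<Longrightarrow> T x = 0"
  using assms by (auto simp: bounded_ops_def)

context
  fixes E :: "'h::chilbert_space set"
  assumes E: "hilbert E"
begin

text \<open>The residual \<open>x - P x\<close> is orthogonal to E and therefore killed by
  \<open>T\<close>.\<close>

lemma projection_residual_aux:
  assumes P: "P \<in> bounded_ops E E" "\<forall>x\<in>E. blinfun_apply P x = x" "\<forall>x y. inner (P x) y = inner x (P y)"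
  shows "T \<in> bounded_ops E K \<Longrightarrow> T x = T (P x)"
proof -
  assume T: "T \<in> bounded_ops E K"
  have "cinner (x - P x) y = 0" if "y \<in> E" for y
    using cinner_eqI[of "blinfun_apply P" "blinfun_apply P" x y] P that bounded_opsD(1)[OF P(1)]
    by (simp add: cinner_diff_left)
  then have "T (x - P x) = 0" using bounded_opsD(3)[OF T, of "x - P x"] by blast
  then show "T x = T (P x)" by (simp add: blinfun.diff_right)
qed

text \<open>The definite description denotes the orthogonal projection: any other candidate factors
  through the projection \<open>P\<close> and fixes its range, hence equals
  \<open>P\<close>.\<close>

lemma id_op_props:
  shows "id_op E \<in> bounded_ops E E" "x \<in> E \<Longrightarrow> id_op E x = x" "inner (id_op E x) y = inner x (id_op E y)"
proof -
  obtain P where P: "P \<in> bounded_ops E E" "\<forall>x\<in>E. blinfun_apply P x = x" "\<forall>x y. inner (P x) y = inner x (P y)"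
    using ex_projection[OF E] by blast
  have "id_op E = P"
    unfolding id_op_def
  proof (rule the_equality)
    show "P \<in> bounded_ops E E \<and> (\<forall>x\<in>E. blinfun_apply P x = x)" using P by simp
    fix Q assume Q: "Q \<in> bounded_ops E E \<and> (\<forall>x\<in>E. blinfun_apply Q x = x)"
    show "Q = P"
    proof (rule blinfun_eqI)
      fix x
      have "Q x = Q (P x)" using projection_residual_aux[OF P] Q by blast
      also have "\<dots> = P x" using Q bounded_opsD(2)[OF P(1)] by blast
      finally show "Q x = P x" .
    qed
  qed
  then show "id_op E \<in> bounded_ops E E" "x \<in> E \<Longrightarrow> id_op E x = x" "inner (id_op E x) y = inner x (id_op E y)"
    using P by auto
qed

lemma bounded_ops_id_op:
  assumes "T \<in> bounded_ops E K"
  shows "T (id_op E x) = T x"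
  using projection_residual_aux[of "id_op E", OF _ _ _ assms] id_op_props by metis

lemma id_op_bounded_ops:
  assumes "T \<in> bounded_ops K E"
  shows "id_op E (T x) = T x"
  using id_op_props(2) bounded_opsD(2)[OF assms] by blast

lemma id_op_in [simp]: "id_op E x \<in> E"
  using bounded_opsD(2)[OF id_op_props(1)] .

lemma clin_id_op: "clin (id_op E)"
  unfolding clin_def using bounded_opsD(1)[OF id_op_props(1)] by blast

lemma selfadj_id_op: "selfadj (id_op E)"
  unfolding selfadj_def using id_op_props(3) by blast

lemma inner_id_op: "inner (id_op E x) x = inner (id_op E x) (id_op E x)"
  using id_op_props(3)[of "id_op E x" x] id_op_props(2)[OF id_op_in] by (simp add: inner_commute)

lemma norm_id_op_le: "norm (id_op E x) \<le> norm x"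
proof -
  have "(norm (id_op E x))\<^sup>2 \<le> norm (id_op E x) * norm x"
    using norm_cauchy_schwarz[of "id_op E x" x] by (simp add: power2_norm_eq_inner inner_id_op)
  then show ?thesis by (cases "norm (id_op E x) = 0") (auto simp: power2_eq_square)
qed

lemma id_op_orthogonal: "(\<And>y. y \<in> E \<Longrightarrow> cinner x y = 0) \<Longrightarrow> id_op E x = 0"
  using bounded_opsD(3)[OF id_op_props(1)] .

end

text \<open>Vanishing on the orthogonal complement becomes an equation with the projection; in this
  form the class is easily seen to be closed under sums, products and limits.\<close>

lemma bounded_ops_iff:
  assumes "hilbert K" "hilbert E"
  shows "T \<in> bounded_ops K E \<longleftrightarrow> clin T \<and> (\<forall>x. T x \<in> E) \<and> (\<forall>x. T (id_op K x) = T x)"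
proof
  assume T: "T \<in> bounded_ops K E"
  then show "clin T \<and> (\<forall>x. T x \<in> E) \<and> (\<forall>x. T (id_op K x) = T x)"
    using bounded_opsD[OF T] bounded_ops_id_op[OF assms(1) T] by (auto simp: clin_def)
next
  assume T: "clin T \<and> (\<forall>x. T x \<in> E) \<and> (\<forall>x. T (id_op K x) = T x)"
  have "T x = 0" if "\<forall>y\<in>K. cinner x y = 0" for x
    using T id_op_orthogonal[OF assms(1), of x] that by (metis blinfun.zero_right)
  then show "T \<in> bounded_ops K E" using T by (auto simp: bounded_ops_def clin_def)
qed

lemma bounded_ops_clin: "T \<in> bounded_ops K E \<Longrightarrow> clin T"
  by (auto simp: bounded_ops_def clin_def)

context
  fixes E :: "'h::chilbert_space set"
  assumes E: "hilbert E"
begin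

lemma bops_iff: "T \<in> bounded_ops E E \<longleftrightarrow> clin T \<and> (\<forall>x. T x \<in> E) \<and> (\<forall>x. T (id_op E x) = T x)"
  by (rule bounded_ops_iff[OF E E])

lemma bops_add: "S \<in> bounded_ops E E \<Longrightarrow> T \<in> bounded_ops E E \<Longrightarrow> S + T \<in> bounded_ops E E"
  by (simp add: bops_iff clin_def blinfun.add_left scaleC_add_right hilbertD[OF E])

lemma bops_scaleR: "T \<in> bounded_ops E E \<Longrightarrow> r *\<^sub>R T \<in> bounded_ops E E"
  by (simp add: bops_iff clin_def blinfun.scaleR_left scaleC_scaleR hilbertD[OF E])

lemma bops_diff: "S \<in> bounded_ops E E \<Longrightarrow> T \<in> bounded_ops E E \<Longrightarrow> S - T \<in> bounded_ops E E"
  by (simp add: bops_iff clin_def blinfun.diff_left scaleC_diff_right hilbertD[OF E])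

lemma bops_compose: "S \<in> bounded_ops E E \<Longrightarrow> T \<in> bounded_ops E E \<Longrightarrow> S o\<^sub>L T \<in> bounded_ops E E"
  by (simp add: bops_iff clin_def)

lemma bops_zero: "0 \<in> bounded_ops E E"
  by (simp add: bops_iff clin_def hilbertD[OF E])

lemma bops_limit:
  assumes T: "\<And>n. T n \<in> bounded_ops E E" and lim: "T \<longlonglongrightarrow> L"
  shows "L \<in> bounded_ops E E"
proof -
  have lim': "(\<lambda>n. T n x) \<longlonglongrightarrow> L x" for x
    using lim by (intro tendsto_intros)
  have "L (c *\<^sub>C x) = c *\<^sub>C L x" for c x
  proof (rule LIMSEQ_unique[OF lim'])
    show "(\<lambda>n. T n (c *\<^sub>C x)) \<longlonglongrightarrow> c *\<^sub>C L x"
      using bounded_linear.tendsto[OF bounded_linear_scaleC lim'] T by (simp add: bops_iff clin_def)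
  qed
  moreover have "L x \<in> E" for x
    by (rule Lim_in_closed_set[OF _ _ _ lim']) (use T E in \<open>auto simp: bops_iff hilbert_def\<close>)
  moreover have "L (id_op E x) = L x" for x
    by (rule LIMSEQ_unique[OF lim']) (use T lim'[of x] in \<open>simp add: bops_iff\<close>)
  ultimately show ?thesis by (auto simp: bops_iff clin_def)
qed

lemma bops_eqI:
  assumes "S \<in> bounded_ops E E" "T \<in> bounded_ops E E" "\<And>x. x \<in> E \<Longrightarrow> blinfun_apply S x = T x"
  shows "S = T"
proof (rule blinfun_eqI)
  fix x show "S x = T x" using assms(3)[OF id_op_in[OF E, of x]] assms(1,2) by (simp add: bops_iff)
qed

end

lemma selfadj_add: "selfadj S \<Longrightarrow> selfadj T \<Longrightarrow> selfadj (S + T)"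
  by (simp add: selfadj_def blinfun.add_left inner_add)

lemma selfadj_diff: "selfadj S \<Longrightarrow> selfadj T \<Longrightarrow> selfadj (S - T)"
  by (simp add: selfadj_def blinfun.diff_left inner_diff)

lemma selfadj_scaleR: "selfadj T \<Longrightarrow> selfadj (r *\<^sub>R T)"
  by (simp add: selfadj_def blinfun.scaleR_left)

lemma selfadj_limit:
  assumes T: "\<And>n. selfadj (T n)" and lim: "T \<longlonglongrightarrow> L"
  shows "selfadj L"
  unfolding selfadj_def
proof (intro allI)
  fix x y
  have lim': "(\<lambda>n. T n x) \<longlonglongrightarrow> L x" for x using lim by (intro tendsto_intros)
  show "inner (L x) y = inner x (L y)"
  proof (rule LIMSEQ_unique)
    show "(\<lambda>n. inner (T n x) y) \<longlonglongrightarrow> inner (L x) y" by (intro tendsto_intros lim')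
    show "(\<lambda>n. inner (T n x) y) \<longlonglongrightarrow> inner x (L y)"
      unfolding selfadjD[OF T] by (intro tendsto_intros lim')
  qed
qed

section \<open>The Loewner order\<close>

lemma loewner_leD: "A \<sqsubseteq>\<^sub>L B \<Longrightarrow> inner (A x) x \<le> inner (B x) x"
proof -
  assume "A \<sqsubseteq>\<^sub>L B"
  then have "cinner ((B - A) x) x \<in> \<real>\<^sub>\<ge>\<^sub>0" by (simp add: loewner_le_def)
  then have "0 \<le> inner ((B - A) x) x" by (simp add: complex_nonneg_Reals_iff Re_cinner)
  then show ?thesis by (simp add: blinfun.diff_left inner_diff_left)
qed

text \<open>The order also demands that the quadratic form of the difference be real, which
  self-adjointness supplies; only real inequalities remain to be checked.\<close>

lemma loewner_leI:
  assumes "clin A" "selfadj A" "clin B" "selfadj B" "\<And>x. inner (A x) x \<le> inner (B x) x"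
  shows "A \<sqsubseteq>\<^sub>L B"
  unfolding loewner_le_def
proof
  fix x
  have "clin (B - A)" using assms by (simp add: clin_def blinfun.diff_left scaleC_diff_right)
  then have "cinner ((B - A) x) x = cinner x ((B - A) x)"
    using selfadj_cinner selfadj_diff assms by blast
  then have "Im (cinner ((B - A) x) x) = 0"
    using cinner_commute[of x "(B - A) x"] by (metis Reals_cnj_iff complex_is_Real_iff)
  then show "cinner ((B - A) x) x \<in> \<real>\<^sub>\<ge>\<^sub>0"
    using assms(5)[of x] by (simp add: complex_nonneg_Reals_iff Re_cinner blinfun.diff_left inner_diff_left)
qed

lemma loewner_refl [simp]: "A \<sqsubseteq>\<^sub>L A"
  by (simp add: loewner_le_def)

lemma loewner_trans: "A \<sqsubseteq>\<^sub>L B \<Longrightarrow> B \<sqsubseteq>\<^sub>L C \<Longrightarrow> A \<sqsubseteq>\<^sub>L C"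
  unfolding loewner_le_def
proof
  fix x assume *: "\<forall>x. cinner ((B - A) x) x \<in> \<real>\<^sub>\<ge>\<^sub>0" "\<forall>x. cinner ((C - B) x) x \<in> \<real>\<^sub>\<ge>\<^sub>0"
  have "cinner ((C - A) x) x = cinner ((B - A) x) x + cinner ((C - B) x) x"
    by (simp add: blinfun.diff_left cinner_diff_left)
  then show "cinner ((C - A) x) x \<in> \<real>\<^sub>\<ge>\<^sub>0" using * by (metis nonneg_Reals_add_I)
qed

lemma loewner_add_mono: "A \<sqsubseteq>\<^sub>L B \<Longrightarrow> C \<sqsubseteq>\<^sub>L D \<Longrightarrow> A + C \<sqsubseteq>\<^sub>L B + D"
  unfolding loewner_le_def
proof
  fix x assume *: "\<forall>x. cinner ((B - A) x) x \<in> \<real>\<^sub>\<ge>\<^sub>0" "\<forall>x. cinner ((D - C) x) x \<in> \<real>\<^sub>\<ge>\<^sub>0"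
  have "cinner ((B + D - (A + C)) x) x = cinner ((B - A) x) x + cinner ((D - C) x) x"
    by (simp add: blinfun.diff_left blinfun.add_left cinner_diff_left cinner_add_left)
  then show "cinner ((B + D - (A + C)) x) x \<in> \<real>\<^sub>\<ge>\<^sub>0" using * by (metis nonneg_Reals_add_I)
qed

lemma loewner_scaleR_mono:
  assumes "A \<sqsubseteq>\<^sub>L B" "0 \<le> r" shows "r *\<^sub>R A \<sqsubseteq>\<^sub>L r *\<^sub>R B"
  unfolding loewner_le_def
proof
  fix x
  have "cinner ((r *\<^sub>R B - r *\<^sub>R A) x) x = of_real r * cinner ((B - A) x) x"
    by (simp add: scaleR_diff_right[symmetric] blinfun.scaleR_left cinner_scaleR_left scaleR_conv_of_real)
  then show "cinner ((r *\<^sub>R B - r *\<^sub>R A) x) x \<in> \<real>\<^sub>\<ge>\<^sub>0"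
    using assms by (auto simp: loewner_le_def intro!: nonneg_Reals_mult_I)
qed

lemma loewner_limit:
  assumes lim: "A \<longlonglongrightarrow> LA" "B \<longlonglongrightarrow> LB" and le: "\<And>n. A n \<sqsubseteq>\<^sub>L B n"
  shows "LA \<sqsubseteq>\<^sub>L LB"
  unfolding loewner_le_def
proof
  fix x
  have "(\<lambda>n. (B n - A n) x) \<longlonglongrightarrow> (LB - LA) x" using lim by (intro tendsto_intros)
  then have "(\<lambda>n. cinner ((B n - A n) x) x) \<longlonglongrightarrow> cinner ((LB - LA) x) x"
    by (rule bounded_linear.tendsto[OF bounded_linear_cinner_left])
  moreover have "cinner ((B n - A n) x) x \<in> \<real>\<^sub>\<ge>\<^sub>0" for n using le by (simp add: loewner_le_def)
  ultimately show "cinner ((LB - LA) x) x \<in> \<real>\<^sub>\<ge>\<^sub>0"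
    by (intro Lim_in_closed_set[OF closed_nonneg_Reals_complex _ trivial_limit_sequentially]) auto
qed

text \<open>The order is closed under norm limits. This removes the factors 1 + e from all
  approximate inequalities below.\<close>

lemma loewner_le_epsilon:
  assumes "\<And>e. 0 < e \<Longrightarrow> A \<sqsubseteq>\<^sub>L (1 + e) *\<^sub>R B"
  shows "A \<sqsubseteq>\<^sub>L B"
proof (rule loewner_limit)
  show "(\<lambda>n. A) \<longlonglongrightarrow> A" by simp
  have "(\<lambda>n. (1 + inverse (real (Suc n))) *\<^sub>R B) \<longlonglongrightarrow> (1 + 0) *\<^sub>R B"
    by (intro tendsto_intros LIMSEQ_inverse_real_of_nat)
  then show "(\<lambda>n. (1 + inverse (real (Suc n))) *\<^sub>R B) \<longlonglongrightarrow> B" by simp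
qed (use assms in simp)

text \<open>Polarisation: the imaginary part of the form vanishes at x, at y and at x + i y, and the
  last expression contains the difference of the two mixed real terms.\<close>

lemma positive_selfadj:
  assumes "clin A" "0 \<sqsubseteq>\<^sub>L A"
  shows "selfadj A"
  unfolding selfadj_def
proof (intro allI)
  fix x y
  have im: "Im (cinner (A z) z) = 0" for z
    using assms(2) by (simp add: loewner_le_def complex_nonneg_Reals_iff)
  have "Im (cinner (A (x + \<i> *\<^sub>C y)) (x + \<i> *\<^sub>C y)) =
      Im (cinner (A x) x) + Im (cinner (A y) y) - Re (cinner (A x) y) + Re (cinner (A y) x)"
    by (simp add: blinfun.add_right cinner_add_left cinner_add_right clinD[OF assms(1)]
        cinner_scaleC_left cinner_scaleC_right)
  then have "inner (A x) y = inner (A y) x" by (simp add: im Re_cinner)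
  then show "inner (A x) y = inner x (A y)" by (simp add: inner_commute)
qed

lemma positive_Cauchy_Schwarz:
  assumes "selfadj A" "\<And>x. 0 \<le> inner (A x) x"
  shows "(inner (A x) y)\<^sup>2 \<le> inner (A x) x * inner (A y) y"
proof -
  have q: "0 \<le> inner (A x) x + 2 * t * inner (A x) y + t\<^sup>2 * inner (A y) y" for t
  proof -
    have "inner (A y) x = inner (A x) y" using selfadjD[OF assms(1), of y x] by (simp add: inner_commute)
    then have "inner (A (x + t *\<^sub>R y)) (x + t *\<^sub>R y) = inner (A x) x + 2 * t * inner (A x) y + t\<^sup>2 * inner (A y) y"
      by (simp add: blinfun.add_right blinfun.scaleR_right inner_add power2_eq_square algebra_simps)
    then show ?thesis using assms(2)[of "x + t *\<^sub>R y"] by simp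
  qed
  show ?thesis
  proof (cases "inner (A y) y = 0")
    case True
    have "inner (A x) y = 0"
    proof (rule ccontr)
      assume ne: "inner (A x) y \<noteq> 0"
      \<comment> \<open>For \<open>inner (A y) y = 0\<close> the expression in \<open>q\<close> is
        linear in t; at this t it equals -1.\<close>
      show False
        using q[of "- (inner (A x) x + 1) / (2 * inner (A x) y)"] True ne by (simp add: field_simps)
    qed
    then show ?thesis using True by simp
  next
    case False
    then have pos: "0 < inner (A y) y" using assms(2)[of y] by simp
    let ?a = "inner (A x) x" and ?b = "inner (A x) y" and ?c = "inner (A y) y"
    \<comment> \<open>The quadratic polynomial is evaluated at its minimum.\<close>
    have "0 \<le> ?a + 2 * (- ?b / ?c) * ?b + (- ?b / ?c)\<^sup>2 * ?c" by (rule q)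
    also have "\<dots> = ?a - ?b\<^sup>2 / ?c" using pos by (simp add: field_simps power2_eq_square)
    finally show ?thesis using pos by (simp add: field_simps)
  qed
qed

text \<open>The form of the difference vanishes identically, and the Cauchy-Schwarz inequality for
  this form then makes the difference itself vanish.\<close>

lemma loewner_antisym:
  assumes "clin A" "clin B" "A \<sqsubseteq>\<^sub>L B" "B \<sqsubseteq>\<^sub>L A"
  shows "A = B"
proof (rule blinfun_eqI)
  fix x
  let ?D = "B - A"
  have "clin ?D" using assms by (simp add: clin_def blinfun.diff_left scaleC_diff_right)
  moreover have "0 \<sqsubseteq>\<^sub>L ?D" using assms(3) by (simp add: loewner_le_def)
  ultimately have sa: "selfadj ?D" by (rule positive_selfadj)
  have zero: "inner (?D y) y = 0" for y
    using loewner_leD[OF assms(3), of y] loewner_leD[OF assms(4), of y] by (simp add: blinfun.diff_left inner_diff_left)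
  then have "(inner (?D x) (?D x))\<^sup>2 \<le> 0"
    using positive_Cauchy_Schwarz[OF sa, of x "?D x"] by simp
  then have "?D x = 0" by simp
  then show "A x = B x" by (simp add: blinfun.diff_left)
qed

section \<open>Inverses\<close>

context
  fixes E :: "'h::chilbert_space set"
  assumes E: "hilbert E"
begin

text \<open>The Lax-Milgram theorem: a solution of A x = y is a fixed point of x + \<tau> (y - A x),
  and coercivity makes this map a contraction for small \<tau>.\<close>

lemma coercive_surj:
  assumes A: "A \<in> bounded_ops E E" and c: "0 < c" and coercive: "\<And>x. x \<in> E \<Longrightarrow> c * inner x x \<le> inner (A x) x"
    and y: "y \<in> E"
  shows "\<exists>x\<in>E. A x = y"
proof -
  \<comment> \<open>M dominates c as well as the norm, so that the contraction constant is the root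
    of a nonnegative number.\<close>
  define M where "M = max 1 (max c (norm A))"
  have M: "norm A \<le> M" "0 < M" "c \<le> M" by (auto simp: M_def)
  \<comment> \<open>The minimiser of 1 - 2 \<tau> c + \<tau>^2 M^2, the bound for the squared
    contraction constant.\<close>
  define \<tau> where "\<tau> = c / M\<^sup>2"
  have \<tau>: "0 < \<tau>" using M c by (simp add: \<tau>_def)
  define q where "q = sqrt (1 - c\<^sup>2 / M\<^sup>2)"
  have "c\<^sup>2 \<le> M\<^sup>2" using M c by (intro power_mono) auto
  then have cM: "0 \<le> 1 - c\<^sup>2 / M\<^sup>2" using M by (simp add: field_simps)
  have "q < 1" using c M by (simp add: q_def real_sqrt_less_iff)
  have "\<exists>!x\<in>E. x + \<tau> *\<^sub>R (y - A x) = x"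
  proof (rule Banach_fix)
    show "Topological_Spaces.complete E" using hilbertD(6)[OF E] by (simp add: complete_eq_closed)
    show "E \<noteq> {}" using hilbertD(1)[OF E] by blast
    show "0 \<le> q" using cM by (simp add: q_def)
    show "q < 1" by fact
    show "(\<lambda>x. x + \<tau> *\<^sub>R (y - A x)) ` E \<subseteq> E"
      using hilbertD[OF E] y bounded_opsD(2)[OF A] by auto
    fix u v assume uv: "u \<in> E" "v \<in> E"
    let ?w = "u - v"
    have w: "?w \<in> E" using hilbertD[OF E] uv by auto
    have eq: "(u + \<tau> *\<^sub>R (y - A u)) - (v + \<tau> *\<^sub>R (y - A v)) = ?w - \<tau> *\<^sub>R A ?w"
      by (simp add: blinfun.diff_right algebra_simps)
    have "norm (A ?w) \<le> M * norm ?w"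
      using norm_blinfun[of A ?w] M(1) by (meson mult_right_mono norm_ge_zero order_trans)
    then have "(norm (A ?w))\<^sup>2 \<le> M\<^sup>2 * (norm ?w)\<^sup>2"
      by (metis norm_ge_zero power_mono power_mult_distrib)
    then have nA: "inner (A ?w) (A ?w) \<le> M\<^sup>2 * inner ?w ?w" by (simp add: power2_norm_eq_inner)
    have "inner (?w - \<tau> *\<^sub>R A ?w) (?w - \<tau> *\<^sub>R A ?w) = inner ?w ?w - 2 * \<tau> * inner (A ?w) ?w + \<tau>\<^sup>2 * inner (A ?w) (A ?w)"
      by (simp add: inner_diff inner_commute power2_eq_square algebra_simps)
    also have "\<dots> \<le> inner ?w ?w - 2 * \<tau> * (c * inner ?w ?w) + \<tau>\<^sup>2 * (M\<^sup>2 * inner ?w ?w)"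
      using coercive[OF w] nA \<tau> by (intro add_mono diff_mono mult_left_mono) auto
    also have "\<dots> = (1 - c\<^sup>2 / M\<^sup>2) * inner ?w ?w"
      using M by (simp add: \<tau>_def field_simps power2_eq_square)
    finally have "(norm (?w - \<tau> *\<^sub>R A ?w))\<^sup>2 \<le> (q * norm ?w)\<^sup>2"
      using cM by (simp add: power2_norm_eq_inner power_mult_distrib q_def)
    then have "norm (?w - \<tau> *\<^sub>R A ?w) \<le> q * norm ?w"
      by (rule power2_le_imp_le) (use cM in \<open>simp add: q_def\<close>)
    then show "dist (u + \<tau> *\<^sub>R (y - A u)) (v + \<tau> *\<^sub>R (y - A v)) \<le> q * dist u v"
      unfolding dist_norm eq .
  qed
  then obtain x where "x \<in> E" "x + \<tau> *\<^sub>R (y - A x) = x" by (auto elim: ex1E)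
  then show ?thesis using \<tau> by (intro bexI[of _ x]) auto
qed

text \<open>Bounded below means injective with a bounded inverse. The preimage is taken of
  \<open>id_op E y\<close>, so that the inverse vanishes on the orthogonal complement; its linearity
  follows from injectivity.\<close>

lemma bounded_below_inverse:
  assumes T: "T \<in> bounded_ops E E" and c: "0 < c" and below: "\<And>x. x \<in> E \<Longrightarrow> c * norm x \<le> norm (T x)"
    and surj: "\<And>y. y \<in> E \<Longrightarrow> \<exists>x\<in>E. T x = y"
  obtains B where "B \<in> bounded_ops E E" "\<And>x. x \<in> E \<Longrightarrow> blinfun_apply B (T x) = x" "\<And>x. x \<in> E \<Longrightarrow> T (B x) = x"
proof -
  have inj: "x = y" if "x \<in> E" "y \<in> E" "T x = T y" for x y
  proof -
    have "c * norm (x - y) \<le> norm (T (x - y))" by (rule below[OF hilbertD(5)[OF E that(1,2)]])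
    then have "c * norm (x - y) \<le> 0" using that by (simp add: blinfun.diff_right)
    then show ?thesis using c by (simp add: mult_le_0_iff)
  qed
  have "\<forall>y. \<exists>x. x \<in> E \<and> T x = id_op E y" using surj id_op_in[OF E] by blast
  then obtain g where g: "\<And>y. g y \<in> E" "\<And>y. T (g y) = id_op E y" by metis
  have g_eq: "g y = x" if "x \<in> E" "T x = id_op E y" for x y using inj g that by metis
  have lin: "bounded_linear g"
  proof (rule bounded_linear_intro[where K = "1 / c"])
    show "g (x + y) = g x + g y" for x y
      by (rule g_eq) (auto simp: g hilbertD[OF E] blinfun.add_right)
    show "g (r *\<^sub>R x) = r *\<^sub>R g x" for r x
      by (rule g_eq) (auto simp: g hilbertD[OF E] blinfun.scaleR_right)
    show "norm (g x) \<le> norm x * (1 / c)" for x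
    proof -
      have "c * norm (g x) \<le> norm (id_op E x)" using below[OF g(1), of x] g(2) by simp
      also have "\<dots> \<le> norm x" by (rule norm_id_op_le[OF E])
      finally show ?thesis using c by (simp add: field_simps)
    qed
  qed
  have app: "blinfun_apply (Blinfun g) = g" by (rule bounded_linear_Blinfun_apply[OF lin])
  show thesis
  proof (rule that[of "Blinfun g"])
    have "g (c *\<^sub>C x) = c *\<^sub>C g x" for c x
      by (rule g_eq) (auto simp: g hilbertD[OF E] bounded_opsD(1)[OF T] clinD[OF clin_id_op[OF E]])
    moreover have "g (id_op E x) = g x" for x
      by (rule g_eq) (auto simp: g id_op_props(2)[OF E] id_op_in[OF E])
    ultimately show "Blinfun g \<in> bounded_ops E E" by (simp add: bops_iff[OF E] clin_def app g)
    show "Blinfun g (T x) = x" if "x \<in> E" for x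
      unfolding app by (rule g_eq) (auto simp: that id_op_props(2)[OF E] bounded_opsD(2)[OF T])
    show "T (Blinfun g x) = x" if "x \<in> E" for x
      unfolding app using g that by (simp add: id_op_props(2)[OF E])
  qed
qed

text \<open>The form of T T at x is the squared norm of T x, so T T is coercive and therefore
  surjective on E; then so is T.\<close>

lemma selfadj_bounded_below_inverse:
  assumes T: "T \<in> bounded_ops E E" and sa: "selfadj T"
    and c: "0 < c" and below: "\<And>x. x \<in> E \<Longrightarrow> c * norm x \<le> norm (T x)"
  obtains B where "B \<in> bounded_ops E E" "\<And>x. x \<in> E \<Longrightarrow> blinfun_apply B (T x) = x" "\<And>x. x \<in> E \<Longrightarrow> T (B x) = x"
proof -
  have "\<exists>x\<in>E. T x = y" if "y \<in> E" for y
  proof -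
    have "\<exists>x\<in>E. (T o\<^sub>L T) x = y"
    proof (rule coercive_surj[OF bops_compose[OF E T T] _ _ that])
      show "0 < c\<^sup>2" using c by simp
      fix x assume "x \<in> E"
      then have "(c * norm x)\<^sup>2 \<le> (norm (T x))\<^sup>2" using below c by (intro power_mono) auto
      then show "c\<^sup>2 * inner x x \<le> inner ((T o\<^sub>L T) x) x"
        by (simp add: power_mult_distrib power2_norm_eq_inner selfadjD[OF sa])
    qed
    then show ?thesis using bounded_opsD(2)[OF T] by auto
  qed
  then show thesis using bounded_below_inverse[OF T c below] that by metis
qed

lemma invertible_opI:
  assumes "A \<in> bounded_ops E E" "B \<in> bounded_ops E E"
    "\<And>x. x \<in> E \<Longrightarrow> blinfun_apply B (A x) = x" "\<And>x. x \<in> E \<Longrightarrow> A (B x) = x"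
  shows "A o\<^sub>L B = id_op E" "B o\<^sub>L A = id_op E" "invertible_op E A"
proof -
  show 1: "A o\<^sub>L B = id_op E"
    by (rule bops_eqI[OF E bops_compose[OF E] id_op_props(1)[OF E]]) (auto simp: assms id_op_props(2)[OF E])
  show 2: "B o\<^sub>L A = id_op E"
    by (rule bops_eqI[OF E bops_compose[OF E] id_op_props(1)[OF E]]) (auto simp: assms id_op_props(2)[OF E])
  show "invertible_op E A" unfolding invertible_op_def using 1 2 assms(2) by blast
qed

lemma pos_opsD:
  assumes "A \<in> \<P> E"
  shows "A \<in> bounded_ops E E" "clin A" "selfadj A" "0 \<sqsubseteq>\<^sub>L A" "0 \<le> inner (A x) x" "invertible_op E A"
proof -
  show 1: "A \<in> bounded_ops E E" "0 \<sqsubseteq>\<^sub>L A" "invertible_op E A" using assms by (auto simp: pos_ops_def)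
  show 2: "clin A" using bounded_ops_clin[OF 1(1)] .
  show "selfadj A" by (rule positive_selfadj[OF 2 1(2)])
  show "0 \<le> inner (A x) x" using loewner_leD[OF 1(2), of x] by simp
qed

text \<open>The form of A factors through the projection, so positivity on E extends to the whole
  space. Coercivity and the Cauchy-Schwarz inequality bound A from below, which gives the
  inverse.\<close>

lemma pos_opsI:
  assumes A: "A \<in> bounded_ops E E" "selfadj A" and c: "0 < c"
    and coercive: "\<And>x. x \<in> E \<Longrightarrow> c * inner x x \<le> inner (A x) x"
  shows "A \<in> \<P> E"
proof -
  have "0 \<sqsubseteq>\<^sub>L A"
  proof (rule loewner_leI)
    show "clin A" using bounded_ops_clin[OF A(1)] .
    fix x
    let ?x = "id_op E x"
    have "inner (A x) x = inner (A ?x) ?x"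
    proof -
      have "inner (A x) x = inner (id_op E (A ?x)) x"
        using A(1) by (simp add: id_op_bounded_ops[OF E A(1)] bounded_ops_id_op[OF E A(1)])
      then show ?thesis by (simp add: id_op_props(3)[OF E])
    qed
    moreover have "0 \<le> c * inner ?x ?x" using c by simp
    ultimately show "inner ((0::'h operator) x) x \<le> inner (A x) x"
      using coercive[OF id_op_in[OF E, of x]] by simp
  qed (use A(2) in \<open>auto simp: clin_def selfadj_def\<close>)
  moreover obtain B where "B \<in> bounded_ops E E" "\<And>x. x \<in> E \<Longrightarrow> blinfun_apply B (A x) = x" "\<And>x. x \<in> E \<Longrightarrow> A (B x) = x"
  proof (rule selfadj_bounded_below_inverse[OF A c])
    fix x assume "x \<in> E"
    then have "c * (norm x)\<^sup>2 \<le> norm (A x) * norm x"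
      using coercive norm_cauchy_schwarz[of "A x" x] by (metis order_trans power2_norm_eq_inner)
    then show "c * norm x \<le> norm (A x)"
      by (cases "norm x = 0") (auto simp: power2_eq_square mult.assoc[symmetric])
  qed (use that in blast)
  then have "invertible_op E A" by (rule invertible_opI(3)[OF A(1)])
  ultimately show ?thesis using A by (simp add: pos_ops_def)
qed

end

section \<open>Inverses in the cone: positivity, reversal of the order, scalar bounds\<close>

definition inv_op :: "'h::chilbert_space set \<Rightarrow> 'h operator \<Rightarrow> 'h operator" where
  "inv_op E A = (THE B. B \<in> bounded_ops E E \<and> A o\<^sub>L B = id_op E \<and> B o\<^sub>L A = id_op E)"

lemma clin_zero [simp]: "clin 0" and selfadj_zero [simp]: "selfadj 0"
  by (simp_all add: clin_def selfadj_def)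

lemma clin_scaleR: "clin T \<Longrightarrow> clin (r *\<^sub>R T)"
  by (simp add: clin_def blinfun.scaleR_left scaleC_scaleR)

lemma norm_blinfun_le: "norm A \<le> r \<Longrightarrow> norm (blinfun_apply A x) \<le> r * norm x"
  by (meson mult_right_mono norm_blinfun norm_ge_zero order_trans)

context
  fixes E :: "'h::chilbert_space set"
  assumes E: "hilbert E"
begin

lemma bops_id_op:
  assumes "T \<in> bounded_ops E E"
  shows "T (id_op E x) = T x" "id_op E (T x) = T x"
  using bounded_ops_id_op[OF E assms] id_op_bounded_ops[OF E assms] by auto

lemma bops_quad: "T \<in> bounded_ops E E \<Longrightarrow> inner (T x) x = inner (T (id_op E x)) (id_op E x)"
  by (metis bounded_ops_id_op[OF E] id_op_bounded_ops[OF E] id_op_props(3)[OF E])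

lemma inv_op_eqI:
  assumes B: "B \<in> bounded_ops E E" "A o\<^sub>L B = id_op E" "B o\<^sub>L A = id_op E"
  shows "inv_op E A = B"
  unfolding inv_op_def
proof (rule the_equality)
  fix C assume C: "C \<in> bounded_ops E E \<and> A o\<^sub>L C = id_op E \<and> C o\<^sub>L A = id_op E"
  show "C = B"
  proof (rule blinfun_eqI)
    fix x
    have "C x = C (id_op E x)" using C by (simp add: bops_id_op)
    also have "\<dots> = C (A (B x))" using B(2) by (metis blinfun_apply_blinfun_compose)
    also have "\<dots> = id_op E (B x)" using C by (metis blinfun_apply_blinfun_compose)
    also have "\<dots> = B x" by (rule id_op_bounded_ops[OF E B(1)])
    finally show "C x = B x" .
  qed
qed (use B in simp)

lemma inv_op_props:
  assumes A: "A \<in> \<P> E"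
  shows "inv_op E A \<in> bounded_ops E E" "A o\<^sub>L inv_op E A = id_op E" "inv_op E A o\<^sub>L A = id_op E"
    "A (inv_op E A x) = id_op E x" "inv_op E A (A x) = id_op E x"
proof -
  obtain B where B: "B \<in> bounded_ops E E" "A o\<^sub>L B = id_op E" "B o\<^sub>L A = id_op E"
    using pos_opsD(6)[OF E A] by (auto simp: invertible_op_def)
  have "inv_op E A = B" by (rule inv_op_eqI[OF B])
  then show *: "inv_op E A \<in> bounded_ops E E" "A o\<^sub>L inv_op E A = id_op E" "inv_op E A o\<^sub>L A = id_op E"
    using B by simp_all
  show "A (inv_op E A x) = id_op E x" "inv_op E A (A x) = id_op E x"
    using *(2,3) by (metis blinfun_apply_blinfun_compose)+
qed

lemma inv_op_pos:
  assumes A: "A \<in> \<P> E"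
  shows "inv_op E A \<in> \<P> E"
proof -
  note B = inv_op_props[OF A]
  let ?B = "inv_op E A"
  \<comment> \<open>The form of the inverse is the form of A pulled back along the inverse; symmetry
    and positivity are inherited from A.\<close>
  have quad: "inner (?B x) y = inner (A (?B x)) (?B y)" for x y
  proof -
    have "inner (?B x) y = inner (id_op E (?B x)) y" by (simp add: id_op_bounded_ops[OF E B(1)])
    also have "\<dots> = inner (?B x) (A (?B y))" by (simp add: id_op_props(3)[OF E] B(4))
    finally show ?thesis by (simp add: selfadjD[OF pos_opsD(3)[OF E A]])
  qed
  have sa: "selfadj ?B"
    unfolding selfadj_def
    by (metis quad selfadjD[OF pos_opsD(3)[OF E A]] inner_commute)
  have "0 \<sqsubseteq>\<^sub>L ?B"
    by (rule loewner_leI) (simp_all add: sa bounded_ops_clin[OF B(1)] quad pos_opsD(5)[OF E A])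
  moreover have "invertible_op E ?B"
    unfolding invertible_op_def using B(2,3) pos_opsD(1)[OF E A] by blast
  ultimately show ?thesis using B(1) by (simp add: pos_ops_def)
qed

lemma inv_op_inv_op: "A \<in> \<P> E \<Longrightarrow> inv_op E (inv_op E A) = A"
  by (rule inv_op_eqI) (auto simp: inv_op_props pos_opsD[OF E])

text \<open>With a = A^-1 x and b = B^-1 x, the Cauchy-Schwarz inequality for the form of A gives
  (b, x)^2 = (A a, b)^2 \<le> (a, x) (A b, b) \<le> (a, x) (B b, b) = (a, x) (b, x). No square root
  is involved.\<close>

lemma inv_op_antimono:
  assumes A: "A \<in> \<P> E" and B: "B \<in> \<P> E" and le: "A \<sqsubseteq>\<^sub>L B"
  shows "inv_op E B \<sqsubseteq>\<^sub>L inv_op E A"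
proof (rule loewner_leI)
  note pA = pos_opsD[OF E inv_op_pos[OF A]] and pB = pos_opsD[OF E inv_op_pos[OF B]]
  show "clin (inv_op E B)" "selfadj (inv_op E B)" "clin (inv_op E A)" "selfadj (inv_op E A)"
    using pA pB by auto
  fix x
  let ?a = "inv_op E A x" and ?b = "inv_op E B x"
  have b: "inner ?b x = inner (B ?b) ?b"
    by (metis id_op_bounded_ops[OF E pB(1)] id_op_props(3)[OF E] inner_commute inv_op_props(4)[OF B])
  have "inner (A ?a) ?b = inner (id_op E x) ?b" by (simp add: inv_op_props(4)[OF A])
  also have "\<dots> = inner ?b x" by (metis id_op_bounded_ops[OF E pB(1)] id_op_props(3)[OF E] inner_commute)
  finally have "(inner ?b x)\<^sup>2 \<le> inner (A ?a) ?a * inner (A ?b) ?b"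
    using positive_Cauchy_Schwarz[OF pos_opsD(3,5)[OF E A], of ?a ?b] by simp
  also have "inner (A ?a) ?a = inner ?a x"
    by (metis id_op_bounded_ops[OF E pA(1)] id_op_props(3)[OF E] inner_commute inv_op_props(4)[OF A])
  also have "inner ?a x * inner (A ?b) ?b \<le> inner ?a x * inner ?b x"
    unfolding b using loewner_leD[OF le] pA(5) by (intro mult_left_mono) auto
  finally show "inner ?b x \<le> inner ?a x"
    using pA(5)[of x] pB(5)[of x] by (cases "inner ?b x = 0") (auto simp: power2_eq_square)
qed

lemma pos_ops_upward:
  assumes A: "A \<in> \<P> E" and B: "B \<in> bounded_ops E E" and le: "A \<sqsubseteq>\<^sub>L B" and c: "0 < c"
    "\<And>x. x \<in> E \<Longrightarrow> c * inner x x \<le> inner (A x) x"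
  shows "B \<in> \<P> E"
proof (rule pos_opsI[OF E B _ c(1)])
  have "0 \<sqsubseteq>\<^sub>L B" using pos_opsD(4)[OF E A] le loewner_trans by blast
  then show "selfadj B" using positive_selfadj bounded_ops_clin[OF B] by blast
  show "c * inner x x \<le> inner (B x) x" if "x \<in> E" for x
    using c(2)[OF that] loewner_leD[OF le, of x] by linarith
qed

lemma id_op_pos: "id_op E \<in> \<P> E"
  by (rule pos_opsI[OF E, of _ 1]) (auto simp: id_op_props[OF E] selfadj_def)

text \<open>The Cauchy-Schwarz inequality for the form of A at the pair A^-1 x, x bounds the squared
  norm of x by N (A x, x), where N exceeds the norm of the inverse.\<close>

lemma pos_ops_lower:
  assumes A: "A \<in> \<P> E"
  obtains c where "0 < c" "c *\<^sub>R id_op E \<sqsubseteq>\<^sub>L A"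
proof -
  let ?B = "inv_op E A"
  \<comment> \<open>The summand 1 keeps N positive when E is the zero space.\<close>
  define N where "N = norm ?B + 1"
  have N: "0 < N" "norm ?B \<le> N" by (auto simp: N_def add_nonneg_pos)
  have "inner x x \<le> N * inner (A x) x" if x: "x \<in> E" for x
  proof -
    have ABx: "A (?B x) = x" using x by (simp add: inv_op_props(4)[OF A] id_op_props(2)[OF E])
    have "inner x (?B x) \<le> norm x * norm (?B x)" by (rule norm_cauchy_schwarz)
    also have "\<dots> \<le> norm x * (N * norm x)"
      using norm_blinfun_le[OF N(2)] by (intro mult_left_mono) auto
    also have "\<dots> = N * inner x x" by (simp add: power2_norm_eq_inner[symmetric] power2_eq_square)
    finally have bx: "inner x (?B x) \<le> N * inner x x" .
    have "(inner x x)\<^sup>2 \<le> inner x (?B x) * inner (A x) x"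
      using positive_Cauchy_Schwarz[OF pos_opsD(3,5)[OF E A], of "?B x" x] by (simp add: ABx)
    also have "\<dots> \<le> N * inner x x * inner (A x) x"
      using bx pos_opsD(5)[OF E A] by (intro mult_right_mono) auto
    finally have "inner x x * inner x x \<le> inner x x * (N * inner (A x) x)" by (simp add: power2_eq_square mult_ac)
    then show ?thesis using N pos_opsD(5)[OF E A, of x] by (cases "inner x x = 0") auto
  qed
  then have le: "inner (id_op E x) (id_op E x) \<le> N * inner (A x) x" for x
    using bops_quad[OF pos_opsD(1)[OF E A], of x] id_op_in[OF E, of x] by metis
  have "(1 / N) *\<^sub>R id_op E \<sqsubseteq>\<^sub>L A"
  proof (rule loewner_leI)
    show "inner (((1 / N) *\<^sub>R id_op E) x) x \<le> inner (A x) x" for x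
      using le[of x] N by (simp add: blinfun.scaleR_left inner_id_op[OF E] field_simps)
  qed (use pos_opsD[OF E A] clin_id_op[OF E] selfadj_id_op[OF E] in
      \<open>auto simp: selfadj_scaleR clin_def blinfun.scaleR_left scaleC_scaleR\<close>)
  then show thesis using that[of "1 / N"] N by simp
qed

lemma loewner_le_norm:
  assumes A: "A \<in> bounded_ops E E" "selfadj A" and r: "norm A \<le> r"
  shows "A \<sqsubseteq>\<^sub>L r *\<^sub>R id_op E"
proof (rule loewner_leI)
  fix x
  let ?x = "id_op E x"
  have "inner (A x) x = inner (A ?x) ?x" by (rule bops_quad[OF A(1)])
  also have "\<dots> \<le> norm (A ?x) * norm ?x" by (rule norm_cauchy_schwarz)
  also have "\<dots> \<le> (r * norm ?x) * norm ?x"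
    using norm_blinfun_le[OF r] by (intro mult_right_mono) auto
  also have "\<dots> = r * inner ?x ?x" by (simp add: power2_norm_eq_inner[symmetric] power2_eq_square)
  finally show "inner (A x) x \<le> inner ((r *\<^sub>R id_op E) x) x"
    by (simp add: blinfun.scaleR_left inner_id_op[OF E])
qed (use A bounded_ops_clin[OF A(1)] clin_id_op[OF E] selfadj_id_op[OF E] in
      \<open>auto simp: selfadj_scaleR clin_def blinfun.scaleR_left scaleC_scaleR\<close>)

lemma pos_ops_upper:
  assumes A: "A \<in> \<P> E"
  obtains c where "0 < c" "A \<sqsubseteq>\<^sub>L c *\<^sub>R id_op E"
  by (rule that[of "norm A + 1"]) (auto simp: add_nonneg_pos intro!: loewner_le_norm pos_opsD[OF E A])

lemma scaleR_pos: "A \<in> \<P> E \<Longrightarrow> 0 < r \<Longrightarrow> r *\<^sub>R A \<in> \<P> E"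
proof -
  assume A: "A \<in> \<P> E" and r: "0 < r"
  obtain c where c: "0 < c" "c *\<^sub>R id_op E \<sqsubseteq>\<^sub>L A" by (rule pos_ops_lower[OF A])
  show ?thesis
  proof (rule pos_opsI[OF E, of _ "r * c"])
    show "r *\<^sub>R A \<in> bounded_ops E E" "selfadj (r *\<^sub>R A)"
      using pos_opsD[OF E A] by (auto simp: bops_scaleR[OF E] selfadj_scaleR)
    show "0 < r * c" using c r by simp
    fix x assume "x \<in> E"
    then show "r * c * inner x x \<le> inner ((r *\<^sub>R A) x) x"
      using loewner_leD[OF c(2), of x] r by (simp add: blinfun.scaleR_left id_op_props(2)[OF E])
  qed
qed

lemma pos_ops_mono:
  assumes A: "A \<in> \<P> E" and B: "B \<in> bounded_ops E E" and le: "A \<sqsubseteq>\<^sub>L B"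
  shows "B \<in> \<P> E"
proof -
  obtain c where c: "0 < c" "c *\<^sub>R id_op E \<sqsubseteq>\<^sub>L A" by (rule pos_ops_lower[OF A])
  show ?thesis
  proof (rule pos_ops_upward[OF A B le c(1)])
    show "c * inner x x \<le> inner (A x) x" if "x \<in> E" for x
      using loewner_leD[OF c(2), of x] that by (simp add: blinfun.scaleR_left id_op_props(2)[OF E])
  qed
qed

lemma add_pos: "A \<in> \<P> E \<Longrightarrow> B \<in> \<P> E \<Longrightarrow> A + B \<in> \<P> E"
  using pos_ops_mono[of A "A + B"] loewner_add_mono[OF loewner_refl, of 0 B A]
  by (auto simp: pos_opsD[OF E] bops_add[OF E])

lemma inv_op_scaleR:
  assumes "A \<in> \<P> E" "0 < r"
  shows "inv_op E (r *\<^sub>R A) = (1 / r) *\<^sub>R inv_op E A"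
  by (rule inv_op_eqI)
     (use assms inv_op_props[OF assms(1)] in
      \<open>auto simp: bops_scaleR[OF E] blinfun.scaleR_left blinfun.scaleR_right intro!: blinfun_eqI\<close>)

lemma inv_op_id: "inv_op E (id_op E) = id_op E"
  by (rule inv_op_eqI) (auto simp: id_op_props[OF E] id_op_in[OF E] intro!: blinfun_eqI)

end

section \<open>Polynomials of an operator\<close>

lemma poly_map_of_real: "poly (map_poly complex_of_real p) (complex_of_real t) = complex_of_real (poly p t)"
  by (induction p) (auto simp: map_poly_pCons)

text \<open>Horner's scheme applied to a vector. Complex coefficients are needed to split
  polynomials into linear factors, and they act on vectors through \<open>*\<^sub>C\<close>;
  \<open>poly_op\<close> has real coefficients.\<close>

definition vec_poly :: "('h::complex_inner \<Rightarrow> 'h) \<Rightarrow> complex poly \<Rightarrow> 'h \<Rightarrow> 'h" where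
  "vec_poly f p x = fold_coeffs (\<lambda>a v. a *\<^sub>C x + f v) p 0"

lemma vec_poly_0 [simp]: "vec_poly f 0 x = 0"
  by (simp add: vec_poly_def)

lemma vec_poly_pCons [simp]: "f 0 = 0 \<Longrightarrow> vec_poly f (pCons a p) x = a *\<^sub>C x + f (vec_poly f p x)"
  unfolding vec_poly_def
  by (cases "p = 0 \<and> a = 0") (auto simp: fold_coeffs_pCons_coeff_not_0_eq fold_coeffs_pCons_not_0_0_eq)

context
  fixes A :: "'h::chilbert_space operator"
  assumes A: "clin A"
begin

lemma vec_poly_add: "vec_poly A (p + q) x = vec_poly A p x + vec_poly A q x"
  by (induction p q rule: poly_induct2) (simp_all add: scaleC_add_left blinfun.add_right algebra_simps)

lemma vec_poly_smult: "vec_poly A (smult c p) x = c *\<^sub>C vec_poly A p x"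
  by (induction p) (simp_all add: scaleC_add_right scaleC_scaleC clinD[OF A])

lemma vec_poly_linear_factor: "vec_poly A ([:-z, 1:] * p) x = A (vec_poly A p x) - z *\<^sub>C vec_poly A p x"
proof -
  have "[:-z, 1:] * p = pCons 0 p + smult (- z) p" by simp
  moreover have "(- z) *\<^sub>C v = - (z *\<^sub>C v)" for v :: 'h
    by (metis linear_neg bounded_linear.linear[OF bounded_linear_scaleC_left])
  ultimately show ?thesis by (simp only: vec_poly_add vec_poly_smult) simp
qed

end

lemma vec_poly_in:
  assumes "hilbert E" "A \<in> bounded_ops E E" "x \<in> E"
  shows "vec_poly A p x \<in> E"
  by (induction p) (use assms bounded_opsD(2)[OF assms(2)] in \<open>auto simp: hilbertD[OF assms(1)]\<close>)

lemma poly_op_pCons: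
  "poly_op E (pCons a p) A = a *\<^sub>R id_op E + (A o\<^sub>L poly_op E p A)"
proof (cases "p = 0")
  case False
  have "poly_op E (pCons a p) A = (\<Sum>i\<le>Suc (degree p). coeff (pCons a p) i *\<^sub>R op_power E A i)"
    using False by (simp add: poly_op_def)
  also have "\<dots> = a *\<^sub>R id_op E + (\<Sum>i\<le>degree p. coeff p i *\<^sub>R (A o\<^sub>L op_power E A i))"
    by (subst sum.atMost_Suc_shift) simp
  also have "(\<Sum>i\<le>degree p. coeff p i *\<^sub>R (A o\<^sub>L op_power E A i)) = A o\<^sub>L poly_op E p A"
    unfolding poly_op_def by (rule blinfun_eqI)
      (simp add: blinfun.sum_left blinfun.sum_right blinfun.scaleR_left blinfun.scaleR_right)
  finally show ?thesis .
qed (auto simp: poly_op_def intro!: blinfun_eqI)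

lemma poly_op_0 [simp]: "poly_op E 0 A = 0"
  by (simp add: poly_op_def)

lemma poly_op_const: "poly_op E [:a:] A = a *\<^sub>R id_op E"
  by (auto simp: poly_op_pCons intro!: blinfun_eqI)

lemma poly_op_add: "poly_op E (p + q) A = poly_op E p A + poly_op E q A"
  by (induction p q rule: poly_induct2)
     (auto simp: poly_op_pCons blinfun.add_left blinfun.add_right blinfun.scaleR_left algebra_simps intro!: blinfun_eqI)

lemma poly_op_smult: "poly_op E (smult c p) A = c *\<^sub>R poly_op E p A"
  by (induction p)
     (auto simp: poly_op_pCons blinfun.add_left blinfun.add_right blinfun.scaleR_left blinfun.scaleR_right
        algebra_simps intro!: blinfun_eqI)

lemma poly_op_minus: "poly_op E (- p) A = - poly_op E p A"
  using poly_op_smult[of E "-1" p A] by simp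

lemma poly_op_diff: "poly_op E (p - q) A = poly_op E p A - poly_op E q A"
  using poly_op_add[of E p "- q" A] by (simp add: poly_op_minus)

context
  fixes E :: "'h::chilbert_space set" and A :: "'h operator"
  assumes E: "hilbert E" and A: "A \<in> bounded_ops E E"
begin

lemma poly_op_bops: "poly_op E p A \<in> bounded_ops E E"
  by (induction p)
     (auto simp: poly_op_pCons A bops_zero[OF E] id_op_props[OF E] intro!: bops_add[OF E] bops_scaleR[OF E] bops_compose[OF E])

lemma poly_op_X: "poly_op E [:0, 1:] A = A"
  by (auto simp: poly_op_pCons bounded_ops_id_op[OF E A] blinfun.scaleR_left intro!: blinfun_eqI)

lemma poly_op_mult: "poly_op E (p * q) A = poly_op E p A o\<^sub>L poly_op E q A"
proof (induction p)
  case (pCons a p)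
  show ?case
  proof (rule blinfun_eqI)
    fix x
    have "poly_op E (pCons a p * q) A x = a *\<^sub>R poly_op E q A x + A (poly_op E p A (poly_op E q A x))"
      by (simp add: poly_op_add poly_op_smult poly_op_pCons pCons.IH blinfun.add_left blinfun.scaleR_left)
    then show "poly_op E (pCons a p * q) A x = (poly_op E (pCons a p) A o\<^sub>L poly_op E q A) x"
      by (simp add: poly_op_pCons blinfun.add_left blinfun.scaleR_left id_op_bounded_ops[OF E poly_op_bops])
  qed
qed simp

lemma poly_op_commute: "poly_op E p A o\<^sub>L A = A o\<^sub>L poly_op E p A"
  by (metis mult.commute poly_op_X poly_op_mult)

lemma selfadj_poly_op:
  assumes sa: "selfadj A"
  shows "selfadj (poly_op E p A)"
proof (induction p)
  case (pCons a p)
  have "selfadj (A o\<^sub>L poly_op E p A)"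
    unfolding selfadj_def
    by (metis blinfun_apply_blinfun_compose poly_op_commute selfadjD[OF sa] selfadjD[OF pCons.IH])
  then show ?case by (simp add: poly_op_pCons selfadj_add selfadj_scaleR selfadj_id_op[OF E])
qed (simp add: selfadj_def)

lemma vec_poly_of_real:
  "x \<in> E \<Longrightarrow> vec_poly A (map_poly complex_of_real p) x = poly_op E p A x"
  by (induction p)
     (auto simp: map_poly_pCons poly_op_pCons blinfun.add_left blinfun.scaleR_left scaleC_of_real id_op_props(2)[OF E])

end

section \<open>The spectrum of a self-adjoint operator\<close>

text \<open>The set on which \<open>op_fun\<close> asks for uniform convergence. For self-adjoint
  operators the remaining complex numbers are covered by
  \<open>bounded_below_nonspectrum\<close>.\<close>

definition real_spectrum :: "'h::chilbert_space set \<Rightarrow> 'h operator \<Rightarrow> real set" where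
  "real_spectrum E A = {t. complex_of_real t \<in> spectrum E A}"

context
  fixes E :: "'h::chilbert_space set" and A :: "'h operator"
  assumes E: "hilbert E" and A: "A \<in> bounded_ops E E" and sa: "selfadj A"
begin

text \<open>At a real point a bounded inverse gives the constant. At a nonreal point (A - Re z) x is
  orthogonal to i x, and Pythagoras gives the constant |Im z|.\<close>

lemma bounded_below_nonspectrum:
  assumes "z \<notin> complex_of_real ` real_spectrum E A"
  shows "\<exists>c>0. \<forall>x\<in>E. c * norm x \<le> norm (A x - z *\<^sub>C x)"
proof (cases "Im z = 0")
  case True
  then have "z = complex_of_real (Re z)" by (simp add: complex_eq_iff)
  then have "z \<notin> spectrum E A" using assms unfolding real_spectrum_def by (metis image_eqI mem_Collect_eq)
  then obtain B where B: "\<And>x. x \<in> E \<Longrightarrow> blinfun_apply B (A x - z *\<^sub>C x) = x"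
    by (auto simp: spectrum_def)
  have pos: "0 < norm B + 1" by (simp add: add_nonneg_pos)
  have "1 / (norm B + 1) * norm x \<le> norm (A x - z *\<^sub>C x)" if "x \<in> E" for x
  proof -
    have "norm x \<le> norm B * norm (A x - z *\<^sub>C x)"
      using norm_blinfun[of B "A x - z *\<^sub>C x"] B[OF that] by simp
    also have "\<dots> \<le> (norm B + 1) * norm (A x - z *\<^sub>C x)" by (intro mult_right_mono) auto
    finally show ?thesis using pos by (simp add: field_simps)
  qed
  then show ?thesis using pos by (intro exI[of _ "1 / (norm B + 1)"]) auto
next
  case False
  have "\<bar>Im z\<bar> * norm x \<le> norm (A x - z *\<^sub>C x)" for x
  proof -
    let ?u = "A x - Re z *\<^sub>R x" and ?v = "Im z *\<^sub>R (\<i> *\<^sub>C x)"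
    have "cinner ?u x = cinner x ?u"
      using selfadj_cinner[OF bounded_ops_clin[OF A] sa, of x x]
      by (simp add: cinner_diff_left cinner_diff_right cinner_scaleR_left cinner_scaleR_right)
    then have "Im (cinner ?u x) = 0"
      using cinner_commute[of x ?u] by (metis Reals_cnj_iff complex_is_Real_iff)
    then have orth: "inner ?u (\<i> *\<^sub>C x) = 0" by (simp add: Im_cinner)
    have pyth: "(norm (u - r *\<^sub>R v))\<^sup>2 = (norm u)\<^sup>2 + (norm (r *\<^sub>R v))\<^sup>2" if "inner u v = 0" for u v :: 'h and r
      using that unfolding power2_norm_eq_inner by (simp add: inner_diff inner_commute)
    have "A x - z *\<^sub>C x = ?u - ?v"
      unfolding diff_diff_eq by (rule arg_cong[OF scaleC_eq_Re_Im])
    then have "(norm (A x - z *\<^sub>C x))\<^sup>2 = (norm ?u)\<^sup>2 + (norm ?v)\<^sup>2"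
      by (simp only: pyth[OF orth])
    moreover have "norm ?v = \<bar>Im z\<bar> * norm x" by (simp add: norm_scaleC)
    ultimately have "(\<bar>Im z\<bar> * norm x)\<^sup>2 \<le> (norm (A x - z *\<^sub>C x))\<^sup>2"
      by (metis le_add_same_cancel2 zero_le_power2)
    then show ?thesis by (rule power2_le_imp_le) simp
  qed
  then show ?thesis using False by (intro exI[of _ "\<bar>Im z\<bar>"]) auto
qed

text \<open>By the fundamental theorem of algebra the polynomial splits into linear factors, each
  bounded below; the constants multiply.\<close>

lemma vec_poly_bounded_below:
  assumes "q \<noteq> 0" "\<And>z. poly q z = 0 \<Longrightarrow> z \<notin> complex_of_real ` real_spectrum E A"
  shows "\<exists>c>0. \<forall>x\<in>E. c * norm x \<le> norm (vec_poly A q x)"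
  using assms
proof (induction "degree q" arbitrary: q)
  case 0
  then obtain a where q: "q = [:a:]" using degree_eq_zeroE by metis
  then have "a \<noteq> 0" using 0 by simp
  then show ?case by (intro exI[of _ "cmod a"]) (auto simp: q norm_scaleC)
next
  case (Suc n)
  then have "\<not> constant (poly q)" by (simp add: constant_degree)
  then obtain z where z: "poly q z = 0" using fundamental_theorem_of_algebra by blast
  then have "[:-z, 1:] dvd q" by (simp only: poly_eq_0_iff_dvd)
  then obtain r where r: "q = [:-z, 1:] * r" by (rule dvdE)
  then have "r \<noteq> 0" using Suc.prems by auto
  moreover have "n = degree r"
  proof -
    have "degree q = degree [:-z, 1:] + degree r"
      unfolding r by (rule degree_mult_eq) (use \<open>r \<noteq> 0\<close> in auto)
    then show ?thesis using Suc.hyps(2) by simp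
  qed
  ultimately obtain c where c: "c > 0" "\<And>x. x \<in> E \<Longrightarrow> c * norm x \<le> norm (vec_poly A r x)"
    using Suc.hyps(1)[of r] Suc.prems r by auto
  obtain d where d: "d > 0" "\<And>x. x \<in> E \<Longrightarrow> d * norm x \<le> norm (A x - z *\<^sub>C x)"
    using bounded_below_nonspectrum Suc.prems(2)[OF z] by blast
  have "d * c * norm x \<le> norm (vec_poly A q x)" if x: "x \<in> E" for x
  proof -
    have "d * (c * norm x) \<le> d * norm (vec_poly A r x)" using c(2)[OF x] d(1) by simp
    also have "\<dots> \<le> norm (vec_poly A q x)"
      unfolding r vec_poly_linear_factor[OF bounded_ops_clin[OF A]] by (rule d(2)[OF vec_poly_in[OF E A x]])
    finally show ?thesis by (simp add: mult.assoc)
  qed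
  then show ?case using c d by (intro exI[of _ "d * c"]) auto
qed

text \<open>The squared norm N^2 belongs to the approximate spectrum of T^2. Expanding the square of
  T^2 x - N^2 x, a lower bound c would give |T x|^2 \<le> (N^2 - c^2 / N^2) |x|^2, so that the norm
  of T would be less than N.\<close>

lemma square_minus_norm_not_bounded_below:
  assumes T: "T \<in> bounded_ops E E" "selfadj T" and ne: "\<exists>x\<in>E. x \<noteq> 0" and c: "0 < c"
    and below: "\<And>x. x \<in> E \<Longrightarrow> c * norm x \<le> norm (T (T x) - (norm T)\<^sup>2 *\<^sub>R x)"
  shows False
proof -
  define N where "N = norm T"
  show False
  proof (cases "N = 0")
    case True
    then have "T = 0" by (simp add: N_def)
    obtain x where "x \<in> E" "x \<noteq> 0" using ne by blast
    then show False using below[of x] c \<open>T = 0\<close> by (simp add: mult_le_0_iff)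
  next
    case False
    then have N: "N > 0" by (simp add: N_def)
    \<comment> \<open>The maximum with 0 makes the square root of d available; d stays below
      N^2.\<close>
    define d where "d = max 0 (N\<^sup>2 - c\<^sup>2 / N\<^sup>2)"
    have E_bound: "(norm (T x))\<^sup>2 \<le> d * (norm x)\<^sup>2" if x: "x \<in> E" for x
    proof -
      have "(c * norm x)\<^sup>2 \<le> (norm (T (T x) - N\<^sup>2 *\<^sub>R x))\<^sup>2"
        using below[OF x] c by (intro power_mono) (auto simp: N_def)
      also have "\<dots> = (norm (T (T x)))\<^sup>2 - 2 * N\<^sup>2 * (norm (T x))\<^sup>2 + N^4 * (norm x)\<^sup>2"
      proof -
        have "inner (T (T x)) x = inner (T x) (T x)" by (rule selfadjD[OF T(2)])
        then show ?thesis
          unfolding power2_norm_eq_inner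
          by (simp add: inner_diff inner_commute[of x "T (T x)"] algebra_simps power4_eq_xxxx power2_eq_square)
      qed
      also have "(norm (T (T x)))\<^sup>2 \<le> N\<^sup>2 * (norm (T x))\<^sup>2"
        using power_mono[OF norm_blinfun[of T "T x"], of 2] by (simp add: N_def power_mult_distrib)
      finally have "N\<^sup>2 * (norm (T x))\<^sup>2 \<le> (N^4 - c\<^sup>2) * (norm x)\<^sup>2"
        by (simp add: power_mult_distrib algebra_simps)
      then have "(norm (T x))\<^sup>2 \<le> (N\<^sup>2 - c\<^sup>2 / N\<^sup>2) * (norm x)\<^sup>2"
        using N by (simp add: field_simps power4_eq_xxxx power2_eq_square)
      also have "\<dots> \<le> d * (norm x)\<^sup>2" by (intro mult_right_mono) (auto simp: d_def)
      finally show ?thesis .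
    qed
    have "norm (T x) \<le> sqrt d * norm x" for x
    proof -
      have "(norm (T x))\<^sup>2 \<le> d * (norm (id_op E x))\<^sup>2"
        using E_bound[OF id_op_in[OF E, of x]] by (simp add: bounded_ops_id_op[OF E T(1)])
      also have "\<dots> \<le> d * (norm x)\<^sup>2"
        using norm_id_op_le[OF E, of x] by (intro mult_left_mono power_mono) (auto simp: d_def)
      also have "\<dots> = (sqrt d * norm x)\<^sup>2" by (simp add: power_mult_distrib d_def)
      finally show ?thesis by (rule power2_le_imp_le) (simp add: d_def)
    qed
    then have "N \<le> sqrt d" unfolding N_def by (intro norm_blinfun_bound) (auto simp: d_def)
    then have "N\<^sup>2 \<le> d" using N by (simp add: real_le_rsqrt sqrt_ge_absD)
    moreover have "d < N\<^sup>2" using N c by (simp add: d_def)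
    ultimately show False by simp
  qed
qed

text \<open>If p^2 - |p(A)|^2 had no zero on the spectrum, p(A)^2 - |p(A)|^2 would be bounded below,
  against the previous lemma for T = p(A).\<close>

lemma norm_poly_op_attained_aux:
  assumes ne: "\<exists>x\<in>E. x \<noteq> 0" and q: "p * p - [:(norm (poly_op E p A))\<^sup>2:] \<noteq> 0"
  shows "\<exists>t\<in>real_spectrum E A. \<bar>poly p t\<bar> = norm (poly_op E p A)"
proof (rule ccontr)
  let ?T = "poly_op E p A"
  let ?q = "p * p - [:(norm ?T)\<^sup>2:]"
  let ?Q = "map_poly complex_of_real ?q"
  assume *: "\<not> ?thesis"
  have nz: "poly ?q t \<noteq> 0" if "t \<in> real_spectrum E A" for t
  proof
    assume "poly ?q t = 0"
    then have "(poly p t)\<^sup>2 = (norm ?T)\<^sup>2" by (simp add: power2_eq_square)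
    then have "\<bar>poly p t\<bar> = norm ?T" by (metis abs_norm_cancel power2_eq_iff_nonneg abs_ge_zero power2_abs)
    then show False using * that by blast
  qed
  have "\<exists>c>0. \<forall>x\<in>E. c * norm x \<le> norm (vec_poly A ?Q x)"
  proof (rule vec_poly_bounded_below)
    show "?Q \<noteq> 0" using q by (simp add: map_poly_eq_0_iff)
    fix z assume z: "poly ?Q z = 0"
    show "z \<notin> complex_of_real ` real_spectrum E A"
    proof
      assume "z \<in> complex_of_real ` real_spectrum E A"
      then obtain t where t: "t \<in> real_spectrum E A" "z = complex_of_real t" by blast
      have "complex_of_real (poly ?q t) = 0" using z by (simp only: t(2) poly_map_of_real)
      then have "poly ?q t = 0" by (simp only: of_real_eq_0_iff)
      then show False using nz[OF t(1)] by contradiction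
    qed
  qed
  then obtain c where c: "c > 0" "\<And>x. x \<in> E \<Longrightarrow> c * norm x \<le> norm (vec_poly A ?Q x)" by blast
  show False
  proof (rule square_minus_norm_not_bounded_below[OF poly_op_bops[OF E A] selfadj_poly_op[OF E A sa] ne c(1)])
    fix x assume x: "x \<in> E"
    have "vec_poly A ?Q x = ?T (?T x) - (norm ?T)\<^sup>2 *\<^sub>R x"
      unfolding vec_poly_of_real[OF E A x]
      by (simp add: poly_op_diff poly_op_mult[OF E A] poly_op_const blinfun.diff_left blinfun.scaleR_left id_op_props(2)[OF E x])
    then show "c * norm x \<le> norm (?T (?T x) - (norm ?T)\<^sup>2 *\<^sub>R x)" using c(2)[OF x] by simp
  qed
qed

lemma norm_poly_op_attained:
  assumes ne: "\<exists>x\<in>E. x \<noteq> 0"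
  shows "\<exists>t\<in>real_spectrum E A. \<bar>poly p t\<bar> = norm (poly_op E p A)"
proof (cases "p * p - [:(norm (poly_op E p A))\<^sup>2:] = 0")
  case True
  \<comment> \<open>If p^2 is the constant |p(A)|^2, every spectral point will do; the polynomial X,
    for which the auxiliary lemma applies, shows that there is one.\<close>
  have "\<exists>t\<in>real_spectrum E A. \<bar>poly [:0, 1:] t\<bar> = norm (poly_op E [:0, 1:] A)"
    by (rule norm_poly_op_attained_aux[OF ne]) simp
  then obtain t where t: "t \<in> real_spectrum E A" by blast
  have "poly (p * p - [:(norm (poly_op E p A))\<^sup>2:]) t = 0" using True by simp
  then have "(poly p t)\<^sup>2 = (norm (poly_op E p A))\<^sup>2" by (simp add: power2_eq_square)
  then have "\<bar>poly p t\<bar> = norm (poly_op E p A)" by (metis abs_norm_cancel power2_eq_iff_nonneg abs_ge_zero power2_abs)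
  then show ?thesis using t by blast
qed (rule norm_poly_op_attained_aux[OF ne])

lemma norm_poly_op_le:
  assumes "0 \<le> K" "\<And>t. t \<in> real_spectrum E A \<Longrightarrow> \<bar>poly p t\<bar> \<le> K"
  shows "norm (poly_op E p A) \<le> K"
proof (cases "\<exists>x\<in>E. x \<noteq> 0")
  case True
  then show ?thesis using norm_poly_op_attained[OF True, of p] assms by metis
next
  \<comment> \<open>On the zero space the spectrum is empty, but the operator is 0.\<close>
  case False
  then have "poly_op E p A x = 0" for x
    using bounded_opsD(2)[OF poly_op_bops[OF E A], of p x] by blast
  then have "poly_op E p A = 0" by (auto intro: blinfun_eqI)
  then show ?thesis using assms by simp
qed

text \<open>Otherwise A - t is bounded below on E, hence invertible there by self-adjointness, and t
  is not in the spectrum.\<close>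

lemma approximate_eigenvector:
  assumes t: "t \<in> real_spectrum E A" and c: "0 < c"
  obtains x where "x \<in> E" "norm x = 1" "norm (A x - t *\<^sub>R x) < c"
proof -
  let ?T = "A - t *\<^sub>R id_op E"
  have T: "?T \<in> bounded_ops E E" "selfadj ?T"
    using A sa by (auto intro!: bops_diff[OF E] bops_scaleR[OF E] id_op_props[OF E] selfadj_diff selfadj_scaleR selfadj_id_op[OF E])
  have app: "?T x = A x - t *\<^sub>R x" if "x \<in> E" for x
    using that by (simp add: blinfun.diff_left blinfun.scaleR_left id_op_props(2)[OF E])
  have "\<exists>x\<in>E. norm (?T x) < c * norm x"
  proof (rule ccontr)
    assume "\<not> ?thesis"
    then have below: "c * norm x \<le> norm (?T x)" if "x \<in> E" for x using that by (auto simp: not_less)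
    obtain B where B: "B \<in> bounded_ops E E" "\<And>x. x \<in> E \<Longrightarrow> blinfun_apply B (?T x) = x" "\<And>x. x \<in> E \<Longrightarrow> ?T (B x) = x"
      using selfadj_bounded_below_inverse[OF E T c below] by metis
    have "complex_of_real t \<notin> spectrum E A"
      unfolding spectrum_def mem_Collect_eq not_not
      using B bounded_opsD(2)[OF B(1)] by (intro bexI[of _ B]) (auto simp: app scaleC_of_real)
    then show False using t by (simp add: real_spectrum_def)
  qed
  then obtain x where x: "x \<in> E" "norm (?T x) < c * norm x" by blast
  then have "0 < norm x" using c by (cases "x = 0") auto
  let ?y = "(1 / norm x) *\<^sub>R x"
  show thesis
  proof (rule that[of ?y])
    show "?y \<in> E" using x hilbertD[OF E] by blast
    show "norm ?y = 1" using \<open>0 < norm x\<close> by simp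
    have "A ?y - t *\<^sub>R ?y = (1 / norm x) *\<^sub>R ?T x"
      by (simp add: app[OF x(1)] blinfun.scaleR_right scaleR_diff_right)
    then show "norm (A ?y - t *\<^sub>R ?y) < c" using x \<open>0 < norm x\<close> by (simp add: field_simps)
  qed
qed

text \<open>The polynomial p - p(t) is divisible by X - t, so p(A) x is close to p(t) x for an
  approximate eigenvector x.\<close>

lemma poly_spectrum_le_norm:
  assumes t: "t \<in> real_spectrum E A"
  shows "\<bar>poly p t\<bar> \<le> norm (poly_op E p A)"
proof (rule field_le_epsilon)
  fix e :: real assume e: "0 < e"
  have "poly (p - [:poly p t:]) t = 0" by simp
  then have "[:-t, 1:] dvd p - [:poly p t:]" by (simp only: poly_eq_0_iff_dvd)
  then obtain r where r: "p - [:poly p t:] = [:-t, 1:] * r" by (rule dvdE)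
  let ?R = "poly_op E r A"
  define c where "c = e / (norm ?R + 1)"
  have pos: "0 < norm ?R + 1" by (simp add: add_nonneg_pos)
  then have "0 < c" using e by (simp add: c_def)
  then obtain x where x: "x \<in> E" "norm x = 1" "norm (A x - t *\<^sub>R x) < c"
    by (rule approximate_eigenvector[OF t])
  have "poly_op E p A = poly_op E ([:poly p t:] + r * [:-t, 1:]) A"
    using r by (metis add.commute diff_add_cancel mult.commute)
  then have "poly_op E p A x = poly p t *\<^sub>R x + ?R (A x - t *\<^sub>R x)"
    by (simp only: poly_op_add poly_op_mult[OF E A] poly_op_const)
       (simp add: poly_op_pCons blinfun.add_left blinfun.diff_left blinfun.scaleR_left id_op_props(2)[OF E] x
        bounded_ops_id_op[OF E A])
  then have "poly p t *\<^sub>R x = poly_op E p A x - ?R (A x - t *\<^sub>R x)" by simp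
  then have "\<bar>poly p t\<bar> = norm (poly_op E p A x - ?R (A x - t *\<^sub>R x))"
    using x by (metis mult.right_neutral norm_scaleR)
  also have "\<dots> \<le> norm (poly_op E p A x) + norm (?R (A x - t *\<^sub>R x))" by (rule norm_triangle_ineq4)
  also have "norm (poly_op E p A x) \<le> norm (poly_op E p A)"
    using norm_blinfun[of "poly_op E p A" x] x by simp
  also have "norm (?R (A x - t *\<^sub>R x)) \<le> norm ?R * c"
    using norm_blinfun[of ?R "A x - t *\<^sub>R x"] x by (meson less_imp_le mult_left_mono norm_ge_zero order_trans)
  also have "norm ?R * c \<le> e" using pos e by (simp add: c_def field_simps)
  finally show "\<bar>poly p t\<bar> \<le> norm (poly_op E p A) + e" by simp
qed

text \<open>The values of the quadratic form at approximate unit eigenvectors approach t and lie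
  between a and b.\<close>

lemma spectrum_bounds:
  assumes ab: "a *\<^sub>R id_op E \<sqsubseteq>\<^sub>L A" "A \<sqsubseteq>\<^sub>L b *\<^sub>R id_op E" and t: "t \<in> real_spectrum E A"
  shows "a \<le> t" "t \<le> b"
proof -
  have *: "a \<le> t + e \<and> t \<le> b + e" if e: "0 < e" for e
  proof -
    obtain x where x: "x \<in> E" "norm x = 1" "norm (A x - t *\<^sub>R x) < e"
      by (rule approximate_eigenvector[OF t e])
    have xx: "inner x x = 1" using x(2) by (simp add: norm_eq_1)
    have "\<bar>inner (A x - t *\<^sub>R x) x\<bar> \<le> norm (A x - t *\<^sub>R x) * norm x" by (rule Cauchy_Schwarz_ineq2)
    then have "\<bar>inner (A x) x - t\<bar> < e" using x xx by (simp add: inner_diff_left)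
    moreover have "a \<le> inner (A x) x" "inner (A x) x \<le> b"
      using loewner_leD[OF ab(1), of x] loewner_leD[OF ab(2), of x] x xx
      by (simp_all add: blinfun.scaleR_left id_op_props(2)[OF E])
    ultimately show ?thesis by (simp add: abs_less_iff)
  qed
  show "a \<le> t" by (rule field_le_epsilon) (use * in blast)
  show "t \<le> b" by (rule field_le_epsilon) (use * in blast)
qed

end

section \<open>Continuous functional calculus\<close>

lemma ex_poly_approximation:
  fixes f :: "real \<Rightarrow> real"
  assumes "continuous_on {a..b} f" "S \<subseteq> {a..b}"
  shows "\<exists>p. uniform_limit S (\<lambda>n. poly (p n)) f sequentially"
proof -
  have "\<exists>q. \<forall>x\<in>{a..b}. \<bar>f x - poly q x\<bar> < inverse (real (Suc n))" for n
  proof -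
    obtain g where g: "real_polynomial_function g" "\<And>x. x \<in> {a..b} \<Longrightarrow> \<bar>f x - g x\<bar> < inverse (real (Suc n))"
      using Stone_Weierstrass_real_polynomial_function[OF compact_Icc assms(1), of "inverse (real (Suc n))"] by auto
    obtain c m where "g = (\<lambda>x. \<Sum>i\<le>m. c i * x ^ i)"
      using real_polynomial_function_imp_sum[OF g(1)] by auto
    then have "g = poly (\<Sum>i\<le>m. monom (c i) i)" by (auto simp: poly_sum poly_monom)
    then show ?thesis using g(2) by metis
  qed
  then obtain q where q: "\<And>n x. x \<in> {a..b} \<Longrightarrow> \<bar>f x - poly (q n) x\<bar> < inverse (real (Suc n))" by metis
  have "uniform_limit S (\<lambda>n. poly (q n)) f sequentially"
    unfolding uniform_limit_sequentially_iff
  proof (intro allI impI)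
    fix e :: real assume "0 < e"
    then obtain N where N: "inverse (real (Suc N)) < e" using reals_Archimedean by blast
    have "dist (poly (q n) x) (f x) < e" if "n \<ge> N" "x \<in> S" for n x
    proof -
      have "inverse (real (Suc n)) \<le> inverse (real (Suc N))" using that by (simp add: le_imp_inverse_le)
      moreover have "x \<in> {a..b}" using that assms(2) by blast
      ultimately show ?thesis using q[of x n] N unfolding dist_real_def by linarith
    qed
    then show "\<exists>N. \<forall>n\<ge>N. \<forall>x\<in>S. dist (poly (q n) x) (f x) < e" by blast
  qed
  then show ?thesis by blast
qed

context
  fixes E :: "'h::chilbert_space set" and A :: "'h operator"
  assumes E: "hilbert E" and A: "A \<in> bounded_ops E E" and sa: "selfadj A"
begin

text \<open>This makes the definite description in \<open>op_fun\<close> meaningful. Two sequences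
  that approximate f on the spectrum have operators whose distance tends to 0, by
  \<open>norm_poly_op_le\<close>; completeness provides the limit, and it does not depend on the
  sequence.\<close>

lemma op_fun_limit:
  assumes p: "uniform_limit (real_spectrum E A) (\<lambda>n. poly (p n)) f sequentially"
  shows "(\<lambda>n. poly_op E (p n) A) \<longlonglongrightarrow> op_fun E f A"
proof -
  have close: "\<exists>N. \<forall>m\<ge>N. \<forall>n\<ge>N. norm (poly_op E (p m) A - poly_op E (q n) A) < e"
    if pq: "uniform_limit (real_spectrum E A) (\<lambda>n. poly (p n)) f sequentially"
      "uniform_limit (real_spectrum E A) (\<lambda>n. poly (q n)) f sequentially" and e: "0 < e" for p q e
  proof -
    obtain M where M: "\<And>n x. n \<ge> M \<Longrightarrow> x \<in> real_spectrum E A \<Longrightarrow> dist (poly (p n) x) (f x) < e / 4"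
      using pq(1) e unfolding uniform_limit_sequentially_iff by (metis divide_pos_pos zero_less_numeral)
    obtain N where N: "\<And>n x. n \<ge> N \<Longrightarrow> x \<in> real_spectrum E A \<Longrightarrow> dist (poly (q n) x) (f x) < e / 4"
      using pq(2) e unfolding uniform_limit_sequentially_iff by (metis divide_pos_pos zero_less_numeral)
    have "norm (poly_op E (p m) A - poly_op E (q n) A) < e" if "m \<ge> max M N" "n \<ge> max M N" for m n
    proof -
      have "norm (poly_op E (p m - q n) A) \<le> e / 2"
      proof (rule norm_poly_op_le[OF E A sa])
        fix t assume t: "t \<in> real_spectrum E A"
        have "dist (poly (p m) t) (f t) < e / 4" "dist (poly (q n) t) (f t) < e / 4"
          using M[OF _ t, of m] N[OF _ t, of n] that by auto
        then show "\<bar>poly (p m - q n) t\<bar> \<le> e / 2" unfolding dist_real_def poly_diff by linarith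
      qed (use e in simp)
      then show ?thesis using e by (simp add: poly_op_diff)
    qed
    then show ?thesis by blast
  qed
  have "Cauchy (\<lambda>n. poly_op E (p n) A)"
    by (rule CauchyI) (use close[OF p p] in blast)
  then obtain T where T: "(\<lambda>n. poly_op E (p n) A) \<longlonglongrightarrow> T"
    using Cauchy_convergent convergent_def by blast
  have all: "(\<lambda>n. poly_op E (q n) A) \<longlonglongrightarrow> T"
    if q: "uniform_limit (real_spectrum E A) (\<lambda>n. poly (q n)) f sequentially" for q
  proof -
    have "(\<lambda>n. poly_op E (q n) A - poly_op E (p n) A) \<longlonglongrightarrow> 0"
      unfolding LIMSEQ_iff using close[OF q p] by (metis diff_zero)
    from tendsto_add[OF this T] show ?thesis by simp
  qed
  have "op_fun E f A = T"
    unfolding op_fun_def real_spectrum_def[symmetric]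
  proof (rule the_equality)
    show "T' = T" if "\<forall>p. uniform_limit (real_spectrum E A) (\<lambda>n. poly (p n)) f sequentially \<longrightarrow> (\<lambda>n. poly_op E (p n) A) \<longlonglongrightarrow> T'" for T'
      using that p T LIMSEQ_unique by blast
  qed (use all in blast)
  then show ?thesis using T by simp
qed

context
  fixes f :: "real \<Rightarrow> real" and a b :: real
  assumes f: "continuous_on {a..b} f" and S: "real_spectrum E A \<subseteq> {a..b}"
begin

lemma op_fun_approx:
  obtains p where "uniform_limit (real_spectrum E A) (\<lambda>n. poly (p n)) f sequentially"
    "(\<lambda>n. poly_op E (p n) A) \<longlonglongrightarrow> op_fun E f A"
  using ex_poly_approximation[OF f S] op_fun_limit by blast

lemma op_fun_bops: "op_fun E f A \<in> bounded_ops E E"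
proof -
  obtain p where "(\<lambda>n. poly_op E (p n) A) \<longlonglongrightarrow> op_fun E f A" using op_fun_approx by blast
  then show ?thesis by (rule bops_limit[OF E poly_op_bops[OF E A]])
qed

lemma selfadj_op_fun: "selfadj (op_fun E f A)"
proof -
  obtain p where "(\<lambda>n. poly_op E (p n) A) \<longlonglongrightarrow> op_fun E f A" using op_fun_approx by blast
  then show ?thesis by (rule selfadj_limit[OF selfadj_poly_op[OF E A sa]])
qed

lemma op_fun_commute: "op_fun E f A o\<^sub>L A = A o\<^sub>L op_fun E f A"
proof -
  obtain p where p: "(\<lambda>n. poly_op E (p n) A) \<longlonglongrightarrow> op_fun E f A" using op_fun_approx by blast
  have "(\<lambda>n. poly_op E (p n) A o\<^sub>L A) \<longlonglongrightarrow> (op_fun E f A o\<^sub>L A)"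
    by (rule bounded_bilinear.tendsto[OF bounded_bilinear_blinfun_compose p tendsto_const])
  moreover have "(\<lambda>n. A o\<^sub>L poly_op E (p n) A) \<longlonglongrightarrow> (A o\<^sub>L op_fun E f A)"
    by (rule bounded_bilinear.tendsto[OF bounded_bilinear_blinfun_compose tendsto_const p])
  ultimately show ?thesis using LIMSEQ_unique by (simp add: poly_op_commute[OF E A])
qed

lemma norm_op_fun_le:
  assumes K: "0 \<le> K" "\<And>t. t \<in> real_spectrum E A \<Longrightarrow> \<bar>f t\<bar> \<le> K"
  shows "norm (op_fun E f A) \<le> K"
proof (rule field_le_epsilon)
  fix e :: real assume e: "0 < e"
  obtain p where p: "uniform_limit (real_spectrum E A) (\<lambda>n. poly (p n)) f sequentially"
    "(\<lambda>n. poly_op E (p n) A) \<longlonglongrightarrow> op_fun E f A" by (rule op_fun_approx)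
  obtain N where N: "\<forall>n\<ge>N. \<forall>t\<in>real_spectrum E A. dist (poly (p n) t) (f t) < e"
    using p(1) e unfolding uniform_limit_sequentially_iff by blast
  have "norm (poly_op E (p n) A) \<le> K + e" if "n \<ge> N" for n
  proof (rule norm_poly_op_le[OF E A sa])
    fix t assume t: "t \<in> real_spectrum E A"
    have "\<bar>poly (p n) t - f t\<bar> < e" using N t that by (auto simp: dist_real_def)
    then show "\<bar>poly (p n) t\<bar> \<le> K + e" using K(2)[OF t] by linarith
  qed (use K e in simp)
  then show "norm (op_fun E f A) \<le> K + e"
    by (intro LIMSEQ_le_const2[OF tendsto_norm[OF p(2)]]) blast
qed

text \<open>Together with \<open>norm_op_fun_le\<close>, norm bounds for f(A) become pointwise
  bounds for f on the spectrum. This turns the Thompson metric into a condition on the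
  spectrum.\<close>

lemma spectrum_le_norm_op_fun:
  assumes t: "t \<in> real_spectrum E A"
  shows "\<bar>f t\<bar> \<le> norm (op_fun E f A)"
proof -
  obtain p where p: "uniform_limit (real_spectrum E A) (\<lambda>n. poly (p n)) f sequentially"
    "(\<lambda>n. poly_op E (p n) A) \<longlonglongrightarrow> op_fun E f A" by (rule op_fun_approx)
  have "(\<lambda>n. poly (p n) t) \<longlonglongrightarrow> f t" by (rule tendsto_uniform_limitI[OF p(1) t])
  then show ?thesis
    by (intro LIMSEQ_le[OF tendsto_rabs tendsto_norm[OF p(2)]])
       (use poly_spectrum_le_norm[OF E A sa t] in auto)
qed

end

lemma op_fun_one: "op_fun E (\<lambda>_. 1) A = id_op E"
proof -
  have "(\<lambda>n::nat. poly_op E [:1:] A) \<longlonglongrightarrow> op_fun E (\<lambda>_. 1) A"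
    by (rule op_fun_limit) (simp add: uniform_limit_sequentially_iff)
  then show ?thesis by (simp add: poly_op_const LIMSEQ_const_iff)
qed

text \<open>The upper bound is a bound for the norm of A. The lower one follows from the bound b - a
  for the norm of b - A, since the polynomial b - X lies between 0 and b - a on the
  spectrum.\<close>

lemma loewner_iff_spectrum_bounds:
  assumes "0 \<sqsubseteq>\<^sub>L A" and bound: "\<And>t. t \<in> real_spectrum E A \<Longrightarrow> a \<le> t \<and> t \<le> b" and ab: "a \<le> b" "0 \<le> b"
  shows "a *\<^sub>R id_op E \<sqsubseteq>\<^sub>L A" "A \<sqsubseteq>\<^sub>L b *\<^sub>R id_op E"
proof -
  have t0: "0 \<le> t" if "t \<in> real_spectrum E A" for t
    by (rule spectrum_bounds(1)[OF E A sa _ loewner_le_norm[OF E A sa order_refl] that]) (simp add: assms)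
  have "norm (poly_op E [:0, 1:] A) \<le> b"
  proof (rule norm_poly_op_le[OF E A sa])
    fix t assume "t \<in> real_spectrum E A"
    then show "\<bar>poly [:0, 1:] t\<bar> \<le> b" using bound[of t] t0[of t] by simp
  qed (use ab in simp)
  then show "A \<sqsubseteq>\<^sub>L b *\<^sub>R id_op E"
    by (intro loewner_le_norm[OF E A sa]) (simp add: poly_op_X[OF E A])
  have "norm (poly_op E ([:b:] - [:0, 1:]) A) \<le> b - a"
    by (rule norm_poly_op_le[OF E A sa]) (use bound ab in \<open>auto simp: abs_le_iff algebra_simps\<close>)
  then have "norm (b *\<^sub>R id_op E - A) \<le> b - a" by (simp only: poly_op_diff poly_op_X[OF E A] poly_op_const)
  then have "b *\<^sub>R id_op E - A \<sqsubseteq>\<^sub>L (b - a) *\<^sub>R id_op E"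
    using A sa by (intro loewner_le_norm[OF E])
      (auto intro!: bops_diff[OF E] bops_scaleR[OF E] id_op_props[OF E] selfadj_diff selfadj_scaleR selfadj_id_op[OF E])
  then show "a *\<^sub>R id_op E \<sqsubseteq>\<^sub>L A"
    by (simp add: loewner_le_def algebra_simps)
qed

end

section \<open>The Thompson metric\<close>

lemma conj_mono:
  assumes R: "R \<in> bounded_ops E E" "selfadj R" and AB: "clin A" "selfadj A" "clin B" "selfadj B" "A \<sqsubseteq>\<^sub>L B"
  shows "R o\<^sub>L A o\<^sub>L R \<sqsubseteq>\<^sub>L R o\<^sub>L B o\<^sub>L R"
proof (rule loewner_leI)
  fix x
  show "inner ((R o\<^sub>L A o\<^sub>L R) x) x \<le> inner ((R o\<^sub>L B o\<^sub>L R) x) x"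
    using loewner_leD[OF AB(5), of "R x"] by (simp add: selfadjD[OF R(2)])
qed (use bounded_ops_clin[OF R(1)] R(2) AB in \<open>auto simp: clin_def selfadj_def\<close>)

context
  fixes E :: "'h::chilbert_space set"
  assumes E: "hilbert E"
begin

lemma pos_spectrum:
  assumes A: "A \<in> \<P> E"
  obtains a b where "0 < a" "real_spectrum E A \<subseteq> {a..b}"
proof -
  obtain a where a: "0 < a" "a *\<^sub>R id_op E \<sqsubseteq>\<^sub>L A" by (rule pos_ops_lower[OF E A])
  obtain b where b: "A \<sqsubseteq>\<^sub>L b *\<^sub>R id_op E" by (rule pos_ops_upper[OF E A])
  have "real_spectrum E A \<subseteq> {a..b}"
    using spectrum_bounds[OF E pos_opsD(1,3)[OF E A] a(2) b] by auto
  then show thesis using that a by blast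
qed

text \<open>If p_n approximates t^(-1/2) on the spectrum, which is bounded away from 0, then
  p_n(t)^2 t tends uniformly to 1; passing to the operators gives R R A = 1.\<close>

lemma inverse_sqrt_props:
  fixes A :: "'h operator"
  defines "R \<equiv> op_fun E (\<lambda>t. t powr (- 1 / 2)) A"
  assumes A: "A \<in> \<P> E"
  shows "R \<in> bounded_ops E E" "selfadj R" "R o\<^sub>L A = A o\<^sub>L R" "R o\<^sub>L (R o\<^sub>L A) = id_op E"
proof -
  note Ab = pos_opsD(1,3)[OF E A]
  let ?f = "\<lambda>t::real. t powr (- 1 / 2)"
  obtain a b where ab: "0 < a" "real_spectrum E A \<subseteq> {a..b}" by (rule pos_spectrum[OF A])
  have f: "continuous_on {a..b} ?f" using ab(1) by (intro continuous_intros) auto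
  show "R \<in> bounded_ops E E" "selfadj R" "R o\<^sub>L A = A o\<^sub>L R"
    unfolding R_def using op_fun_bops[OF E Ab f ab(2)] selfadj_op_fun[OF E Ab f ab(2)] op_fun_commute[OF E Ab f ab(2)] by auto
  obtain p where p: "uniform_limit (real_spectrum E A) (\<lambda>n. poly (p n)) ?f sequentially"
    "(\<lambda>n. poly_op E (p n) A) \<longlonglongrightarrow> R" unfolding R_def by (rule op_fun_approx[OF E Ab f ab(2)])
  have bdd: "bounded (?f ` real_spectrum E A)"
    by (rule bounded_subset[OF compact_imp_bounded[OF compact_continuous_image[OF f compact_Icc]]]) (use ab in auto)
  have bdd': "bounded ((\<lambda>t. ?f t * ?f t) ` real_spectrum E A)"
    by (rule bounded_subset[OF compact_imp_bounded[OF compact_continuous_image[OF continuous_on_mult[OF f f] compact_Icc]]]) (use ab in auto)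
  have bdd'': "bounded ((\<lambda>t. t) ` real_spectrum E A)"
    using bounded_subset[OF bounded_closed_interval] ab(2) by (metis image_ident)
  have "uniform_limit (real_spectrum E A) (\<lambda>n t. poly (p n) t * poly (p n) t * t) (\<lambda>t. ?f t * ?f t * t) sequentially"
    by (intro uniform_lim_mult p(1) uniform_limit_const bdd bdd' bdd'')
  then have "uniform_limit (real_spectrum E A) (\<lambda>n. poly (p n * p n * [:0, 1:])) (\<lambda>_. 1) sequentially"
  proof (rule uniform_limit_cong'[THEN iffD1, rotated -1])
    show "poly (p n) t * poly (p n) t * t = poly (p n * p n * [:0, 1:]) t" for n t by simp
    show "?f t * ?f t * t = 1" if "t \<in> real_spectrum E A" for t
    proof -
      have "0 < t" using that ab by auto
      then have "?f t * ?f t * t = t powr (- 1 / 2) * t powr (- 1 / 2) * t powr 1" by simp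
      also have "\<dots> = 1" using \<open>0 < t\<close> by (simp add: powr_add[symmetric])
      finally show ?thesis .
    qed
  qed
  then have "(\<lambda>n. poly_op E (p n * p n * [:0, 1:]) A) \<longlonglongrightarrow> id_op E"
    using op_fun_limit[OF E Ab] by (metis op_fun_one[OF E Ab])
  moreover have "(\<lambda>n. poly_op E (p n) A o\<^sub>L (poly_op E (p n) A o\<^sub>L A)) \<longlonglongrightarrow> (R o\<^sub>L (R o\<^sub>L A))"
    by (intro bounded_bilinear.tendsto[OF bounded_bilinear_blinfun_compose] p(2) tendsto_const)
  moreover have "poly_op E (p n * p n * [:0, 1:]) A = poly_op E (p n) A o\<^sub>L (poly_op E (p n) A o\<^sub>L A)" for n
    by (rule blinfun_eqI) (simp only: poly_op_mult[OF E Ab(1)] poly_op_X[OF E Ab(1)] blinfun_apply_blinfun_compose)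
  ultimately show "R o\<^sub>L (R o\<^sub>L A) = id_op E" using LIMSEQ_unique by simp
qed

text \<open>The left inverse S makes R bounded below, so the form of B at R x stays coercive in
  x.\<close>

lemma conj_pos:
  assumes B: "B \<in> \<P> E" and R: "R \<in> bounded_ops E E" "selfadj R" and S: "\<And>x. x \<in> E \<Longrightarrow> blinfun_apply S (R x) = x"
  shows "R o\<^sub>L B o\<^sub>L R \<in> \<P> E"
proof -
  note Bd = pos_opsD[OF E B]
  obtain m where m: "0 < m" "m *\<^sub>R id_op E \<sqsubseteq>\<^sub>L B" by (rule pos_ops_lower[OF E B])
  define k where "k = norm S + 1"
  have k: "norm S \<le> k" "0 < k" by (auto simp: k_def add_nonneg_pos)
  show ?thesis
  proof (rule pos_opsI[OF E, of _ "m / k\<^sup>2"])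
    show "R o\<^sub>L B o\<^sub>L R \<in> bounded_ops E E" using R Bd(1) by (intro bops_compose[OF E])
    show "selfadj (R o\<^sub>L B o\<^sub>L R)" using R(2) Bd(3) by (auto simp: selfadj_def)
    show "0 < m / k\<^sup>2" using m k by simp
    fix x assume x: "x \<in> E"
    have "norm x \<le> k * norm (R x)" using norm_blinfun_le[OF k(1), of "R x"] S[OF x] by simp
    then have "(norm x)\<^sup>2 \<le> (k * norm (R x))\<^sup>2" by (rule power_mono) simp
    then have "m * (norm x)\<^sup>2 \<le> m * (k * norm (R x))\<^sup>2" using m(1) by simp
    then have "m / k\<^sup>2 * inner x x \<le> m * inner (R x) (R x)"
      using k(2) by (simp add: power2_norm_eq_inner power_mult_distrib field_simps)
    also have "\<dots> \<le> inner (B (R x)) (R x)"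
      using loewner_leD[OF m(2), of "R x"] by (simp add: blinfun.scaleR_left id_op_bounded_ops[OF E R(1)])
    finally show "m / k\<^sup>2 * inner x x \<le> inner ((R o\<^sub>L B o\<^sub>L R) x) x" by (simp add: selfadjD[OF R(2)])
  qed
qed

text \<open>Conjugation with A^(-1/2) and A^(1/2) preserves the order and exchanges bounds of B by
  multiples of A with bounds of A^(-1/2) B A^(-1/2) by scalars; the latter are spectral bounds, that
  is, bounds for the norm of the logarithm. The later arguments reach the metric through this
  description.\<close>

lemma thompson_le_iff:
  assumes A: "A \<in> \<P> E" and B: "B \<in> \<P> E" and r: "0 \<le> r"
  shows "thompson E A B \<le> r \<longleftrightarrow> exp (- r) *\<^sub>R A \<sqsubseteq>\<^sub>L B \<and> B \<sqsubseteq>\<^sub>L exp r *\<^sub>R A"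
proof -
  define R where "R = op_fun E (\<lambda>t. t powr (- 1 / 2)) A"
  note R = inverse_sqrt_props[OF A, folded R_def]
  note Ad = pos_opsD[OF E A] and Bd = pos_opsD[OF E B]
  \<comment> \<open>The square root of A, inverse to R on E.\<close>
  define S where "S = A o\<^sub>L R"
  define C where "C = R o\<^sub>L B o\<^sub>L R"
  have S: "S \<in> bounded_ops E E" "selfadj S"
    using R(1,2) Ad by (auto simp: S_def bops_compose[OF E] selfadj_def) (metis R(3) blinfun_apply_blinfun_compose)
  have RRA: "R (R (A x)) = id_op E x" for x using R(4) by (metis blinfun_apply_blinfun_compose)
  have comm: "R (A x) = A (R x)" for x using R(3) by (metis blinfun_apply_blinfun_compose)
  have RS: "R (S x) = id_op E x" "S (R x) = id_op E x" for x
    using RRA comm by (simp_all add: S_def)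
  have RAR: "R o\<^sub>L A o\<^sub>L R = id_op E" by (rule blinfun_eqI) (simp add: RRA comm[symmetric])
  have SCS: "S o\<^sub>L C o\<^sub>L S = B"
    by (rule blinfun_eqI) (simp add: C_def RS bops_id_op[OF E Bd(1)])
  have SS: "S o\<^sub>L id_op E o\<^sub>L S = A"
  proof (rule blinfun_eqI)
    fix x
    have "S (S x) = R (R (A (A x)))" by (simp add: S_def comm)
    then show "(S o\<^sub>L id_op E o\<^sub>L S) x = A x" by (simp add: bops_id_op[OF E S(1)] RRA bops_id_op[OF E Ad(1)])
  qed
  have C: "C \<in> \<P> E"
    unfolding C_def by (rule conj_pos[OF B R(1,2), of S]) (simp add: RS id_op_props(2)[OF E])
  note Cd = pos_opsD[OF E C]
  obtain a b where ab: "0 < a" "real_spectrum E C \<subseteq> {a..b}" by (rule pos_spectrum[OF C])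
  have ln: "continuous_on {a..b} ln" using ab(1) by (intro continuous_intros) auto
  have "thompson E A B = norm (op_fun E ln C)"
    using A B by (simp add: thompson_def R_def C_def Let_def)
  also have "\<dots> \<le> r \<longleftrightarrow> (\<forall>t\<in>real_spectrum E C. \<bar>ln t\<bar> \<le> r)"
    using norm_op_fun_le[OF E Cd(1,3) ln ab(2) r] spectrum_le_norm_op_fun[OF E Cd(1,3) ln ab(2)]
    by (meson order_trans)
  also have "\<dots> \<longleftrightarrow> (\<forall>t\<in>real_spectrum E C. exp (- r) \<le> t \<and> t \<le> exp r)"
  proof (rule ball_cong[OF refl])
    fix t assume "t \<in> real_spectrum E C"
    then have "0 < t" using ab by auto
    then have "exp (- r) \<le> t \<longleftrightarrow> - r \<le> ln t" "t \<le> exp r \<longleftrightarrow> ln t \<le> r"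
      by (metis exp_le_cancel_iff exp_ln)+
    then show "\<bar>ln t\<bar> \<le> r \<longleftrightarrow> exp (- r) \<le> t \<and> t \<le> exp r" by auto
  qed
  also have "\<dots> \<longleftrightarrow> exp (- r) *\<^sub>R id_op E \<sqsubseteq>\<^sub>L C \<and> C \<sqsubseteq>\<^sub>L exp r *\<^sub>R id_op E"
    using loewner_iff_spectrum_bounds[OF E Cd(1,3,4), of "exp (- r)" "exp r"] spectrum_bounds[OF E Cd(1,3)] r
    by (auto simp: order_trans[of "exp (- r)" 1 "exp r"])
  also have "\<dots> \<longleftrightarrow> exp (- r) *\<^sub>R A \<sqsubseteq>\<^sub>L B \<and> B \<sqsubseteq>\<^sub>L exp r *\<^sub>R A"
  proof -
    have clin: "clin (s *\<^sub>R id_op E)" "selfadj (s *\<^sub>R id_op E)" "clin (s *\<^sub>R A)" "selfadj (s *\<^sub>R A)" for s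
      using clin_scaleR clin_id_op[OF E] selfadj_scaleR selfadj_id_op[OF E] Ad by auto
    have conjS: "S o\<^sub>L (s *\<^sub>R id_op E) o\<^sub>L S = s *\<^sub>R A" for s
      unfolding SS[symmetric] by (rule blinfun_eqI) (simp add: blinfun.scaleR_left blinfun.scaleR_right)
    have conjR: "R o\<^sub>L (s *\<^sub>R A) o\<^sub>L R = s *\<^sub>R id_op E" for s
      unfolding RAR[symmetric] by (rule blinfun_eqI) (simp add: blinfun.scaleR_left blinfun.scaleR_right)
    have "s *\<^sub>R id_op E \<sqsubseteq>\<^sub>L C \<longleftrightarrow> s *\<^sub>R A \<sqsubseteq>\<^sub>L B" for s
      using conj_mono[OF S clin(1,2) Cd(2,3), of s] conj_mono[OF R(1,2) clin(3,4) Bd(2,3), of s]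
      unfolding conjS conjR SCS C_def[symmetric] by blast
    moreover have "C \<sqsubseteq>\<^sub>L s *\<^sub>R id_op E \<longleftrightarrow> B \<sqsubseteq>\<^sub>L s *\<^sub>R A" for s
      using conj_mono[OF S Cd(2,3) clin(1,2), of s] conj_mono[OF R(1,2) Bd(2,3) clin(3,4), of s]
      unfolding conjS conjR SCS C_def[symmetric] by blast
    ultimately show ?thesis by simp
  qed
  finally show ?thesis .
qed

section \<open>The metric axioms, derived from the order\<close>

lemma thompson_nonneg: "0 \<le> thompson E A B"
  by (simp add: thompson_def Let_def)

lemma scaleR_le_iff:
  assumes "0 < r" shows "(1 / r) *\<^sub>R A \<sqsubseteq>\<^sub>L B \<longleftrightarrow> A \<sqsubseteq>\<^sub>L r *\<^sub>R B"
  using loewner_scaleR_mono[of "(1 / r) *\<^sub>R A" B r] loewner_scaleR_mono[of A "r *\<^sub>R B" "1 / r"] assms by auto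

lemma thompson_le_iff':
  assumes "A \<in> \<P> E" "B \<in> \<P> E" "0 \<le> r"
  shows "thompson E A B \<le> r \<longleftrightarrow> A \<sqsubseteq>\<^sub>L exp r *\<^sub>R B \<and> B \<sqsubseteq>\<^sub>L exp r *\<^sub>R A"
  using thompson_le_iff[OF assms] scaleR_le_iff[of "exp r" A B] by (simp add: exp_minus divide_inverse)

lemma thompson_upper:
  assumes "A \<in> \<P> E" "B \<in> \<P> E" "thompson E A B \<le> r"
  shows "A \<sqsubseteq>\<^sub>L exp r *\<^sub>R B" "B \<sqsubseteq>\<^sub>L exp r *\<^sub>R A"
  using thompson_le_iff'[OF assms(1,2), of r] assms(3) thompson_nonneg[of A B] by auto

text \<open>The order description is symmetric in both operators, the factors exp r and exp s
  multiply in the triangle inequality, and distance 0 is the antisymmetry of the order.\<close>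

lemma Metric_space_thompson: "Metric_space (\<P> E) (thompson E)"
proof
  show "0 \<le> thompson E A B" for A B by (rule thompson_nonneg)
  show "thompson E A B = thompson E B A" for A B
  proof (cases "A \<in> \<P> E \<and> B \<in> \<P> E")
    case True
    then have "thompson E A B \<le> r \<longleftrightarrow> thompson E B A \<le> r" if "0 \<le> r" for r
      using that by (auto simp: thompson_le_iff')
    then show ?thesis using thompson_nonneg by (metis order_antisym order_refl)
  qed (auto simp: thompson_def)
  fix A B assume AB: "A \<in> \<P> E" "B \<in> \<P> E"
  have "thompson E A B = 0 \<longleftrightarrow> thompson E A B \<le> 0" using thompson_nonneg[of A B] by linarith
  also have "\<dots> \<longleftrightarrow> A \<sqsubseteq>\<^sub>L B \<and> B \<sqsubseteq>\<^sub>L A" using AB by (simp add: thompson_le_iff')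
  also have "\<dots> \<longleftrightarrow> A = B" using loewner_antisym pos_opsD(2)[OF E] AB by auto
  finally show "thompson E A B = 0 \<longleftrightarrow> A = B" .
  fix C assume C: "C \<in> \<P> E"
  let ?r = "thompson E A B" and ?s = "thompson E B C"
  have r: "A \<sqsubseteq>\<^sub>L exp ?r *\<^sub>R B" "B \<sqsubseteq>\<^sub>L exp ?r *\<^sub>R A" by (rule thompson_upper[OF AB order_refl])+
  have s: "B \<sqsubseteq>\<^sub>L exp ?s *\<^sub>R C" "C \<sqsubseteq>\<^sub>L exp ?s *\<^sub>R B" by (rule thompson_upper[OF AB(2) C order_refl])+
  have "A \<sqsubseteq>\<^sub>L exp (?r + ?s) *\<^sub>R C"
    using loewner_trans[OF r(1) loewner_scaleR_mono[OF s(1)]] by (simp add: exp_add)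
  moreover have "C \<sqsubseteq>\<^sub>L exp (?r + ?s) *\<^sub>R A"
    using loewner_trans[OF s(2) loewner_scaleR_mono[OF r(2)]] by (simp add: exp_add mult.commute)
  ultimately show "thompson E A C \<le> thompson E A B + thompson E B C"
    using thompson_le_iff'[OF AB(1) C, of "?r + ?s"] thompson_nonneg by simp
qed

end

section \<open>Block operators\<close>

text \<open>\<open>W\<close> is the adjoint of \<open>V\<close>, carried along as a second operator
  so that computations need not unfold \<open>adj\<close>.\<close>

locale isometry =
  fixes V W :: "'h::chilbert_space operator"
  assumes clinV: "clin V" and clinW: "clin W"
    and adjoint: "inner (V x) y = inner x (W y)" and left_inverse: "W (V x) = x"

context isometry
begin

lemma adjoint': "inner (W y) x = inner y (V x)"
  using adjoint[of x y] by (simp add: inner_commute)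

context
  fixes E :: "'h set"
  assumes E: "hilbert E"
begin

text \<open>Presents the image as the set where two continuous maps agree, which shows that it is
  closed.\<close>

lemma image_eq: "V ` E = {k. V (id_op E (W k)) = k}"
  by (auto simp: left_inverse id_op_props(2)[OF E] image_iff) (metis id_op_in[OF E])

lemma hilbert_image: "hilbert (V ` E)"
  unfolding hilbert_def
proof (intro conjI ballI allI)
  show "0 \<in> V ` E" using hilbertD(1)[OF E] by (metis blinfun.zero_right image_eqI)
  show "x + y \<in> V ` E" if "x \<in> V ` E" "y \<in> V ` E" for x y
    using that hilbertD(2)[OF E] by (auto simp: blinfun.add_right[symmetric])
  show "c *\<^sub>C x \<in> V ` E" if "x \<in> V ` E" for c x
    using that hilbertD(3)[OF E] by (auto simp: clinD[OF clinV, symmetric])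
  show "closed (V ` E)" unfolding image_eq by (intro closed_Collect_eq continuous_intros)
qed

lemma image_orthogonal:
  assumes "\<And>y. y \<in> E \<Longrightarrow> cinner k (V y) = 0"
  shows "id_op E (W k) = 0"
proof -
  have "inner k (V (id_op E (W k))) = 0"
    using assms[OF id_op_in[OF E, of "W k"]] by (simp add: Re_cinner[symmetric])
  then have "inner (id_op E (W k)) (W k) = 0" by (simp add: adjoint'[symmetric] inner_commute)
  then show ?thesis by (simp add: inner_id_op[OF E])
qed

lemma id_op_image: "id_op (V ` E) = V o\<^sub>L id_op E o\<^sub>L W"
proof (rule bops_eqI[OF hilbert_image id_op_props(1)[OF hilbert_image]])
  show "V o\<^sub>L id_op E o\<^sub>L W \<in> bounded_ops (V ` E) (V ` E)"
    unfolding bounded_ops_def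
    by (auto simp: image_orthogonal clinD[OF clinV] clinD[OF clinW] clinD[OF clin_id_op[OF E]] id_op_in[OF E])
qed (auto simp: id_op_props(2)[OF hilbert_image] id_op_props(2)[OF E] left_inverse)

lemma adj_projection: "adj (id_op E o\<^sub>L W) = V o\<^sub>L id_op E"
  unfolding adj_def
proof (rule the_equality)
  show *: "\<forall>x y. cinner ((id_op E o\<^sub>L W) x) y = cinner x ((V o\<^sub>L id_op E) y)"
    by (intro allI cinner_eqI)
       (simp_all add: id_op_props(3)[OF E] adjoint' clinD[OF clinV] clinD[OF clin_id_op[OF E]])
  fix S assume S: "\<forall>x y. cinner ((id_op E o\<^sub>L W) x) y = cinner x (blinfun_apply S y)"
  show "S = V o\<^sub>L id_op E"
  proof (rule blinfun_eqI)
    fix y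
    let ?d = "S y - (V o\<^sub>L id_op E) y"
    have "cinner ?d (S y) = cinner ?d ((V o\<^sub>L id_op E) y)"
      using S[rule_format, of ?d y] *[rule_format, of ?d y] by (rule trans[OF sym])
    then have "cinner ?d ?d = 0" by (subst cinner_diff_right) simp
    then show "S y = (V o\<^sub>L id_op E) y" by (simp add: cinner_self)
  qed
qed

lemma projection_unitary: "id_op E o\<^sub>L W \<in> unitaries (V ` E) E"
proof -
  have "id_op E o\<^sub>L W \<in> bounded_ops (V ` E) E"
    unfolding bounded_ops_def
    by (auto simp: image_orthogonal clinD[OF clinW] clinD[OF clin_id_op[OF E]] id_op_in[OF E])
  moreover have "V o\<^sub>L id_op E o\<^sub>L (id_op E o\<^sub>L W) = id_op (V ` E)"
    unfolding id_op_image by (rule blinfun_eqI) (simp add: id_op_props(2)[OF E] id_op_in[OF E])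
  moreover have "id_op E o\<^sub>L W o\<^sub>L (V o\<^sub>L id_op E) = id_op E"
    by (rule blinfun_eqI) (simp add: left_inverse id_op_props(2)[OF E] id_op_in[OF E])
  ultimately show ?thesis by (simp add: unitaries_def adj_projection)
qed

lemma conj_projection:
  assumes "A \<in> bounded_ops E E"
  shows "adj (id_op E o\<^sub>L W) o\<^sub>L A o\<^sub>L (id_op E o\<^sub>L W) = V o\<^sub>L A o\<^sub>L W"
  by (rule blinfun_eqI) (simp add: adj_projection bops_id_op[OF E assms])

lemma conj_pos_ops:
  assumes A: "A \<in> \<P> E"
  shows "V o\<^sub>L A o\<^sub>L W \<in> \<P> (V ` E)"
proof -
  note Ad = pos_opsD[OF E A] and Bd = pos_opsD[OF E inv_op_pos[OF E A]]
  have bops: "V o\<^sub>L T o\<^sub>L W \<in> bounded_ops (V ` E) (V ` E)" if T: "T \<in> bounded_ops E E" for T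
    unfolding bounded_ops_def
  proof (intro CollectI conjI allI impI)
    fix x assume "\<forall>y\<in>V ` E. cinner x y = 0"
    then have "id_op E (W x) = 0" by (intro image_orthogonal) blast
    then have "T (W x) = T 0" using bops_id_op(1)[OF E T, of "W x"] by simp
    then show "(V o\<^sub>L T o\<^sub>L W) x = 0" by simp
  qed (auto simp: clinD[OF clinV] clinD[OF clinW] clinD[OF bounded_ops_clin[OF T]] bounded_opsD(2)[OF T])
  have "0 \<sqsubseteq>\<^sub>L V o\<^sub>L A o\<^sub>L W"
    by (rule loewner_leI)
       (use Ad in \<open>auto simp: bounded_ops_clin[OF bops] selfadj_def adjoint adjoint'[symmetric]\<close>)
  moreover have "invertible_op (V ` E) (V o\<^sub>L A o\<^sub>L W)"
    by (rule invertible_opI(3)[OF hilbert_image bops[OF Ad(1)] bops[OF Bd(1)]])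
       (auto simp: left_inverse inv_op_props[OF E A] id_op_props(2)[OF E])
  ultimately show ?thesis using bops[OF Ad(1)] by (simp add: pos_ops_def)
qed

end

end

section \<open>Two orthogonal copies of E and block diagonal operators\<close>

locale orthogonal_isometries = I1: isometry V1 W1 + I2: isometry V2 W2
  for V1 W1 V2 W2 :: "'h::chilbert_space operator" +
  assumes orthogonal: "W1 (V2 x) = 0" "W2 (V1 x) = 0"

text \<open>A copy of the direct sum of E with itself inside the ambient space;
  \<open>block_op\<close> below is the operator diag(A, B) on it.\<close>

definition block_space :: "'h::chilbert_space operator \<Rightarrow> 'h operator \<Rightarrow> 'h set \<Rightarrow> 'h set" where
  "block_space V1 V2 E = direct_sum (V1 ` E) (V2 ` E)"

definition block_op :: "'h::chilbert_space operator \<Rightarrow> 'h operator \<Rightarrow> 'h operator \<Rightarrow> 'h operator \<Rightarrow>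
    'h operator \<Rightarrow> 'h operator \<Rightarrow> 'h operator" where
  "block_op V1 W1 V2 W2 A B = (V1 o\<^sub>L A o\<^sub>L W1) + (V2 o\<^sub>L B o\<^sub>L W2)"

context orthogonal_isometries
begin

context
  fixes E :: "'h set"
  assumes E: "hilbert E"
begin

lemma block_space_eq: "block_space V1 V2 E = {k. V1 (id_op E (W1 k)) + V2 (id_op E (W2 k)) = k}"
proof (rule set_eqI, rule iffI)
  fix k assume "k \<in> block_space V1 V2 E"
  then obtain x y where "x \<in> E" "y \<in> E" "k = V1 x + V2 y"
    by (auto simp: block_space_def direct_sum_def)
  then show "k \<in> {k. V1 (id_op E (W1 k)) + V2 (id_op E (W2 k)) = k}"
    by (simp add: blinfun.add_right orthogonal I1.left_inverse I2.left_inverse id_op_props(2)[OF E])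
next
  fix k assume "k \<in> {k. V1 (id_op E (W1 k)) + V2 (id_op E (W2 k)) = k}"
  then show "k \<in> block_space V1 V2 E"
    unfolding block_space_def direct_sum_def using id_op_in[OF E] by (smt (verit) imageI mem_Collect_eq)
qed

lemma hilbert_block_space: "hilbert (block_space V1 V2 E)"
  unfolding hilbert_def block_space_eq
proof (intro conjI ballI allI)
  show "closed {k. V1 (id_op E (W1 k)) + V2 (id_op E (W2 k)) = k}"
    by (intro closed_Collect_eq continuous_intros)
next
  fix x y assume "x \<in> {k. V1 (id_op E (W1 k)) + V2 (id_op E (W2 k)) = k}" "y \<in> {k. V1 (id_op E (W1 k)) + V2 (id_op E (W2 k)) = k}"
  then show "x + y \<in> {k. V1 (id_op E (W1 k)) + V2 (id_op E (W2 k)) = k}"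
    by (simp add: blinfun.add_right) (metis add.assoc add.left_commute)
next
  fix c x assume "x \<in> {k. V1 (id_op E (W1 k)) + V2 (id_op E (W2 k)) = k}"
  then show "c *\<^sub>C x \<in> {k. V1 (id_op E (W1 k)) + V2 (id_op E (W2 k)) = k}"
    by (simp add: clinD[OF I1.clinV] clinD[OF I1.clinW] clinD[OF I2.clinV] clinD[OF I2.clinW]
        clinD[OF clin_id_op[OF E]] scaleC_add_right[symmetric])
qed simp

lemma orthogonal_images: "orthogonal_spaces (V1 ` E) (V2 ` E)"
  unfolding orthogonal_spaces_def
proof (intro ballI)
  fix a b assume "a \<in> V1 ` E" "b \<in> V2 ` E"
  then obtain x y where "a = V1 x" "b = V2 y" by blast
  then show "cinner a b = 0"
    by (intro complex_eqI)
       (simp_all add: Re_cinner Im_cinner clinD[OF I2.clinV, symmetric] I1.adjoint orthogonal)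
qed

lemma block_op_quad:
  "inner (block_op V1 W1 V2 W2 A B k) k = inner (A (W1 k)) (W1 k) + inner (B (W2 k)) (W2 k)"
  by (simp add: block_op_def blinfun.add_left inner_add_left I1.adjoint I2.adjoint)

lemma clin_block_op: "clin A \<Longrightarrow> clin B \<Longrightarrow> clin (block_op V1 W1 V2 W2 A B)"
  unfolding block_op_def clin_def
  by (simp add: blinfun.add_left clinD[OF I1.clinV] clinD[OF I1.clinW] clinD[OF I2.clinV] clinD[OF I2.clinW] scaleC_add_right)

lemma selfadj_block_op: "selfadj A \<Longrightarrow> selfadj B \<Longrightarrow> selfadj (block_op V1 W1 V2 W2 A B)"
  by (simp add: block_op_def selfadj_def blinfun.add_left inner_add I1.adjoint I2.adjoint I1.adjoint' I2.adjoint')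

lemma block_op_compose:
  "block_op V1 W1 V2 W2 A B o\<^sub>L block_op V1 W1 V2 W2 C D = block_op V1 W1 V2 W2 (A o\<^sub>L C) (B o\<^sub>L D)"
  by (rule blinfun_eqI)
     (simp add: block_op_def blinfun.add_left blinfun.add_right I1.left_inverse I2.left_inverse orthogonal)

lemma block_op_bops:
  assumes A: "A \<in> bounded_ops E E" and B: "B \<in> bounded_ops E E"
  shows "block_op V1 W1 V2 W2 A B \<in> bounded_ops (block_space V1 V2 E) (block_space V1 V2 E)"
  unfolding bounded_ops_def
proof (intro CollectI conjI allI impI)
  show "block_op V1 W1 V2 W2 A B (c *\<^sub>C x) = c *\<^sub>C block_op V1 W1 V2 W2 A B x" for c x
    by (rule clinD[OF clin_block_op]) (use A B bounded_ops_clin in auto)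
  show "block_op V1 W1 V2 W2 A B x \<in> block_space V1 V2 E" for x
  proof -
    have "block_op V1 W1 V2 W2 A B x = V1 (A (W1 x)) + V2 (B (W2 x))"
      by (simp add: block_op_def blinfun.add_left)
    moreover have "A (W1 x) \<in> E" "B (W2 x) \<in> E" using bounded_opsD(2) A B by blast+
    ultimately show ?thesis unfolding block_space_def direct_sum_def by blast
  qed
  fix k assume k: "\<forall>y\<in>block_space V1 V2 E. cinner k y = 0"
  have "cinner k y = 0" if "y \<in> V1 ` E \<or> y \<in> V2 ` E" for y
  proof -
    have "0 \<in> V1 ` E" "0 \<in> V2 ` E" using hilbertD(1)[OF E] by (metis blinfun.zero_right image_eqI)+
    then have "y + 0 \<in> block_space V1 V2 E \<or> 0 + y \<in> block_space V1 V2 E"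
      using that unfolding block_space_def direct_sum_def by blast
    then show ?thesis using k by auto
  qed
  then have "id_op E (W1 k) = 0" "id_op E (W2 k) = 0"
    using I1.image_orthogonal[OF E] I2.image_orthogonal[OF E] by blast+
  then have "A (W1 k) = 0" "B (W2 k) = 0"
    using bops_id_op(1)[OF E A, of "W1 k"] bops_id_op(1)[OF E B, of "W2 k"] by simp_all
  then show "block_op V1 W1 V2 W2 A B k = 0" by (simp add: block_op_def blinfun.add_left)
qed

lemma id_op_block_space: "id_op (block_space V1 V2 E) = block_op V1 W1 V2 W2 (id_op E) (id_op E)"
proof (rule bops_eqI[OF hilbert_block_space id_op_props(1)[OF hilbert_block_space] block_op_bops])
  fix k assume k: "k \<in> block_space V1 V2 E"
  then have "V1 (id_op E (W1 k)) + V2 (id_op E (W2 k)) = k" by (simp add: block_space_eq)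
  then show "id_op (block_space V1 V2 E) k = block_op V1 W1 V2 W2 (id_op E) (id_op E) k"
    using k by (simp add: id_op_props(2)[OF hilbert_block_space] block_op_def blinfun.add_left)
qed (rule id_op_props(1)[OF E])+

lemma block_op_pos:
  assumes A: "A \<in> \<P> E" and B: "B \<in> \<P> E"
  shows "block_op V1 W1 V2 W2 A B \<in> \<P> (block_space V1 V2 E)"
    "inv_op (block_space V1 V2 E) (block_op V1 W1 V2 W2 A B) = block_op V1 W1 V2 W2 (inv_op E A) (inv_op E B)"
proof -
  note Ad = pos_opsD[OF E A] and Bd = pos_opsD[OF E B]
  note iA = inv_op_props[OF E A] and iB = inv_op_props[OF E B]
  have inv: "block_op V1 W1 V2 W2 A B o\<^sub>L block_op V1 W1 V2 W2 (inv_op E A) (inv_op E B) = id_op (block_space V1 V2 E)"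
    "block_op V1 W1 V2 W2 (inv_op E A) (inv_op E B) o\<^sub>L block_op V1 W1 V2 W2 A B = id_op (block_space V1 V2 E)"
    by (simp_all add: block_op_compose iA iB id_op_block_space)
  have "0 \<sqsubseteq>\<^sub>L block_op V1 W1 V2 W2 A B"
    by (rule loewner_leI) (use Ad Bd in \<open>auto simp: clin_block_op selfadj_block_op block_op_quad\<close>)
  then show "block_op V1 W1 V2 W2 A B \<in> \<P> (block_space V1 V2 E)"
    unfolding pos_ops_def invertible_op_def using inv block_op_bops Ad(1) Bd(1) iA(1) iB(1) by blast
  show "inv_op (block_space V1 V2 E) (block_op V1 W1 V2 W2 A B) = block_op V1 W1 V2 W2 (inv_op E A) (inv_op E B)"
    by (rule inv_op_eqI[OF hilbert_block_space block_op_bops[OF iA(1) iB(1)] inv])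
qed

end

text \<open>A rotation of the pair of isometries by an orthogonal 2x2 matrix preserves all relations
  between them and their adjoints.\<close>

lemma rotate:
  assumes cs: "c\<^sup>2 + s\<^sup>2 = 1"
  shows "orthogonal_isometries (c *\<^sub>R V1 + s *\<^sub>R V2) (c *\<^sub>R W1 + s *\<^sub>R W2) (c *\<^sub>R V2 - s *\<^sub>R V1) (c *\<^sub>R W2 - s *\<^sub>R W1)"
proof -
  have cs': "c * c + s * s = 1" "s * s + c * c = 1" using cs by (simp_all add: power2_eq_square add.commute)
  note simps = blinfun.add_left blinfun.add_right blinfun.scaleR_left blinfun.scaleR_right blinfun.diff_left
    blinfun.diff_right inner_add inner_diff I1.adjoint I2.adjoint I1.left_inverse I2.left_inverse orthogonal
    clinD[OF I1.clinV] clinD[OF I1.clinW] clinD[OF I2.clinV] clinD[OF I2.clinW] clin_def scaleC_add_right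
    scaleC_diff_right scaleC_scaleR scaleR_add_left[symmetric] cs'
  show ?thesis by unfold_locales (simp_all add: simps)
qed

text \<open>The mixed terms cancel and the sum of the two range projections is unchanged. A function
  on this one space can therefore be evaluated through either decomposition.\<close>

lemma block_space_rotate:
  assumes cs: "c\<^sup>2 + s\<^sup>2 = 1" and E: "hilbert E"
  shows "block_space (c *\<^sub>R V1 + s *\<^sub>R V2) (c *\<^sub>R V2 - s *\<^sub>R V1) E = block_space V1 V2 E"
proof -
  interpret R: orthogonal_isometries "c *\<^sub>R V1 + s *\<^sub>R V2" "c *\<^sub>R W1 + s *\<^sub>R W2" "c *\<^sub>R V2 - s *\<^sub>R V1" "c *\<^sub>R W2 - s *\<^sub>R W1"
    by (rule rotate[OF cs])
  have "(c *\<^sub>R V1 + s *\<^sub>R V2) (id_op E ((c *\<^sub>R W1 + s *\<^sub>R W2) k)) + (c *\<^sub>R V2 - s *\<^sub>R V1) (id_op E ((c *\<^sub>R W2 - s *\<^sub>R W1) k))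
     = (c\<^sup>2 + s\<^sup>2) *\<^sub>R (V1 (id_op E (W1 k)) + V2 (id_op E (W2 k)))" for k
    by (simp add: blinfun.add_left blinfun.add_right blinfun.scaleR_left blinfun.scaleR_right blinfun.diff_left
        blinfun.diff_right power2_eq_square algebra_simps)
  then show ?thesis unfolding R.block_space_eq[OF E] block_space_eq[OF E] cs by simp
qed

end

section \<open>Concavity of operator monotone free functions\<close>

text \<open>The consequences of freeness that the concavity argument uses, in a form that passes to
  \<open>dual_family\<close>.\<close>

definition block_function :: "nat \<Rightarrow> 'h::chilbert_space op_family \<Rightarrow> bool" where
  "block_function n F \<longleftrightarrow> operator_monotone n F \<and>
    (\<forall>E. hilbert E \<longrightarrow> (\<forall>Xs\<in>tuples n E. F E Xs \<in> \<P> E)) \<and>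
    (\<forall>V1 W1 V2 W2 E. orthogonal_isometries V1 W1 V2 W2 \<and> hilbert E \<longrightarrow> (\<forall>Xs\<in>tuples n E. \<forall>Ys\<in>tuples n E.
      F (block_space V1 V2 E) (map2 (block_op V1 W1 V2 W2) Xs Ys) = block_op V1 W1 V2 W2 (F E Xs) (F E Ys)))"

lemma free_function_conj:
  assumes F: "free_function n F" and "isometry V W" and E: "hilbert E" and Xs: "Xs \<in> tuples n E"
  shows "F (V ` E) (map (\<lambda>A. V o\<^sub>L A o\<^sub>L W) Xs) = V o\<^sub>L F E Xs o\<^sub>L W"
proof -
  interpret isometry V W by fact
  let ?U = "id_op E o\<^sub>L W"
  have "F (V ` E) (map (\<lambda>A. adj ?U o\<^sub>L A o\<^sub>L ?U) Xs) = adj ?U o\<^sub>L F E Xs o\<^sub>L ?U"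
    using F hilbert_image[OF E] E projection_unitary[OF E] Xs unfolding free_function_def by blast
  moreover have "map (\<lambda>A. adj ?U o\<^sub>L A o\<^sub>L ?U) Xs = map (\<lambda>A. V o\<^sub>L A o\<^sub>L W) Xs"
    using Xs by (intro map_cong refl conj_projection[OF E] pos_opsD(1)[OF E]) (auto simp: tuples_def)
  moreover have "adj ?U o\<^sub>L F E Xs o\<^sub>L ?U = V o\<^sub>L F E Xs o\<^sub>L W"
    using F E Xs unfolding free_function_def by (intro conj_projection[OF E] pos_opsD(1)[OF E]) blast
  ultimately show ?thesis by simp
qed

lemma free_function_block:
  fixes F :: "'a::chilbert_space op_family"
  assumes F: "free_function n F" and mono: "operator_monotone n F"
  shows "block_function n F"
  unfolding block_function_def
proof (intro conjI mono allI impI ballI)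
  show "F E Xs \<in> \<P> E" if "hilbert E" "Xs \<in> tuples n E" for E Xs
    using F that unfolding free_function_def by blast
  fix V1 W1 V2 W2 :: "'a operator" and E :: "'a set" and Xs Ys
  assume "orthogonal_isometries V1 W1 V2 W2 \<and> hilbert E" and Xs: "Xs \<in> tuples n E" and Ys: "Ys \<in> tuples n E"
  then have E: "hilbert E" and "orthogonal_isometries V1 W1 V2 W2" by auto
  interpret orthogonal_isometries V1 W1 V2 W2 by fact
  let ?Xs = "map (\<lambda>A. V1 o\<^sub>L A o\<^sub>L W1) Xs" and ?Ys = "map (\<lambda>A. V2 o\<^sub>L A o\<^sub>L W2) Ys"
  have "?Xs \<in> tuples n (V1 ` E)" "?Ys \<in> tuples n (V2 ` E)"
    using Xs Ys I1.conj_pos_ops[OF E] I2.conj_pos_ops[OF E] by (auto simp: tuples_def)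
  then have "F (block_space V1 V2 E) (map2 (+) ?Xs ?Ys) = F (V1 ` E) ?Xs + F (V2 ` E) ?Ys"
    using F I1.hilbert_image[OF E] I2.hilbert_image[OF E] orthogonal_images[OF E]
    unfolding free_function_def block_space_def by blast
  moreover have "map2 (+) ?Xs ?Ys = map2 (block_op V1 W1 V2 W2) Xs Ys"
    by (simp add: zip_map_map block_op_def case_prod_unfold o_def)
  ultimately show "F (block_space V1 V2 E) (map2 (block_op V1 W1 V2 W2) Xs Ys) = block_op V1 W1 V2 W2 (F E Xs) (F E Ys)"
    by (simp add: block_op_def free_function_conj[OF F I1.isometry_axioms E Xs] free_function_conj[OF F I2.isometry_axioms E Ys])
qed

section \<open>The dual function\<close>

definition dual_family :: "'h::chilbert_space op_family \<Rightarrow> 'h op_family" where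
  "dual_family F E Xs = inv_op E (F E (map (inv_op E) Xs))"

lemma inv_tuples: "hilbert E \<Longrightarrow> Xs \<in> tuples n E \<Longrightarrow> map (inv_op E) Xs \<in> tuples n E"
  by (auto simp: tuples_def inv_op_pos)

text \<open>Inversion reverses the order twice and acts separately on the two blocks.\<close>

lemma dual_family_block:
  fixes F :: "'a::chilbert_space op_family"
  assumes F: "block_function n F"
  shows "block_function n (dual_family F)"
proof -
  have mono: "\<And>E Xs Ys. hilbert E \<Longrightarrow> Xs \<in> tuples n E \<Longrightarrow> Ys \<in> tuples n E \<Longrightarrow> list_all2 loewner_le Xs Ys \<Longrightarrow> F E Xs \<sqsubseteq>\<^sub>L F E Ys"
    and pos: "\<And>E Xs. hilbert E \<Longrightarrow> Xs \<in> tuples n E \<Longrightarrow> F E Xs \<in> \<P> E"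
    and block: "\<And>V1 W1 V2 W2 E Xs Ys. orthogonal_isometries V1 W1 V2 W2 \<Longrightarrow> hilbert E \<Longrightarrow> Xs \<in> tuples n E \<Longrightarrow> Ys \<in> tuples n E \<Longrightarrow>
      F (block_space V1 V2 E) (map2 (block_op V1 W1 V2 W2) Xs Ys) = block_op V1 W1 V2 W2 (F E Xs) (F E Ys)"
    using F unfolding block_function_def operator_monotone_def by blast+
  show ?thesis
    unfolding block_function_def operator_monotone_def
  proof (intro conjI allI impI ballI)
    fix E :: "'a set" and Xs assume E: "hilbert E" and Xs: "Xs \<in> tuples n E"
    show "dual_family F E Xs \<in> \<P> E"
      unfolding dual_family_def by (intro inv_op_pos pos inv_tuples E Xs)
    fix Ys assume Ys: "Ys \<in> tuples n E" and le: "list_all2 loewner_le Xs Ys"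
    have "list_all2 loewner_le (map (inv_op E) Ys) (map (inv_op E) Xs)"
      using le Xs Ys
      by (auto simp: list_all2_conv_all_nth tuples_def intro!: inv_op_antimono[OF E] subsetD[OF _ nth_mem])
    then show "dual_family F E Xs \<sqsubseteq>\<^sub>L dual_family F E Ys"
      unfolding dual_family_def by (intro inv_op_antimono[OF E] pos mono inv_tuples E Xs Ys)
  next
    fix V1 W1 V2 W2 :: "'a operator" and E :: "'a set" and Xs Ys
    assume "orthogonal_isometries V1 W1 V2 W2 \<and> hilbert E" and Xs: "Xs \<in> tuples n E" and Ys: "Ys \<in> tuples n E"
    then have E: "hilbert E" and oi: "orthogonal_isometries V1 W1 V2 W2" by auto
    interpret orthogonal_isometries V1 W1 V2 W2 by fact
    let ?K = "block_space V1 V2 E" and ?b = "block_op V1 W1 V2 W2"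
    have "map (inv_op ?K) (map2 ?b Xs Ys) = map2 ?b (map (inv_op E) Xs) (map (inv_op E) Ys)"
      using Xs Ys
      by (intro nth_equalityI) (auto simp: tuples_def intro!: block_op_pos(2)[OF E] subsetD[OF _ nth_mem])
    then show "dual_family F ?K (map2 ?b Xs Ys) = ?b (dual_family F E Xs) (dual_family F E Ys)"
      unfolding dual_family_def
      by (simp add: block[OF oi E inv_tuples[OF E Xs] inv_tuples[OF E Ys]] block_op_pos(2)[OF E pos pos] E Xs Ys inv_tuples)
  qed
qed

text \<open>The mixed term is bounded by positivity of the form at e x - y, a weighted form of the
  inequality between arithmetic and geometric means.\<close>

lemma quad_sum_le:
  assumes A: "selfadj A" "\<And>x. 0 \<le> inner (A x) x" and e: "0 < e"
  shows "inner (A (x + y)) (x + y) \<le> (1 + e) * inner (A x) x + (1 + 1 / e) * inner (A y) y"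
proof -
  have sym: "inner (A y) x = inner (A x) y" using selfadjD[OF A(1), of y x] by (simp add: inner_commute)
  have "0 \<le> inner (A (e *\<^sub>R x - y)) (e *\<^sub>R x - y)" by (rule A(2))
  also have "\<dots> = e * (e * inner (A x) x - 2 * inner (A x) y + (1 / e) * inner (A y) y)"
    using e by (simp add: blinfun.diff_right blinfun.scaleR_right inner_diff sym algebra_simps)
  finally have "2 * inner (A x) y \<le> e * inner (A x) x + (1 / e) * inner (A y) y"
    using e by (simp add: zero_le_mult_iff)
  then show ?thesis by (simp add: blinfun.add_right inner_add sym algebra_simps)
qed

text \<open>
  Rotating \<open>A \<oplus> B\<close> by the angle with sine \<open>s\<close> and cosine \<open>c\<close> gives a block operator with
  left upper corner \<open>c\<^sup>2 A + s\<^sup>2 B\<close>; up to a factor \<open>1 + e\<close> it is dominated by a block diagonal one.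
\<close>

lemma block_function_weakly_concave:
  fixes F :: "'a::chilbert_space op_family" and V1 W1 V2 W2 :: "'a operator" and E :: "'a set"
  assumes F: "block_function n F" and oi: "orthogonal_isometries V1 W1 V2 W2" and E: "hilbert E"
    and X: "\<And>i. i < n \<Longrightarrow> X i \<in> \<P> E" and Y: "\<And>i. i < n \<Longrightarrow> Y i \<in> \<P> E"
    and l: "0 < l" "l < 1" and e: "0 < e"
  shows "(1 - l) *\<^sub>R F E (map X [0..<n]) + l *\<^sub>R F E (map Y [0..<n])
    \<sqsubseteq>\<^sub>L F E (map (\<lambda>i. (1 + e) *\<^sub>R ((1 - l) *\<^sub>R X i + l *\<^sub>R Y i)) [0..<n])"
proof -
  have mono: "\<And>E Xs Ys. hilbert E \<Longrightarrow> Xs \<in> tuples n E \<Longrightarrow> Ys \<in> tuples n E \<Longrightarrow> list_all2 loewner_le Xs Ys \<Longrightarrow> F E Xs \<sqsubseteq>\<^sub>L F E Ys"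
    and pos: "\<And>E Xs. hilbert E \<Longrightarrow> Xs \<in> tuples n E \<Longrightarrow> F E Xs \<in> \<P> E"
    and block: "\<And>V1 W1 V2 W2 E Xs Ys. orthogonal_isometries V1 W1 V2 W2 \<Longrightarrow> hilbert E \<Longrightarrow> Xs \<in> tuples n E \<Longrightarrow> Ys \<in> tuples n E \<Longrightarrow>
      F (block_space V1 V2 E) (map2 (block_op V1 W1 V2 W2) Xs Ys) = block_op V1 W1 V2 W2 (F E Xs) (F E Ys)"
    using F unfolding block_function_def operator_monotone_def by blast+
  interpret orthogonal_isometries V1 W1 V2 W2 by fact
  define c s where "c = sqrt (1 - l)" and "s = sqrt l"
  have c2: "c\<^sup>2 = 1 - l" "c * c = 1 - l" and s2: "s\<^sup>2 = l" "s * s = l" using l by (auto simp: c_def s_def)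
  have cs: "c\<^sup>2 + s\<^sup>2 = 1" by (simp add: c2 s2)
  define V1' V2' W1' W2' where "V1' = c *\<^sub>R V1 + s *\<^sub>R V2" and "V2' = c *\<^sub>R V2 - s *\<^sub>R V1"
    and "W1' = c *\<^sub>R W1 + s *\<^sub>R W2" and "W2' = c *\<^sub>R W2 - s *\<^sub>R W1"
  interpret R: orthogonal_isometries V1' W1' V2' W2'
    unfolding V1'_def V2'_def W1'_def W2'_def by (rule rotate[OF cs])
  let ?K = "block_space V1 V2 E"
  have K: "block_space V1' V2' E = ?K" unfolding V1'_def V2'_def by (rule block_space_rotate[OF cs E])
  note hK = hilbert_block_space[OF E]
  define C where "C i = (1 + e) *\<^sub>R ((1 - l) *\<^sub>R X i + l *\<^sub>R Y i)" for i
  \<comment> \<open>The second corner grows like 1/e, but it disappears when the result is tested on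
    the first copy of E.\<close>
  define D where "D i = (1 + 1 / e) *\<^sub>R (l *\<^sub>R X i + (1 - l) *\<^sub>R Y i)" for i
  have e': "0 < 1 + e" "0 < 1 + 1 / e" using e by (auto simp: add_pos_pos)
  have C: "C i \<in> \<P> E" and D: "D i \<in> \<P> E" if "i < n" for i
    using X[OF that] Y[OF that] l e' unfolding C_def D_def by (auto intro!: scaleR_pos[OF E] add_pos[OF E])
  let ?b = "block_op V1 W1 V2 W2" and ?b' = "block_op V1' W1' V2' W2'"
  have tup: "map X [0..<n] \<in> tuples n E" "map Y [0..<n] \<in> tuples n E" "map C [0..<n] \<in> tuples n E" "map D [0..<n] \<in> tuples n E"
    using X Y C D by (auto simp: tuples_def)
  have sq: "inner (T (r *\<^sub>R w)) (r *\<^sub>R w) = r\<^sup>2 * inner (T w) w" for T :: "'a operator" and r w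
    by (simp add: blinfun.scaleR_right power2_eq_square)
  have s2': "(- s)\<^sup>2 = l" by (simp add: s2)
  have dom: "?b' (X i) (Y i) \<sqsubseteq>\<^sub>L ?b (C i) (D i)" if i: "i < n" for i
  proof (rule loewner_leI)
    note Xd = pos_opsD[OF E X[OF i]] and Yd = pos_opsD[OF E Y[OF i]] and Cd = pos_opsD[OF E C[OF i]] and Dd = pos_opsD[OF E D[OF i]]
    show "clin (?b' (X i) (Y i))" "selfadj (?b' (X i) (Y i))" "clin (?b (C i) (D i))" "selfadj (?b (C i) (D i))"
      using Xd Yd Cd Dd by (auto intro!: R.clin_block_op[OF E] R.selfadj_block_op[OF E] clin_block_op[OF E] selfadj_block_op[OF E])
    fix k
    let ?u = "W1 k" and ?v = "W2 k"
    have Wk: "W1' k = c *\<^sub>R ?u + s *\<^sub>R ?v" "W2' k = (- s) *\<^sub>R ?u + c *\<^sub>R ?v"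
      by (simp_all add: W1'_def W2'_def blinfun.add_left blinfun.diff_left blinfun.scaleR_left)
    have "inner (X i (W1' k)) (W1' k) + inner (Y i (W2' k)) (W2' k)
       \<le> ((1 + e) * ((1 - l) * inner (X i ?u) ?u) + (1 + 1 / e) * (l * inner (X i ?v) ?v))
        + ((1 + e) * (l * inner (Y i ?u) ?u) + (1 + 1 / e) * ((1 - l) * inner (Y i ?v) ?v))"
      unfolding Wk
      using quad_sum_le[OF Xd(3,5) e, of "c *\<^sub>R ?u" "s *\<^sub>R ?v"]
        quad_sum_le[OF Yd(3,5) e, of "(- s) *\<^sub>R ?u" "c *\<^sub>R ?v"]
      unfolding sq s2' c2 s2 by (rule add_mono)
    also have "\<dots> = inner (C i ?u) ?u + inner (D i ?v) ?v"
      by (simp add: C_def D_def blinfun.scaleR_left blinfun.add_left inner_add_left ring_distribs)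
    finally show "inner (?b' (X i) (Y i) k) k \<le> inner (?b (C i) (D i) k) k"
      by (simp add: block_op_quad[OF E] R.block_op_quad[OF E])
  qed
  \<comment> \<open>The same space carries both decompositions: the left side is evaluated in the
    rotated one, the dominating side in the original one.\<close>
  have "?b' (F E (map X [0..<n])) (F E (map Y [0..<n])) = F ?K (map2 ?b' (map X [0..<n]) (map Y [0..<n]))"
    using block[OF R.orthogonal_isometries_axioms E tup(1,2)] by (simp add: K)
  also have "\<dots> \<sqsubseteq>\<^sub>L F ?K (map2 ?b (map C [0..<n]) (map D [0..<n]))"
  proof (rule mono[OF hK])
    show "map2 ?b' (map X [0..<n]) (map Y [0..<n]) \<in> tuples n ?K"
      using R.block_op_pos(1)[OF E X Y] by (auto simp: tuples_def K map2_map_map)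
    show "map2 ?b (map C [0..<n]) (map D [0..<n]) \<in> tuples n ?K"
      using block_op_pos(1)[OF E C D] by (auto simp: tuples_def map2_map_map)
    show "list_all2 loewner_le (map2 ?b' (map X [0..<n]) (map Y [0..<n])) (map2 ?b (map C [0..<n]) (map D [0..<n]))"
      using dom by (auto simp: map2_map_map list_all2_conv_all_nth)
  qed
  also have "\<dots> = ?b (F E (map C [0..<n])) (F E (map D [0..<n]))"
    by (rule block[OF oi E tup(3,4)])
  finally have le: "?b' (F E (map X [0..<n])) (F E (map Y [0..<n])) \<sqsubseteq>\<^sub>L ?b (F E (map C [0..<n])) (F E (map D [0..<n]))" .
  show ?thesis
    unfolding C_def[symmetric]
  proof (rule loewner_leI)
    note Fd = pos_opsD[OF E pos[OF E tup(1)]] pos_opsD[OF E pos[OF E tup(2)]] pos_opsD[OF E pos[OF E tup(3)]]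
    show "clin (F E (map C [0..<n]))" "selfadj (F E (map C [0..<n]))" using Fd by auto
    have "(1 - l) *\<^sub>R F E (map X [0..<n]) + l *\<^sub>R F E (map Y [0..<n]) \<in> \<P> E"
      by (intro add_pos[OF E] scaleR_pos[OF E] pos[OF E] tup) (use l in auto)
    then show "clin ((1 - l) *\<^sub>R F E (map X [0..<n]) + l *\<^sub>R F E (map Y [0..<n]))"
      "selfadj ((1 - l) *\<^sub>R F E (map X [0..<n]) + l *\<^sub>R F E (map Y [0..<n]))"
      using pos_opsD[OF E] by auto
    fix x
    \<comment> \<open>On the first copy the rotated components are c x and -s x, which give the
      weights 1 - l and l; the second original component is 0, and with it the block of
      \<open>D\<close>.\<close>
    have Wx: "W1' (V1 x) = c *\<^sub>R x" "W2' (V1 x) = (- s) *\<^sub>R x" "W1 (V1 x) = x" "W2 (V1 x) = 0"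
      by (simp_all add: W1'_def W2'_def blinfun.add_left blinfun.diff_left blinfun.scaleR_left I1.left_inverse orthogonal)
    have "(1 - l) * inner (F E (map X [0..<n]) x) x + l * inner (F E (map Y [0..<n]) x) x
        \<le> inner (F E (map C [0..<n]) x) x + inner (F E (map D [0..<n]) 0) 0"
      using loewner_leD[OF le, of "V1 x"] unfolding block_op_quad[OF E] R.block_op_quad[OF E] Wx sq s2' c2 .
    then have "(1 - l) * inner (F E (map X [0..<n]) x) x + l * inner (F E (map Y [0..<n]) x) x \<le> inner (F E (map C [0..<n]) x) x"
      by simp
    then show "inner (((1 - l) *\<^sub>R F E (map X [0..<n]) + l *\<^sub>R F E (map Y [0..<n])) x) x \<le> inner (F E (map C [0..<n]) x) x"
      by (simp add: blinfun.add_left blinfun.scaleR_left inner_add_left)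
  qed
qed

section \<open>Regularity of operator means\<close>

declare loewner_trans [trans]

lemma loewner_sum_mono:
  "(\<And>k. k \<in> I \<Longrightarrow> f k \<sqsubseteq>\<^sub>L g k) \<Longrightarrow> (\<Sum>k\<in>I. f k) \<sqsubseteq>\<^sub>L (\<Sum>k\<in>I. g k)"
  by (induction I rule: infinite_finite_induct) (auto intro: loewner_add_mono)

lemma scaleR_pos_mono:
  assumes "0 \<sqsubseteq>\<^sub>L A" "a \<le> b"
  shows "a *\<^sub>R A \<sqsubseteq>\<^sub>L b *\<^sub>R A"
  using loewner_scaleR_mono[OF assms(1), of "b - a"] assms(2)
  by (simp add: loewner_le_def scaleR_diff_left)

lemma loewner_le_add: "0 \<sqsubseteq>\<^sub>L B \<Longrightarrow> A \<sqsubseteq>\<^sub>L A + B"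
  by (simp add: loewner_le_def)

lemma sum_pos_ops:
  fixes k :: nat
  assumes "hilbert E" "0 < k" "\<And>j. j < k \<Longrightarrow> y j \<in> \<P> E"
  shows "(\<Sum>j<k. y j) \<in> \<P> E"
  using assms(2,3)
proof (induction k rule: nat_induct_non_zero)
  case (Suc k)
  then show ?case using add_pos[OF assms(1)] by simp
qed simp

text \<open>Lists are replaced by functions of the index, so that single coordinates can be updated;
  only indices below n are constrained. Concavity is assumed with the loss e and regained without it
  in \<open>concave\<close>.\<close>

locale monotone_concave =
  fixes E :: "'h::chilbert_space set" and n :: nat and \<phi> :: "(nat \<Rightarrow> 'h operator) \<Rightarrow> 'h operator"
  assumes E: "hilbert E"
    and pos: "(\<And>i. i < n \<Longrightarrow> x i \<in> \<P> E) \<Longrightarrow> \<phi> x \<in> \<P> E"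
    and mono: "(\<And>i. i < n \<Longrightarrow> x i \<in> \<P> E) \<Longrightarrow> (\<And>i. i < n \<Longrightarrow> y i \<in> \<P> E) \<Longrightarrow>
      (\<And>i. i < n \<Longrightarrow> x i \<sqsubseteq>\<^sub>L y i) \<Longrightarrow> \<phi> x \<sqsubseteq>\<^sub>L \<phi> y"
    and weakly_concave: "(\<And>i. i < n \<Longrightarrow> x i \<in> \<P> E) \<Longrightarrow> (\<And>i. i < n \<Longrightarrow> y i \<in> \<P> E) \<Longrightarrow> 0 < l \<Longrightarrow> l < 1 \<Longrightarrow> 0 < e \<Longrightarrow>
      (1 - l) *\<^sub>R \<phi> x + l *\<^sub>R \<phi> y \<sqsubseteq>\<^sub>L \<phi> (\<lambda>i. (1 + e) *\<^sub>R ((1 - l) *\<^sub>R x i + l *\<^sub>R y i))"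
begin

lemma pos0: "A \<in> \<P> E \<Longrightarrow> 0 \<sqsubseteq>\<^sub>L A"
  by (rule pos_opsD(4)[OF E])

text \<open>For an exactly concave positive function, x would be a convex combination of t x and 0.
  Here 0 is not in the cone and concavity loses a factor, so t is enlarged to s and a small multiple
  of x replaces 0.\<close>

lemma subhomogeneous:
  assumes x: "\<And>i. i < n \<Longrightarrow> x i \<in> \<P> E" and t: "1 \<le> t"
  shows "\<phi> (\<lambda>i. t *\<^sub>R x i) \<sqsubseteq>\<^sub>L t *\<^sub>R \<phi> x"
proof (cases "t = 1")
  case False
  then have t: "1 < t" using assms(2) by simp
  show ?thesis
  proof (rule loewner_le_epsilon)
    fix e :: real assume e: "0 < e"
    \<comment> \<open>One factor 1 + d pays for the loss in concavity, the other for the small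
      vector \<open>?u\<close>; together they use up 1 + e.\<close>
    define d where "d = sqrt (1 + e) - 1"
    have d: "0 < d" "(1 + d) * (1 + d) = 1 + e" using e by (auto simp: d_def)
    define s where "s = t * (1 + e)"
    have s: "1 < s" unfolding s_def using t e by (simp add: less_1_mult)
    define l where "l = 1 - 1 / s"
    have l: "0 < l" "l < 1" using s by (auto simp: l_def)
    let ?u = "\<lambda>i. (d / (1 + e)) *\<^sub>R x i"
    have tx: "t *\<^sub>R x i \<in> \<P> E" and u: "?u i \<in> \<P> E" if "i < n" for i
      using x[OF that] t d e by (auto intro!: scaleR_pos[OF E])
    have "(1 / s) *\<^sub>R \<phi> (\<lambda>i. t *\<^sub>R x i) \<sqsubseteq>\<^sub>L (1 - l) *\<^sub>R \<phi> (\<lambda>i. t *\<^sub>R x i) + l *\<^sub>R \<phi> ?u"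
      using pos0[OF scaleR_pos[OF E pos[OF u] l(1)]] by (simp add: l_def loewner_le_add)
    also have "\<dots> \<sqsubseteq>\<^sub>L \<phi> (\<lambda>i. (1 + d) *\<^sub>R ((1 - l) *\<^sub>R (t *\<^sub>R x i) + l *\<^sub>R ?u i))"
      by (rule weakly_concave[OF tx u l d(1)])
    also have "\<dots> \<sqsubseteq>\<^sub>L \<phi> x"
    proof (rule mono[OF _ x])
      fix i assume i: "i < n"
      show "(1 + d) *\<^sub>R ((1 - l) *\<^sub>R (t *\<^sub>R x i) + l *\<^sub>R ?u i) \<in> \<P> E"
        by (rule scaleR_pos[OF E add_pos[OF E scaleR_pos[OF E tx[OF i]] scaleR_pos[OF E u[OF i]]]])
           (use l d in auto)
      have lt: "(1 - l) * t = 1 / (1 + e)" using t by (simp add: l_def s_def)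
      have "(1 + d) * ((1 - l) * t + l * (d / (1 + e))) = (1 + d) * (1 + l * d) / (1 + e)"
        unfolding lt using e by (simp add: field_simps)
      also have "\<dots> \<le> (1 + d) * (1 + d) / (1 + e)"
        using d l e by (intro divide_right_mono mult_left_mono) auto
      also have "\<dots> = 1" using d e by simp
      finally have "((1 + d) * ((1 - l) * t + l * (d / (1 + e)))) *\<^sub>R x i \<sqsubseteq>\<^sub>L 1 *\<^sub>R x i"
        by (rule scaleR_pos_mono[OF pos0[OF x[OF i]]])
      moreover have "(1 + d) *\<^sub>R ((1 - l) *\<^sub>R (t *\<^sub>R x i) + l *\<^sub>R ?u i)
          = ((1 + d) * ((1 - l) * t + l * (d / (1 + e)))) *\<^sub>R x i"
        by (simp add: scaleR_add_left scaleR_add_right distrib_left)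
      ultimately show "(1 + d) *\<^sub>R ((1 - l) *\<^sub>R (t *\<^sub>R x i) + l *\<^sub>R ?u i) \<sqsubseteq>\<^sub>L x i"
        by simp
    qed
    finally have "s *\<^sub>R ((1 / s) *\<^sub>R \<phi> (\<lambda>i. t *\<^sub>R x i)) \<sqsubseteq>\<^sub>L s *\<^sub>R \<phi> x"
      by (rule loewner_scaleR_mono) (use s in simp)
    then show "\<phi> (\<lambda>i. t *\<^sub>R x i) \<sqsubseteq>\<^sub>L (1 + e) *\<^sub>R t *\<^sub>R \<phi> x" using t e by (simp add: s_def mult.commute)
  qed
qed simp

text \<open>Subhomogeneity pulls the factor 1 + e out of the argument, and e tends to 0.\<close>

lemma concave:
  assumes x: "\<And>i. i < n \<Longrightarrow> x i \<in> \<P> E" and y: "\<And>i. i < n \<Longrightarrow> y i \<in> \<P> E" and l: "0 < l" "l < 1"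
  shows "(1 - l) *\<^sub>R \<phi> x + l *\<^sub>R \<phi> y \<sqsubseteq>\<^sub>L \<phi> (\<lambda>i. (1 - l) *\<^sub>R x i + l *\<^sub>R y i)"
proof (rule loewner_le_epsilon)
  fix e :: real assume e: "0 < e"
  have "(1 - l) *\<^sub>R x i + l *\<^sub>R y i \<in> \<P> E" if "i < n" for i
    using x[OF that] y[OF that] l by (auto intro!: scaleR_pos[OF E] add_pos[OF E])
  then have "\<phi> (\<lambda>i. (1 + e) *\<^sub>R ((1 - l) *\<^sub>R x i + l *\<^sub>R y i)) \<sqsubseteq>\<^sub>L (1 + e) *\<^sub>R \<phi> (\<lambda>i. (1 - l) *\<^sub>R x i + l *\<^sub>R y i)"
    using e by (intro subhomogeneous) auto
  then show "(1 - l) *\<^sub>R \<phi> x + l *\<^sub>R \<phi> y \<sqsubseteq>\<^sub>L (1 + e) *\<^sub>R \<phi> (\<lambda>i. (1 - l) *\<^sub>R x i + l *\<^sub>R y i)"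
    by (rule loewner_trans[rotated]) (intro weakly_concave x y l e)
qed

lemma concave_average:
  assumes "0 < k" "\<And>i j. j < k \<Longrightarrow> i < n \<Longrightarrow> y j i \<in> \<P> E"
  shows "(1 / real k) *\<^sub>R (\<Sum>j<k. \<phi> (y j)) \<sqsubseteq>\<^sub>L \<phi> (\<lambda>i. (1 / real k) *\<^sub>R (\<Sum>j<k. y j i))"
  using assms
proof (induction k rule: nat_induct_non_zero)
  case (Suc k)
  define l where "l = 1 / real (Suc k)"
  have l: "0 < l" "l < 1" "(1 - l) * (1 / real k) = l" using Suc.hyps by (auto simp: l_def field_simps)
  let ?x = "\<lambda>i. (1 / real k) *\<^sub>R (\<Sum>j<k. y j i)"
  have avg: "?x i \<in> \<P> E" if "i < n" for i
    using Suc.hyps that Suc.prems by (intro scaleR_pos[OF E] sum_pos_ops[OF E]) auto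
  have "(1 - l) *\<^sub>R ((1 / real k) *\<^sub>R (\<Sum>j<k. \<phi> (y j))) + l *\<^sub>R \<phi> (y k) \<sqsubseteq>\<^sub>L (1 - l) *\<^sub>R \<phi> ?x + l *\<^sub>R \<phi> (y k)"
    using Suc l by (intro loewner_add_mono loewner_scaleR_mono) auto
  also have "\<dots> \<sqsubseteq>\<^sub>L \<phi> (\<lambda>i. (1 - l) *\<^sub>R ?x i + l *\<^sub>R y k i)"
    using Suc.prems by (intro concave avg l) auto
  finally show ?case
    using l(3) by (simp add: scaleR_add_right[symmetric] l_def[symmetric] del: of_nat_Suc)
qed simp

end

text \<open>P, Q, R stand for values of a concave function at p, q = (1 - l) p + l r and r.
  Concavity bounds the increment from q to r by a multiple of the one from p to q, which is at most
  d relative to P.\<close>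

lemma average_jump_arith:
  fixes P Q R l d :: real
  assumes "l * R + (1 - l) * P \<le> Q" "Q \<le> (1 + d) * P" "0 < l" "l < 1" "0 \<le> d" "0 \<le> Q"
  shows "R \<le> (1 + d / l) * Q"
proof -
  \<comment> \<open>This rests on (1 - d) (1 + d) \<le> 1; for d \<ge> 1 the left side is not
    positive.\<close>
  have "(1 - d) * Q \<le> P"
  proof (cases "d < 1")
    case True
    have "(1 - d) * Q \<le> (1 - d) * ((1 + d) * P)" using assms True by (intro mult_left_mono) auto
    also have "\<dots> = P - d * d * P" by (simp add: algebra_simps)
    also have "\<dots> \<le> P" using assms by (smt (verit) mult_nonneg_nonneg zero_le_mult_iff)
    finally show ?thesis .
  next
    case False
    have "0 \<le> P" using assms by (smt (verit) zero_le_mult_iff)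
    moreover have "(1 - d) * Q \<le> 0" using False assms by (simp add: mult_nonpos_nonneg)
    ultimately show ?thesis by simp
  qed
  then have "(1 - l) * ((1 - d) * Q) \<le> (1 - l) * P" using assms by (intro mult_left_mono) auto
  then have "l * R \<le> Q - (1 - l) * ((1 - d) * Q)" using assms(1) by linarith
  also have "\<dots> = (l + d) * Q - l * d * Q" by (simp add: algebra_simps)
  also have "\<dots> \<le> (l + d) * Q" using assms by simp
  finally show ?thesis using assms(3) by (simp add: field_simps)
qed

section \<open>Symmetric functions: the effect of changing a few coordinates\<close>

locale symmetric_mean = F: monotone_concave E n \<phi> + G: monotone_concave E n "\<lambda>x. inv_op E (\<phi> (\<lambda>i. inv_op E (x i)))"
  for E :: "'h::chilbert_space set" and n \<phi> +
  assumes n: "0 < n"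
    and symmetric: "(\<And>i. i < n \<Longrightarrow> x i \<in> \<P> E) \<Longrightarrow> \<sigma> permutes {..<n} \<Longrightarrow> \<phi> (x \<circ> \<sigma>) = \<phi> x"
begin

lemmas E = F.E

abbreviation (input) scalar where "scalar r \<equiv> r *\<^sub>R id_op E"

lemma scalar_pos: "0 < r \<Longrightarrow> scalar r \<in> \<P> E"
  by (rule scaleR_pos[OF E id_op_pos[OF E]])

lemma scalar_mono: "r \<le> s \<Longrightarrow> scalar r \<sqsubseteq>\<^sub>L scalar s"
  by (rule scaleR_pos_mono[OF F.pos0[OF id_op_pos[OF E]]])

text \<open>
  Averaging over the transpositions of \<open>j\<close> with all other indices replaces the jump of size \<open>M\<close> in
  the coordinate \<open>j\<close> by relative jumps of size \<open>O(1 / n)\<close> in every coordinate.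
\<close>

lemma jump_at_top:
  assumes m: "0 < m" "m \<le> M" and j: "j < n"
    and x: "\<And>i. i < n \<Longrightarrow> x i \<in> \<P> E" "\<And>i. i < n \<Longrightarrow> scalar m \<sqsubseteq>\<^sub>L x i" "\<And>i. i < n \<Longrightarrow> x i \<sqsubseteq>\<^sub>L scalar M"
  shows "\<phi> (x(j := scalar (2 * M))) \<sqsubseteq>\<^sub>L (1 + 2 * M / m / real n) *\<^sub>R \<phi> (x(j := scalar M))"
proof -
  define a where "a = x(j := scalar (2 * M))"
  define b where "b = x(j := scalar M)"
  define c where "c = 2 * M / m"
  have M: "0 < M" using m by simp
  have c: "0 < c" "c * m = 2 * M" using m M by (auto simp: c_def)
  define y where "y k = a \<circ> Transposition.transpose j k" for k
  have a: "a i \<in> \<P> E" and b: "b i \<in> \<P> E" and bm: "scalar m \<sqsubseteq>\<^sub>L b i" if "i < n" for i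
    using x(1,2)[OF that] M scalar_mono[OF m(2)] by (auto simp: a_def b_def intro!: scalar_pos)
  have y: "y k i \<in> \<P> E" if "k < n" "i < n" for k i
    using a that j by (auto simp: y_def Transposition.transpose_def)
  \<comment> \<open>The tuple \<open>y k\<close> has the entry 2M at k and \<open>x k\<close> at j,
    the latter below the entry M of \<open>b\<close>. Elsewhere it agrees with
    \<open>b\<close>.\<close>
  have yb: "y k i \<sqsubseteq>\<^sub>L b i + (if k = i then scalar (2 * M) else 0)" if ki: "k < n" "i < n" for k i
  proof (cases "k = i")
    case True
    then have "y k i = scalar (2 * M)" by (simp add: y_def a_def)
    then show ?thesis using True loewner_le_add[OF F.pos0[OF b[OF ki(2)]], of "scalar (2 * M)"] by (simp add: add.commute)
  next
    case False
    show ?thesis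
    proof (cases "i = j")
      case True
      then have "y k i = x k" using False by (simp add: y_def a_def)
      then show ?thesis using x(3)[OF ki(1)] True False by (simp add: b_def)
    next
      case ij: False
      then have "y k i = x i" using False by (simp add: y_def a_def Transposition.transpose_def)
      then show ?thesis using False ij by (simp add: b_def)
    qed
  qed
  have avg: "(1 / real n) *\<^sub>R (\<Sum>k<n. y k i) \<sqsubseteq>\<^sub>L (1 + c / real n) *\<^sub>R b i" if i: "i < n" for i
  proof -
    \<comment> \<open>Over the n tuples the entry 2M visits position i once; it is absorbed by c
      times \<open>b i\<close>, because \<open>b i\<close> is at least m and c m = 2M.\<close>
    have "(\<Sum>k<n. y k i) \<sqsubseteq>\<^sub>L (\<Sum>k<n. b i + (if k = i then scalar (2 * M) else 0))"
      using yb i by (intro loewner_sum_mono) auto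
    also have "\<dots> = real n *\<^sub>R b i + scalar (2 * M)"
      using i by (simp add: sum.distrib sum_constant_scaleR)
    also have "\<dots> \<sqsubseteq>\<^sub>L real n *\<^sub>R b i + c *\<^sub>R b i"
      using loewner_scaleR_mono[OF bm[OF i], of c] c by (intro loewner_add_mono) auto
    finally have "(1 / real n) *\<^sub>R (\<Sum>k<n. y k i) \<sqsubseteq>\<^sub>L (1 / real n) *\<^sub>R (real n *\<^sub>R b i + c *\<^sub>R b i)"
      by (rule loewner_scaleR_mono) simp
    also have "\<dots> = (1 + c / real n) *\<^sub>R b i"
      using n by (simp add: scaleR_add_right scaleR_add_left)
    finally show ?thesis .
  qed
  have "\<phi> a = (1 / real n) *\<^sub>R (\<Sum>k<n. \<phi> (y k))"
    using n j by (simp add: y_def symmetric[OF a] permutes_swap_id sum_constant_scaleR)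
  also have "\<dots> \<sqsubseteq>\<^sub>L \<phi> (\<lambda>i. (1 / real n) *\<^sub>R (\<Sum>k<n. y k i))"
    using n y by (intro F.concave_average) auto
  also have "\<dots> \<sqsubseteq>\<^sub>L \<phi> (\<lambda>i. (1 + c / real n) *\<^sub>R b i)"
  proof (rule F.mono)
    fix i assume i: "i < n"
    show "(1 / real n) *\<^sub>R (\<Sum>k<n. y k i) \<in> \<P> E"
      using n y i by (intro scaleR_pos[OF E] sum_pos_ops[OF E]) auto
    show "(1 + c / real n) *\<^sub>R b i \<in> \<P> E"
      using b[OF i] c by (intro scaleR_pos[OF E]) (auto simp: add_pos_nonneg)
  qed (rule avg)
  also have "\<dots> \<sqsubseteq>\<^sub>L (1 + c / real n) *\<^sub>R \<phi> b"
    using b c by (intro F.subhomogeneous) auto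
  finally show ?thesis by (simp add: a_def b_def c_def)
qed

text \<open>
  The map \<open>s \<mapsto> (\<phi> (x(j := 1/s)))\<^sup>-\<^sup>1\<close> is concave, so its increment on \<open>[1/M, 1/m]\<close> is controlled
  by the one on \<open>[1/(2M), 1/M]\<close>.
\<close>

lemma jump:
  assumes m: "0 < m" "m < M" and j: "j < n"
    and x: "\<And>i. i < n \<Longrightarrow> x i \<in> \<P> E" "\<And>i. i < n \<Longrightarrow> scalar m \<sqsubseteq>\<^sub>L x i" "\<And>i. i < n \<Longrightarrow> x i \<sqsubseteq>\<^sub>L scalar M"
  shows "\<phi> (x(j := scalar M)) \<sqsubseteq>\<^sub>L (1 + 4 * M\<^sup>2 / m\<^sup>2 / real n) *\<^sub>R \<phi> (x(j := scalar m))"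
proof -
  have M: "0 < M" using m by simp
  define d where "d = 2 * M / m / real n"
  have d: "0 \<le> d" using m M by (simp add: d_def)
  \<comment> \<open>The weight for which 1/M = (1 - l) / (2M) + l / m.\<close>
  define l where "l = m / (2 * M - m)"
  have l: "0 < l" "l < 1" using m by (auto simp: l_def)
  \<comment> \<open>An upper bound for d / l = 2M (2M - m) / (m^2 n), the relative increment that
    concavity yields.\<close>
  define C where "C = 4 * M\<^sup>2 / m\<^sup>2 / real n"
  have C: "0 \<le> C" by (simp add: C_def)
  have dlC: "d / l \<le> C"
  proof -
    have "d / l = 2 * M * (2 * M - m) / m\<^sup>2 / real n"
      using m by (simp add: d_def l_def power2_eq_square)
    also have "\<dots> \<le> C" unfolding C_def using m M
      by (intro divide_right_mono) (auto simp: power2_eq_square algebra_simps)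
    finally show ?thesis .
  qed
  have xs: "(x(j := scalar s)) i \<in> \<P> E" if "0 < s" "i < n" for s i
    using x(1)[OF that(2)] scalar_pos[OF that(1)] by simp
  have phi_pos: "\<phi> (x(j := scalar s)) \<in> \<P> E" if "0 < s" for s
    by (rule F.pos) (erule xs[OF that])
  define \<Psi> where "\<Psi> s = inv_op E (\<phi> (x(j := scalar (1 / s))))" for s
  have \<Psi>: "\<Psi> s \<in> \<P> E" if "0 < s" for s
    unfolding \<Psi>_def using that by (intro inv_op_pos[OF E] phi_pos) auto
  define z where "z s = (\<lambda>i. inv_op E (x i))(j := scalar s)" for s
  have z: "z s i \<in> \<P> E" if "0 < s" "i < n" for s i
    using x(1)[OF that(2)] scalar_pos[OF that(1)] inv_op_pos[OF E] by (simp add: z_def)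
  have \<Psi>_z: "\<Psi> s = inv_op E (\<phi> (\<lambda>i. inv_op E (z s i)))" if s: "0 < s" for s
  proof -
    have eq: "inv_op E (z s i) = (x(j := scalar (1 / s))) i" if "i < n" for i
      using x(1)[OF that] s inv_op_inv_op[OF E] inv_op_scaleR[OF E id_op_pos[OF E] s] inv_op_id[OF E]
      by (auto simp: z_def)
    have p1: "(x(j := scalar (1 / s))) i \<in> \<P> E" if "i < n" for i using xs that s by simp
    have p2: "inv_op E (z s i) \<in> \<P> E" if "i < n" for i using inv_op_pos[OF E z[OF s that]] .
    \<comment> \<open>The two arguments are known to agree only below n, so the values are compared
      by monotonicity in both directions.\<close>
    have "\<phi> (\<lambda>i. inv_op E (z s i)) = \<phi> (x(j := scalar (1 / s)))"
    proof (rule loewner_antisym)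
      show "\<phi> (\<lambda>i. inv_op E (z s i)) \<sqsubseteq>\<^sub>L \<phi> (x(j := scalar (1 / s)))"
      proof (rule F.mono[OF p2 p1])
        fix i assume "i < n"
        then show "inv_op E (z s i) \<sqsubseteq>\<^sub>L (x(j := scalar (1 / s))) i" by (subst eq) simp_all
      qed
      show "\<phi> (x(j := scalar (1 / s))) \<sqsubseteq>\<^sub>L \<phi> (\<lambda>i. inv_op E (z s i))"
      proof (rule F.mono[OF p1 p2])
        fix i assume "i < n"
        then show "(x(j := scalar (1 / s))) i \<sqsubseteq>\<^sub>L inv_op E (z s i)" by (subst eq) simp_all
      qed
    qed (rule pos_opsD(2)[OF E F.pos], (rule p1 p2)?, assumption?)+
    then show ?thesis by (simp add: \<Psi>_def)
  qed
  let ?p = "1 / (2 * M)" and ?q = "1 / M" and ?r = "1 / m"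
  have pqr: "0 < ?p" "0 < ?q" "0 < ?r" "0 < 2 * M" using m M by auto
  have ql: "(1 - l) * ?p + l * ?r = ?q"
  proof -
    have "2 * M - m \<noteq> 0" "m \<noteq> 0" "M \<noteq> 0" using m by auto
    then have "l * ?r = 1 / (2 * M - m)" "1 - l = 2 * (M - m) / (2 * M - m)" by (simp_all add: l_def field_simps)
    then have "(1 - l) * ?p + l * ?r = 2 * (M - m) / (2 * M - m) * ?p + 1 / (2 * M - m)" by (simp only:)
    also have "\<dots> = ?q"
      using \<open>2 * M - m \<noteq> 0\<close> \<open>M \<noteq> 0\<close> by (simp add: divide_simps)
    finally show ?thesis .
  qed
  have conc: "(1 - l) *\<^sub>R \<Psi> ?p + l *\<^sub>R \<Psi> ?r \<sqsubseteq>\<^sub>L \<Psi> ?q"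
  proof -
    have "(\<lambda>i. (1 - l) *\<^sub>R z ?p i + l *\<^sub>R z ?r i) = z ?q"
    proof
      fix i show "(1 - l) *\<^sub>R z ?p i + l *\<^sub>R z ?r i = z ?q i"
      proof (cases "i = j")
        case True
        then show ?thesis using ql by (simp add: z_def scaleR_add_left[symmetric] del: times_divide_eq_right)
      next
        case False
        then show ?thesis by (simp add: z_def scaleR_add_left[symmetric])
      qed
    qed
    note eq = this[THEN fun_cong]
    have "(1 - l) *\<^sub>R inv_op E (\<phi> (\<lambda>i. inv_op E (z ?p i))) + l *\<^sub>R inv_op E (\<phi> (\<lambda>i. inv_op E (z ?r i)))
        \<sqsubseteq>\<^sub>L inv_op E (\<phi> (\<lambda>i. inv_op E ((1 - l) *\<^sub>R z ?p i + l *\<^sub>R z ?r i)))"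
      by (rule G.concave[where x = "z ?p" and y = "z ?r", OF _ _ l]) (erule z[OF pqr(1)] z[OF pqr(3)])+
    then show ?thesis by (simp only: \<Psi>_z pqr eq)
  qed
  \<comment> \<open>The bound for the jump from M to 2M, inverted: it controls the increment of
    \<Psi> from 1/(2M) to 1/M.\<close>
  have "inv_op E ((1 + d) *\<^sub>R \<phi> (x(j := scalar M))) \<sqsubseteq>\<^sub>L inv_op E (\<phi> (x(j := scalar (2 * M))))"
  proof (rule inv_op_antimono[OF E phi_pos[OF pqr(4)]])
    show "(1 + d) *\<^sub>R \<phi> (x(j := scalar M)) \<in> \<P> E"
      using d by (intro scaleR_pos[OF E phi_pos[OF M]]) simp
    show "\<phi> (x(j := scalar (2 * M))) \<sqsubseteq>\<^sub>L (1 + d) *\<^sub>R \<phi> (x(j := scalar M))"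
      unfolding d_def by (rule jump_at_top[OF m(1) less_imp_le[OF m(2)] j]) (erule x)+
  qed
  then have "(1 / (1 + d)) *\<^sub>R \<Psi> ?q \<sqsubseteq>\<^sub>L \<Psi> ?p"
    using d by (subst (asm) inv_op_scaleR[OF E phi_pos[OF M]]) (auto simp: \<Psi>_def)
  then have qp: "\<Psi> ?q \<sqsubseteq>\<^sub>L (1 + d) *\<^sub>R \<Psi> ?p"
    using scaleR_le_iff[OF E, of "1 + d"] d by auto
  have "\<Psi> ?r \<sqsubseteq>\<^sub>L (1 + C) *\<^sub>R \<Psi> ?q"
  proof (rule loewner_leI)
    have "(1 + C) *\<^sub>R \<Psi> ?q \<in> \<P> E" using \<Psi>[OF pqr(2)] C by (intro scaleR_pos[OF E]) auto
    then show "clin (\<Psi> ?r)" "selfadj (\<Psi> ?r)" "clin ((1 + C) *\<^sub>R \<Psi> ?q)" "selfadj ((1 + C) *\<^sub>R \<Psi> ?q)"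
      using pos_opsD[OF E] \<Psi>[OF pqr(3)] by auto
    fix v
    let ?P = "inner (\<Psi> ?p v) v" and ?Q = "inner (\<Psi> ?q v) v" and ?R = "inner (\<Psi> ?r v) v"
    have Q: "0 \<le> ?Q" by (rule pos_opsD(5)[OF E \<Psi>[OF pqr(2)]])
    have "?R \<le> (1 + d / l) * ?Q"
    proof (rule average_jump_arith[OF _ _ l d Q])
      show "l * ?R + (1 - l) * ?P \<le> ?Q"
        using loewner_leD[OF conc, of v] by (simp add: blinfun.add_left blinfun.scaleR_left inner_add_left)
      show "?Q \<le> (1 + d) * ?P" using loewner_leD[OF qp, of v] by (simp add: blinfun.scaleR_left)
    qed
    also have "\<dots> \<le> (1 + C) * ?Q" using dlC Q by (intro mult_right_mono) auto
    finally show "?R \<le> inner (((1 + C) *\<^sub>R \<Psi> ?q) v) v" by (simp add: blinfun.scaleR_left)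
  qed
  then have "inv_op E ((1 + C) *\<^sub>R \<Psi> ?q) \<sqsubseteq>\<^sub>L inv_op E (\<Psi> ?r)"
    using \<Psi>[OF pqr(3)] \<Psi>[OF pqr(2)] C by (intro inv_op_antimono[OF E] scaleR_pos[OF E]) auto
  then have "(1 / (1 + C)) *\<^sub>R inv_op E (\<Psi> ?q) \<sqsubseteq>\<^sub>L inv_op E (\<Psi> ?r)"
    using C by (subst (asm) inv_op_scaleR[OF E \<Psi>[OF pqr(2)]]) auto
  then have "inv_op E (\<Psi> ?q) \<sqsubseteq>\<^sub>L (1 + C) *\<^sub>R inv_op E (\<Psi> ?r)"
    using scaleR_le_iff[OF E, of "1 + C"] C by auto
  moreover have "inv_op E (\<Psi> ?q) = \<phi> (x(j := scalar M))" "inv_op E (\<Psi> ?r) = \<phi> (x(j := scalar m))"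
    using inv_op_inv_op[OF E phi_pos[OF M]] inv_op_inv_op[OF E phi_pos[OF m(1)]] by (simp_all add: \<Psi>_def)
  ultimately show ?thesis by (simp add: C_def)
qed

text \<open>The coordinates of S are changed one at a time. All intermediate tuples stay between m
  and M, so each change costs the same factor.\<close>

lemma jumps:
  assumes m: "0 < m" "m < M" and S: "finite S" "S \<subseteq> {..<n}"
    and x: "\<And>i. i < n \<Longrightarrow> x i \<in> \<P> E" "\<And>i. i < n \<Longrightarrow> scalar m \<sqsubseteq>\<^sub>L x i" "\<And>i. i < n \<Longrightarrow> x i \<sqsubseteq>\<^sub>L scalar M"
  shows "\<phi> (\<lambda>i. if i \<in> S then scalar M else x i)
    \<sqsubseteq>\<^sub>L (1 + 4 * M\<^sup>2 / m\<^sup>2 / real n) ^ card S *\<^sub>R \<phi> (\<lambda>i. if i \<in> S then scalar m else x i)"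
  using S x
proof (induction S arbitrary: x rule: finite_induct)
  case (insert j S)
  let ?C = "1 + 4 * M\<^sup>2 / m\<^sup>2 / real n"
  have C: "0 \<le> ?C" by (simp add: add_nonneg_nonneg)
  have M: "0 < M" using m by simp
  define y where "y = (\<lambda>i. if i \<in> S then scalar M else x i)"
  have y: "y i \<in> \<P> E" "scalar m \<sqsubseteq>\<^sub>L y i" "y i \<sqsubseteq>\<^sub>L scalar M" if "i < n" for i
    using insert.prems(2-4)[OF that] scalar_pos[OF M] scalar_mono[of m M] m by (auto simp: y_def)
  define x' where "x' = x(j := scalar m)"
  have x': "x' i \<in> \<P> E" "scalar m \<sqsubseteq>\<^sub>L x' i" "x' i \<sqsubseteq>\<^sub>L scalar M" if "i < n" for i
    using insert.prems(2-4)[OF that] scalar_pos[OF m(1)] scalar_mono[of m M] m by (auto simp: x'_def)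
  have "(\<lambda>i. if i \<in> insert j S then scalar M else x i) = y(j := scalar M)" by (auto simp: y_def)
  moreover have "\<phi> (y(j := scalar M)) \<sqsubseteq>\<^sub>L ?C *\<^sub>R \<phi> (y(j := scalar m))"
    using insert.prems by (intro jump m y) auto
  moreover have "y(j := scalar m) = (\<lambda>i. if i \<in> S then scalar M else x' i)"
    using insert.hyps by (auto simp: y_def x'_def)
  moreover have "?C *\<^sub>R \<phi> (\<lambda>i. if i \<in> S then scalar M else x' i)
      \<sqsubseteq>\<^sub>L ?C *\<^sub>R ?C ^ card S *\<^sub>R \<phi> (\<lambda>i. if i \<in> S then scalar m else x' i)"
    using insert.prems x' C by (intro loewner_scaleR_mono insert.IH) auto
  moreover have "(\<lambda>i. if i \<in> S then scalar m else x' i) = (\<lambda>i. if i \<in> insert j S then scalar m else x i)"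
    by (auto simp: x'_def)
  ultimately show ?case
    using insert.hyps by (simp add: loewner_trans)
qed simp

text \<open>Scaling also the entries M by t only increases the left side; then t is pulled out by
  subhomogeneity. The exponential comes from (1 + a)^k \<le> exp (a k).\<close>

lemma comparison:
  assumes m: "0 < m" "m < M" and S: "S \<subseteq> {..<n}" and t: "1 \<le> t"
    and w: "\<And>i. i < n \<Longrightarrow> w i \<in> \<P> E" "\<And>i. i < n \<Longrightarrow> scalar m \<sqsubseteq>\<^sub>L w i" "\<And>i. i < n \<Longrightarrow> w i \<sqsubseteq>\<^sub>L scalar M"
  shows "\<phi> (\<lambda>i. if i \<in> S then scalar M else t *\<^sub>R w i)
    \<sqsubseteq>\<^sub>L (t * exp (4 * M\<^sup>2 / m\<^sup>2 * (real (card S) / real n))) *\<^sub>R \<phi> (\<lambda>i. if i \<in> S then scalar m else w i)"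
proof -
  let ?u = "\<lambda>i. if i \<in> S then scalar M else w i" and ?v = "\<lambda>i. if i \<in> S then scalar m else w i"
  let ?C = "4 * M\<^sup>2 / m\<^sup>2 / real n"
  have M: "0 < M" using m by simp
  have u: "?u i \<in> \<P> E" if "i < n" for i using w(1)[OF that] scalar_pos[OF M] by simp
  have v: "?v i \<in> \<P> E" if "i < n" for i using w(1)[OF that] scalar_pos[OF m(1)] by simp
  have "\<phi> (\<lambda>i. if i \<in> S then scalar M else t *\<^sub>R w i) \<sqsubseteq>\<^sub>L \<phi> (\<lambda>i. t *\<^sub>R ?u i)"
  proof (rule F.mono)
    fix i assume i: "i < n"
    show "(if i \<in> S then scalar M else t *\<^sub>R w i) \<in> \<P> E" "t *\<^sub>R ?u i \<in> \<P> E"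
      using w(1)[OF i] scalar_pos[OF M] t by (auto intro!: scaleR_pos[OF E] id_op_pos[OF E] simp: M)
    show "(if i \<in> S then scalar M else t *\<^sub>R w i) \<sqsubseteq>\<^sub>L t *\<^sub>R ?u i"
      using scalar_mono[of M "t * M"] t M by auto
  qed
  also have "\<dots> \<sqsubseteq>\<^sub>L t *\<^sub>R \<phi> ?u" by (rule F.subhomogeneous[OF u t])
  also have "\<dots> \<sqsubseteq>\<^sub>L t *\<^sub>R (1 + ?C) ^ card S *\<^sub>R \<phi> ?v"
    using t by (intro loewner_scaleR_mono jumps m finite_subset[OF S] S w) auto
  also have "\<dots> = (t * (1 + ?C) ^ card S) *\<^sub>R \<phi> ?v" by simp
  also have "\<dots> \<sqsubseteq>\<^sub>L (t * exp (4 * M\<^sup>2 / m\<^sup>2 * (real (card S) / real n))) *\<^sub>R \<phi> ?v"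
  proof (rule scaleR_pos_mono[OF F.pos0[OF F.pos[OF v]]])
    have "(1 + ?C) ^ card S \<le> exp ?C ^ card S"
      by (intro power_mono exp_ge_add_one_self) (simp add: add_nonneg_nonneg)
    also have "\<dots> = exp (4 * M\<^sup>2 / m\<^sup>2 * (real (card S) / real n))"
      by (simp add: exp_of_nat_mult[symmetric] mult.commute)
    finally show "t * (1 + ?C) ^ card S \<le> t * exp (4 * M\<^sup>2 / m\<^sup>2 * (real (card S) / real n))"
      using t by simp
  qed
  finally show ?thesis .
qed

end

text \<open>Infinite dimension enters here: it provides the two orthogonal copies of E on which the
  rotation argument takes place. The argument is applied to the mean and to its dual.\<close>

lemma operator_mean_symmetric_mean:
  fixes F :: "nat \<Rightarrow> 'h::chilbert_space op_family"
  assumes inf: "\<not> (\<exists>B :: 'h set. finite B \<and> span B = UNIV)" and mean: "operator_mean F"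
    and E: "hilbert E" and n: "0 < n"
  shows "symmetric_mean E n (\<lambda>x. F n E (map x [0..<n]))"
proof -
  obtain V1 V2 W1 W2 :: "'h operator" where
    V: "\<And>c x. V1 (c *\<^sub>C x) = c *\<^sub>C V1 x" "\<And>c x. V2 (c *\<^sub>C x) = c *\<^sub>C V2 x"
    "\<And>c x. W1 (c *\<^sub>C x) = c *\<^sub>C W1 x" "\<And>c x. W2 (c *\<^sub>C x) = c *\<^sub>C W2 x"
    "\<And>x y. cinner (V1 x) y = cinner x (W1 y)" "\<And>x y. cinner (V2 x) y = cinner x (W2 y)"
    "\<And>x. W1 (V1 x) = x" "\<And>x. W2 (V2 x) = x" "\<And>x. W1 (V2 x) = 0" "\<And>x. W2 (V1 x) = 0"
    by (rule exists_orthogonal_isometries[OF inf]) (rule that)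
  have oi: "orthogonal_isometries V1 W1 V2 W2"
    by unfold_locales (simp_all add: clin_def V Re_cinner[symmetric])
  have free: "free_function n (F n)" "operator_monotone n (F n)"
    using conjunct1[OF mean[unfolded operator_mean_def]] n by simp_all
  have B: "block_function n (F n)" by (rule free_function_block[OF free])
  have conc: "monotone_concave E n (\<lambda>x. G E (map x [0..<n]))" if G: "block_function n G" for G
  proof
    show "hilbert E" by (rule E)
    fix x :: "nat \<Rightarrow> 'h operator" assume x: "\<And>i. i < n \<Longrightarrow> x i \<in> \<P> E"
    then have tx: "map x [0..<n] \<in> tuples n E" by (auto simp: tuples_def)
    then show "G E (map x [0..<n]) \<in> \<P> E" using G E unfolding block_function_def by blast
    fix y assume y: "\<And>i. i < n \<Longrightarrow> y i \<in> \<P> E"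
    then have ty: "map y [0..<n] \<in> tuples n E" by (auto simp: tuples_def)
    show "G E (map x [0..<n]) \<sqsubseteq>\<^sub>L G E (map y [0..<n])" if "\<And>i. i < n \<Longrightarrow> x i \<sqsubseteq>\<^sub>L y i"
    proof -
      have "list_all2 loewner_le (map x [0..<n]) (map y [0..<n])" using that by (simp add: list_all2_conv_all_nth)
      then show ?thesis using G E tx ty unfolding block_function_def operator_monotone_def by blast
    qed
    show "(1 - l) *\<^sub>R G E (map x [0..<n]) + l *\<^sub>R G E (map y [0..<n])
        \<sqsubseteq>\<^sub>L G E (map (\<lambda>i. (1 + e) *\<^sub>R ((1 - l) *\<^sub>R x i + l *\<^sub>R y i)) [0..<n])"
      if "0 < l" "l < 1" "0 < e" for l e
      by (rule block_function_weakly_concave[OF G oi E x y that])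
  qed
  interpret F: monotone_concave E n "\<lambda>x. F n E (map x [0..<n])" by (rule conc[OF B])
  have "monotone_concave E n (\<lambda>x. inv_op E (F n E (map (\<lambda>i. inv_op E (x i)) [0..<n])))"
    using conc[OF dual_family_block[OF B]] by (simp add: dual_family_def o_def)
  then interpret G: monotone_concave E n "\<lambda>x. inv_op E (F n E (map (\<lambda>i. inv_op E (x i)) [0..<n]))" .
  show ?thesis
  proof
    show "0 < n" by (rule n)
    fix x :: "nat \<Rightarrow> 'h operator" and \<sigma> assume x: "\<And>i. i < n \<Longrightarrow> x i \<in> \<P> E" and \<sigma>: "\<sigma> permutes {..<n}"
    have "permute_list \<sigma> (map x [0..<n]) = map (x \<circ> \<sigma>) [0..<n]"
      using permutes_in_image[OF \<sigma>] by (auto simp: permute_list_def)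
    moreover have "map x [0..<n] \<in> tuples n E" using x by (auto simp: tuples_def)
    ultimately show "F n E (map (x \<circ> \<sigma>) [0..<n]) = F n E (map x [0..<n])"
      using conjunct1[OF conjunct2[OF mean[unfolded operator_mean_def]], rule_format, OF n E _ \<sigma>] by metis
  qed
qed

section \<open>Hall's marriage theorem\<close>

text \<open>Induction on the size of I. If a nonempty proper subset J has exactly as many neighbours
  as elements, J and I - J are matched separately; otherwise there is a surplus, and one element may
  be matched arbitrarily.\<close>

lemma hall_marriage:
  fixes N :: "'a \<Rightarrow> 'b set"
  assumes "finite I" "\<And>i. i \<in> I \<Longrightarrow> finite (N i)" "\<And>J. J \<subseteq> I \<Longrightarrow> card J \<le> card (\<Union>(N ` J))"
  shows "\<exists>\<sigma>. inj_on \<sigma> I \<and> (\<forall>i\<in>I. \<sigma> i \<in> N i)"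
  using assms
proof (induction "card I" arbitrary: I N rule: less_induct)
  case less
  note fin = less.prems(1,2) and hall = less.prems(3)
  show ?case
  proof (cases "\<exists>J. J \<subset> I \<and> J \<noteq> {} \<and> card J = card (\<Union>(N ` J))")
    case True
    then obtain J where J: "J \<subset> I" "J \<noteq> {}" "card J = card (\<Union>(N ` J))" by (elim exE conjE)
    have finJ: "finite J" using J(1) fin(1) finite_subset by (metis psubset_imp_subset)
    have "\<exists>\<sigma>. inj_on \<sigma> J \<and> (\<forall>i\<in>J. \<sigma> i \<in> N i)"
    proof (rule less.hyps[OF _ finJ])
      show "card J < card I" by (rule psubset_card_mono[OF fin(1) J(1)])
      show "finite (N i)" if "i \<in> J" for i using fin(2) J(1) that by (metis psubsetD)
      show "card K \<le> card (\<Union>(N ` K))" if "K \<subseteq> J" for K using hall[of K] J(1) that by (meson order_trans psubset_imp_subset)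
    qed
    then obtain \<sigma> where \<sigma>: "inj_on \<sigma> J" "\<And>i. i \<in> J \<Longrightarrow> \<sigma> i \<in> N i" by (elim exE conjE) simp
    let ?V = "\<Union>(N ` J)"
    have finV: "finite ?V" using finJ fin(2) J(1) by (metis finite_UN_I psubsetD)
    have "\<exists>\<tau>. inj_on \<tau> (I - J) \<and> (\<forall>i\<in>I - J. \<tau> i \<in> N i - ?V)"
    proof (rule less.hyps)
      show "card (I - J) < card I" using J fin(1) by (metis Diff_subset card_Diff_subset card_gt_0_iff diff_less finJ card_mono psubset_imp_subset order_less_le_trans)
      show "finite (I - J)" using fin(1) by simp
      show "finite (N i - ?V)" if "i \<in> I - J" for i using fin(2) that by simp
      \<comment> \<open>Hall's condition for K \<union> J, after removing the neighbours of J, which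
        are exactly as many as J has elements.\<close>
      fix K assume K: "K \<subseteq> I - J"
      have finK: "finite K" using K fin(1) by (metis finite_Diff finite_subset)
      let ?W = "\<Union>i\<in>K. N i - ?V"
      have finW: "finite ?W" using finK K fin(2) by (intro finite_UN_I) auto
      have "card K + card J = card (K \<union> J)" using K finK finJ by (intro card_Un_disjoint[symmetric]) auto
      also have "\<dots> \<le> card (\<Union>(N ` (K \<union> J)))" using K J(1) by (intro hall) auto
      also have "\<Union>(N ` (K \<union> J)) = ?W \<union> ?V" by auto
      also have "card (?W \<union> ?V) = card ?W + card ?V" using finW finV by (intro card_Un_disjoint) auto
      finally show "card K \<le> card ?W" using J(3) by simp
    qed
    then obtain \<tau> where \<tau>: "inj_on \<tau> (I - J)" "\<And>i. i \<in> I - J \<Longrightarrow> \<tau> i \<in> N i - ?V" by (elim exE conjE) simp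
    let ?\<rho> = "\<lambda>i. if i \<in> J then \<sigma> i else \<tau> i"
    have "inj_on ?\<rho> I"
    proof (rule inj_onI)
      fix a b assume ab: "a \<in> I" "b \<in> I" "?\<rho> a = ?\<rho> b"
      have "a \<in> J \<longleftrightarrow> b \<in> J"
      proof (rule ccontr)
        assume ne: "\<not> ?thesis"
        have "\<sigma> i \<in> ?V" if "i \<in> J" for i using \<sigma>(2)[OF that] that by blast
        moreover have "\<tau> i \<notin> ?V" if "i \<in> I - J" for i using \<tau>(2)[OF that] by blast
        ultimately show False using ne ab by (metis DiffI)
      qed
      then show "a = b" using ab \<sigma>(1) \<tau>(1) by (cases "a \<in> J") (auto dest: inj_onD)
    qed
    moreover have "\<forall>i\<in>I. ?\<rho> i \<in> N i" using \<sigma>(2) \<tau>(2) by auto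
    ultimately show ?thesis by blast
  next
    case False
    show ?thesis
    proof (cases "I = {}")
      case False': False
      then obtain a where a: "a \<in> I" by blast
      have "card {a} \<le> card (N a)" using hall[of "{a}"] a by simp
      then obtain y where y: "y \<in> N a" by (metis card.empty card_0_eq ex_in_conv fin(2)[OF a] finite.emptyI card.insert empty_iff finite.intros(1) not_one_le_zero One_nat_def)
      have "\<exists>\<sigma>. inj_on \<sigma> (I - {a}) \<and> (\<forall>i\<in>I - {a}. \<sigma> i \<in> N i - {y})"
      proof (rule less.hyps)
        show "card (I - {a}) < card I" using a fin(1) by (rule card_Diff1_less[rotated])
        show "finite (I - {a})" using fin(1) by simp
        show "finite (N i - {y})" if "i \<in> I - {a}" for i using fin(2) that by simp
        fix K assume K: "K \<subseteq> I - {a}"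
        show "card K \<le> card (\<Union>i\<in>K. N i - {y})"
        proof (cases "K = {}")
          case ne: False
          have "K \<subset> I" using K a by blast
          \<comment> \<open>No proper nonempty subset is tight, so the deletion of \<open>y\<close>
            leaves enough neighbours.\<close>
          then have "card K < card (\<Union>(N ` K))"
            using False hall[of K] ne by (metis le_neq_implies_less psubset_imp_subset)
          moreover have "(\<Union>i\<in>K. N i - {y}) = \<Union>(N ` K) - {y}" by blast
          moreover have "card (\<Union>(N ` K)) - 1 \<le> card (\<Union>(N ` K) - {y})" 
            using diff_card_le_card_Diff[of "{y}"] by simp
          ultimately show ?thesis by simp
        qed simp
      qed
      then obtain \<sigma> where \<sigma>: "inj_on \<sigma> (I - {a})" "\<And>i. i \<in> I - {a} \<Longrightarrow> \<sigma> i \<in> N i - {y}" by (elim exE conjE) simp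
      have "inj_on (\<sigma>(a := y)) I"
        using \<sigma> by (auto simp: inj_on_def)
      moreover have "\<forall>i\<in>I. (\<sigma>(a := y)) i \<in> N i" using \<sigma>(2) y by auto
      ultimately show ?thesis by blast
    qed simp
  qed
qed

section \<open>Empirical measures\<close>

abbreviation count_in :: "'a set \<Rightarrow> 'a list \<Rightarrow> nat" where
  "count_in U Xs \<equiv> length (filter (\<lambda>X. X \<in> U) Xs)"

context
  fixes E :: "'h::chilbert_space set"
  assumes E: "hilbert E"
begin

interpretation T: Metric_space "\<P> E" "thompson E"
  by (rule Metric_space_thompson[OF E])

lemma open_sets_Pow: "{U. openin T.mtopology U} \<subseteq> Pow (\<P> E)"
  using openin_subset[of T.mtopology] by auto

lemma space_borel_pos: "space (borel_pos E) = \<P> E"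
  unfolding borel_pos_def by (rule space_measure_of[OF open_sets_Pow])

lemma open_in_borel: "openin T.mtopology U \<Longrightarrow> U \<in> sets (borel_pos E)"
  unfolding borel_pos_def sets_measure_of[OF open_sets_Pow] by (rule sigma_sets.Basic) simp

lemma closed_in_borel:
  assumes "closedin T.mtopology U" shows "U \<in> sets (borel_pos E)"
proof -
  have "U = space (borel_pos E) - (\<P> E - U)"
    using closedin_subset[OF assms] by (auto simp: space_borel_pos)
  moreover have "openin T.mtopology (\<P> E - U)" using assms by (simp add: closedin_def)
  ultimately show ?thesis using open_in_borel by (metis sets.compl_sets)
qed

context
  fixes n :: nat and Xs :: "'h operator list"
  assumes n: "0 < n" and Xs: "Xs \<in> tuples n E"
begin

lemma length_Xs: "length Xs = n" and set_Xs: "set Xs \<subseteq> \<P> E"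
  using Xs by (auto simp: tuples_def)

lemma sets_empirical: "sets (empirical E Xs) = sets (borel_pos E)"
  unfolding empirical_def space_borel_pos[symmetric]
  by (simp add: sets.space_closed sets.sigma_sets_eq)

lemma space_empirical: "space (empirical E Xs) = \<P> E"
  using sets_eq_imp_space_eq[OF sets_empirical] by (simp add: space_borel_pos)

text \<open>\<open>measure_of\<close> takes the intended values only once countable additivity is
  verified; it is inherited from the point masses.\<close>

lemma emeasure_empirical:
  assumes "U \<in> sets (borel_pos E)"
  shows "emeasure (empirical E Xs) U = ennreal (real (count_in U Xs) / real n)"
proof -
  let ?b = "borel_pos E"
  let ?f = "\<lambda>U. (\<Sum>X\<leftarrow>Xs. emeasure (return ?b X) U) / of_nat (length Xs)"
  have f_eq: "?f U = (\<Sum>i<n. emeasure (return ?b (Xs ! i)) U) * inverse (of_nat n)" for U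
    by (simp add: sum_list_sum_nth length_Xs divide_ennreal_def atLeast0LessThan)
  have "emeasure (empirical E Xs) U = ?f U"
  proof (rule emeasure_measure_of[OF empirical_def])
    show "sets ?b \<subseteq> Pow (\<P> E)" using sets.space_closed[of ?b] by (simp add: space_borel_pos)
    show "positive (sets (empirical E Xs)) ?f"
      unfolding f_eq by (simp add: positive_def)
    show "countably_additive (sets (empirical E Xs)) ?f"
      unfolding f_eq sets_empirical countably_additive_def
    proof (intro allI impI)
      fix A :: "nat \<Rightarrow> 'h operator set"
      assume A: "range A \<subseteq> sets ?b" "disjoint_family A" "\<Union>(range A) \<in> sets ?b"
      have "(\<Sum>k. \<Sum>i<n. emeasure (return ?b (Xs ! i)) (A k)) = (\<Sum>i<n. emeasure (return ?b (Xs ! i)) (\<Union>(range A)))"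
        using A by (subst suminf_sum) (auto intro!: sum.cong suminf_emeasure simp del: emeasure_return)
      then show "(\<Sum>k. (\<Sum>i<n. emeasure (return ?b (Xs ! i)) (A k)) * inverse (of_nat n))
          = (\<Sum>i<n. emeasure (return ?b (Xs ! i)) (\<Union>(range A))) * inverse (of_nat n)"
        by (simp only: ennreal_suminf_multc)
    qed
    show "U \<in> sets (empirical E Xs)" using assms by (simp add: sets_empirical)
  qed
  also have "(\<Sum>X\<leftarrow>Xs. emeasure (return ?b X) U) = of_nat (count_in U Xs)"
    using assms by (induction Xs) (auto simp: indicator_def)
  also have "of_nat (count_in U Xs) / of_nat (length Xs) = ennreal (real (count_in U Xs) / real n)"
    using n by (simp add: length_Xs ennreal_of_nat_eq_real_of_nat divide_ennreal)
  finally show ?thesis .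
qed

lemma prob_space_empirical: "prob_space (empirical E Xs)"
proof
  have "count_in (\<P> E) Xs = n" using set_Xs length_Xs by (auto simp: filter_id_conv subset_iff)
  then show "emeasure (empirical E Xs) (space (empirical E Xs)) = 1"
    using n sets.top[of "borel_pos E"] by (simp add: emeasure_empirical space_empirical space_borel_pos)
qed

lemma closed_set_Xs: "closedin T.mtopology (set Xs)"
  using Hausdorff_imp_t1_space[OF T.Hausdorff_space_mtopology] set_Xs
  by (simp add: t1_space_closedin_finite)

lemma supp_empirical: "supp E (empirical E Xs) = set Xs"
proof
  show "set Xs \<subseteq> supp E (empirical E Xs)"
  proof
    fix X assume X: "X \<in> set Xs"
    have "0 < emeasure (empirical E Xs) U" if "openin T.mtopology U" "X \<in> U" for U
    proof -
      have "0 < count_in U Xs" using X that(2) by (auto simp: filter_empty_conv)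
      then show ?thesis using n by (simp add: emeasure_empirical open_in_borel[OF that(1)])
    qed
    then show "X \<in> supp E (empirical E Xs)" using X set_Xs by (auto simp: supp_def)
  qed
  show "supp E (empirical E Xs) \<subseteq> set Xs"
  proof
    fix Y assume Y: "Y \<in> supp E (empirical E Xs)"
    show "Y \<in> set Xs"
    proof (rule ccontr)
      assume "Y \<notin> set Xs"
      let ?U = "\<P> E - set Xs"
      have U: "openin T.mtopology ?U" using closed_set_Xs by (simp add: closedin_def)
      have "count_in ?U Xs = 0" by (auto simp: filter_empty_conv)
      then have "emeasure (empirical E Xs) ?U = 0" by (simp add: emeasure_empirical open_in_borel[OF U])
      moreover have "Y \<in> ?U" using Y \<open>Y \<notin> set Xs\<close> by (simp add: supp_def)
      ultimately show False using Y U unfolding supp_def by fastforce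
    qed
  qed
qed

lemma empirical_bounded: "empirical E Xs \<in> bounded_prob_measures E"
proof -
  have "count_in (set Xs) Xs = n" using length_Xs by (simp add: filter_id_conv)
  then have "emeasure (empirical E Xs) (supp E (empirical E Xs)) = 1"
    using n by (simp add: supp_empirical emeasure_empirical closed_in_borel[OF closed_set_Xs])
  moreover have "T.mbounded (supp E (empirical E Xs))"
  proof -
    obtain X where X: "X \<in> set Xs" using n length_Xs by (cases Xs) auto
    have "thompson E X Y \<le> Max (thompson E X ` set Xs)" if "Y \<in> set Xs" for Y
      using that by (intro Max_ge) auto
    then show ?thesis
      unfolding supp_empirical T.mbounded_def using X set_Xs
      by (intro exI[of _ X] exI[of _ "Max (thompson E X ` set Xs)"]) auto
  qed
  ultimately show ?thesis
    by (simp add: bounded_prob_measures_def prob_measures_def sets_empirical prob_space_empirical)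
qed

end

text \<open>If every ball around Z meets the cone, Z has arbitrarily close Y above X; since Y \<le>
  (1 + e) Z, the limit gives X \<le> Z.\<close>

lemma closed_upper_cone:
  assumes X: "X \<in> \<P> E"
  shows "closedin T.mtopology {Z \<in> \<P> E. X \<sqsubseteq>\<^sub>L Z}"
  unfolding T.closedin_metric
proof (intro conjI allI impI)
  fix Z assume Z: "Z \<in> \<P> E - {Z \<in> \<P> E. X \<sqsubseteq>\<^sub>L Z}"
  show "\<exists>r>0. disjnt {Z \<in> \<P> E. X \<sqsubseteq>\<^sub>L Z} (T.mball Z r)"
  proof (rule ccontr)
    assume no: "\<not> ?thesis"
    have "X \<sqsubseteq>\<^sub>L Z"
    proof (rule loewner_le_epsilon)
      fix e :: real assume e: "0 < e"
      then have "0 < ln (1 + e)" by simp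
      then obtain Y where Y: "Y \<in> \<P> E" "X \<sqsubseteq>\<^sub>L Y" "thompson E Z Y < ln (1 + e)"
        using no by (auto simp: disjnt_iff)
      have "Y \<sqsubseteq>\<^sub>L exp (ln (1 + e)) *\<^sub>R Z"
        using Z Y by (intro thompson_upper(2)[OF E]) auto
      then show "X \<sqsubseteq>\<^sub>L (1 + e) *\<^sub>R Z" using Y(2) e loewner_trans by simp
    qed
    then show False using Z by simp
  qed
qed auto

text \<open>The sets at which the stochastic order is tested in order to verify Hall's
  condition.\<close>

lemma closed_upper_hull:
  assumes "finite S" "S \<subseteq> \<P> E"
  shows "closedin T.mtopology {Z \<in> \<P> E. \<exists>X\<in>S. X \<sqsubseteq>\<^sub>L Z}" "upper_set E {Z \<in> \<P> E. \<exists>X\<in>S. X \<sqsubseteq>\<^sub>L Z}"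
proof -
  have "{Z \<in> \<P> E. \<exists>X\<in>S. X \<sqsubseteq>\<^sub>L Z} = (\<Union>X\<in>S. {Z \<in> \<P> E. X \<sqsubseteq>\<^sub>L Z})" by auto
  then show "closedin T.mtopology {Z \<in> \<P> E. \<exists>X\<in>S. X \<sqsubseteq>\<^sub>L Z}"
    using assms closed_upper_cone by (auto intro!: closedin_Union)
  show "upper_set E {Z \<in> \<P> E. \<exists>X\<in>S. X \<sqsubseteq>\<^sub>L Z}"
    unfolding upper_set_def using loewner_trans by blast
qed

lemma replicate_tuples: "Xs \<in> tuples n E \<Longrightarrow> concat (map (replicate k) Xs) \<in> tuples (n * k) E"
  by (auto simp: tuples_def length_concat o_def sum_list_triv)

lemma count_in_replicate: "count_in U (concat (map (replicate k) Xs)) = k * count_in U Xs"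
  by (induction Xs) (auto simp: filter_replicate)

text \<open>
  For uniform discrete measures, the stochastic order is a matching condition on the atoms
  after both tuples are repeated to a common length.
\<close>

lemma empirical_mono:
  assumes mean: "operator_mean F" and n: "0 < n" "0 < m" and Xs: "Xs \<in> tuples n E" and Ys: "Ys \<in> tuples m E"
    and le: "stoch_le E (empirical E Xs) (empirical E Ys)"
  shows "F n E Xs \<sqsubseteq>\<^sub>L F m E Ys"
proof -
  \<comment> \<open>A common length: repetition leaves the values and the atom frequencies
    unchanged.\<close>
  define N where "N = n * m"
  define Xs' where "Xs' = concat (map (replicate m) Xs)"
  define Ys' where "Ys' = concat (map (replicate n) Ys)"
  have N: "0 < N" using n by (simp add: N_def)
  have tup: "Xs' \<in> tuples N E" "Ys' \<in> tuples N E"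
    using replicate_tuples[OF Xs, of m] replicate_tuples[OF Ys, of n] by (simp_all add: Xs'_def Ys'_def N_def mult.commute)
  have len: "length Xs' = N" "length Ys' = N" and sub: "set Xs' \<subseteq> \<P> E" "set Ys' \<subseteq> \<P> E"
    using tup by (auto simp: tuples_def)
  have mono: "operator_monotone N (F N)"
    using conjunct1[OF mean[unfolded operator_mean_def]] N by simp
  have perm: "\<And>Zs \<sigma>. Zs \<in> tuples N E \<Longrightarrow> \<sigma> permutes {..<N} \<Longrightarrow> F N E (permute_list \<sigma> Zs) = F N E Zs"
    using conjunct1[OF conjunct2[OF mean[unfolded operator_mean_def]]] N E by simp
  have repl: "\<And>n k Zs. 0 < n \<Longrightarrow> 0 < k \<Longrightarrow> Zs \<in> tuples n E \<Longrightarrow> F (n * k) E (concat (map (replicate k) Zs)) = F n E Zs"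
    using conjunct2[OF conjunct2[OF mean[unfolded operator_mean_def]]] E by simp
  have FX: "F N E Xs' = F n E Xs" and FY: "F N E Ys' = F m E Ys"
    using repl[OF n(1) n(2) Xs] repl[OF n(2) n(1) Ys] by (simp_all add: N_def Xs'_def Ys'_def mult.commute)
  have counts: "count_in U Xs' \<le> count_in U Ys'" if U: "closedin T.mtopology U" "upper_set E U" for U
  proof -
    have "emeasure (empirical E Xs) U \<le> emeasure (empirical E Ys) U"
      using le U unfolding stoch_le_def by blast
    then have "ennreal (real (count_in U Xs) / real n) \<le> ennreal (real (count_in U Ys) / real m)"
      by (simp only: emeasure_empirical[OF n(1) Xs closed_in_borel[OF U(1)]]
          emeasure_empirical[OF n(2) Ys closed_in_borel[OF U(1)]])
    then have "real (m * count_in U Xs) \<le> real (n * count_in U Ys)"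
      using n by (simp add: field_simps)
    then show ?thesis unfolding Xs'_def Ys'_def count_in_replicate of_nat_le_iff .
  qed
  let ?N = "\<lambda>i. {j. j < N \<and> Xs' ! i \<sqsubseteq>\<^sub>L Ys' ! j}"
  have "\<exists>\<sigma>. inj_on \<sigma> {..<N} \<and> (\<forall>i\<in>{..<N}. \<sigma> i \<in> ?N i)"
  proof (rule hall_marriage)
    fix J assume J: "J \<subseteq> {..<N}"
    let ?S = "(!) Xs' ` J"
    \<comment> \<open>The upper hull of the atoms indexed by J. It contains these atoms, and the
      atoms of \<open>Ys'\<close> in it are exactly the neighbours of J.\<close>
    let ?U = "{Z \<in> \<P> E. \<exists>X\<in>?S. X \<sqsubseteq>\<^sub>L Z}"
    have S: "finite ?S" "?S \<subseteq> \<P> E" using J sub len finite_subset[OF J] by (auto intro!: subsetD[OF sub(1)] nth_mem)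
    have "card J \<le> card {i. i < length Xs' \<and> Xs' ! i \<in> ?U}"
    proof (rule card_mono)
      show "J \<subseteq> {i. i < length Xs' \<and> Xs' ! i \<in> ?U}"
      proof
        fix i assume i: "i \<in> J"
        then have "Xs' ! i \<in> ?U" using S(2) loewner_refl[of "Xs' ! i"] by blast
        then show "i \<in> {i. i < length Xs' \<and> Xs' ! i \<in> ?U}" using i J len by blast
      qed
    qed simp
    also have "\<dots> = count_in ?U Xs'" by (rule length_filter_conv_card[symmetric])
    also have "\<dots> \<le> count_in ?U Ys'" using closed_upper_hull[OF S] by (rule counts)
    also have "\<dots> = card {j. j < length Ys' \<and> Ys' ! j \<in> ?U}" by (rule length_filter_conv_card)
    also have "\<dots> \<le> card (\<Union>(?N ` J))"
      using len by (intro card_mono) (auto intro!: finite_subset[of _ "{..<N}"])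
    finally show "card J \<le> card (\<Union>(?N ` J))" .
  qed auto
  then obtain \<sigma> where \<sigma>: "inj_on \<sigma> {..<N}" "\<And>i. i < N \<Longrightarrow> \<sigma> i < N \<and> Xs' ! i \<sqsubseteq>\<^sub>L Ys' ! \<sigma> i" by auto
  \<comment> \<open>Extended by the identity, as \<open>permutes\<close> prescribes the values
    outside the index set as well.\<close>
  let ?\<sigma> = "\<lambda>i. if i < N then \<sigma> i else i"
  have "bij_betw \<sigma> {..<N} {..<N}"
    using \<sigma> by (intro bij_betw_imageI endo_inj_surj) auto
  then have "bij_betw ?\<sigma> {..<N} {..<N}" by (rule bij_betw_cong[THEN iffD1, rotated]) simp
  then have "?\<sigma> permutes {..<N}" by (rule bij_imp_permutes) simp
  from perm[OF tup(2) this] have FY': "F N E (permute_list ?\<sigma> Ys') = F N E Ys'" .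
  have le': "list_all2 loewner_le Xs' (permute_list ?\<sigma> Ys')"
    using \<sigma>(2) len by (auto simp: list_all2_conv_all_nth permute_list_def)
  have "permute_list ?\<sigma> Ys' \<in> tuples N E"
    using \<sigma>(2) len sub(2) by (auto simp: tuples_def permute_list_def intro!: subsetD[OF sub(2)] nth_mem)
  from mono[unfolded operator_monotone_def, rule_format, OF E tup(1) this le']
  have "F N E Xs' \<sqsubseteq>\<^sub>L F N E Ys'" by (simp only: FY')
  then show ?thesis by (simp only: FX FY)
qed

end

section \<open>Approximation of measures of bounded support\<close>

lemma norm_le_of_loewner:
  assumes E: "hilbert E" and A: "A \<in> bounded_ops E E" "selfadj A" and c: "0 \<le> c"
    and le: "(- c) *\<^sub>R id_op E \<sqsubseteq>\<^sub>L A" "A \<sqsubseteq>\<^sub>L c *\<^sub>R id_op E"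
  shows "norm A \<le> c"
proof -
  have "norm (poly_op E [:0, 1:] A) \<le> c"
  proof (rule norm_poly_op_le[OF E A c])
    fix t assume "t \<in> real_spectrum E A"
    then have "- c \<le> t" "t \<le> c" using spectrum_bounds[OF E A le] by auto
    then show "\<bar>poly [:0, 1:] t\<bar> \<le> c" by simp
  qed
  then show ?thesis by (simp add: poly_op_X[OF E A(1)])
qed

context
  fixes E :: "'h::chilbert_space set"
  assumes E: "hilbert E"
begin

interpretation T: Metric_space "\<P> E" "thompson E"
  by (rule Metric_space_thompson[OF E])

context
  fixes \<mu> :: "'h operator measure"
  assumes \<mu>: "\<mu> \<in> bounded_prob_measures E"
begin

lemma bounded_prob_props:
  shows "sets \<mu> = sets (borel_pos E)" "prob_space \<mu>" "emeasure \<mu> (supp E \<mu>) = 1" "T.mbounded (supp E \<mu>)"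
    "supp E \<mu> \<subseteq> \<P> E" "space \<mu> = \<P> E"
proof -
  show "sets \<mu> = sets (borel_pos E)" "prob_space \<mu>" "emeasure \<mu> (supp E \<mu>) = 1" "T.mbounded (supp E \<mu>)"
    using \<mu> by (auto simp: bounded_prob_measures_def prob_measures_def)
  then show "space \<mu> = \<P> E" using sets_eq_imp_space_eq space_borel_pos[OF E] by metis
  show "supp E \<mu> \<subseteq> \<P> E" by (auto simp: supp_def)
qed

interpretation prob_space \<mu> by (rule bounded_prob_props(2))

lemma supp_sets: "supp E \<mu> \<in> sets \<mu>"
  using emeasure_notin_sets[of "supp E \<mu>" \<mu>] bounded_prob_props(3) by (metis zero_neq_one)

lemma prob_supp: "prob (supp E \<mu>) = 1"
  using bounded_prob_props(3) by (simp add: measure_def)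

lemma open_sets: "openin T.mtopology U \<Longrightarrow> U \<in> sets \<mu>"
  using open_in_borel[OF E] bounded_prob_props(1) by simp

lemma closed_sets: "closedin T.mtopology U \<Longrightarrow> U \<in> sets \<mu>"
  using closed_in_borel[OF E] bounded_prob_props(1) by simp

lemma supp_order_bounds:
  obtains m M where "0 < m" "m < M" "\<And>X. X \<in> supp E \<mu> \<Longrightarrow> m *\<^sub>R id_op E \<sqsubseteq>\<^sub>L X"
    "\<And>X. X \<in> supp E \<mu> \<Longrightarrow> X \<sqsubseteq>\<^sub>L M *\<^sub>R id_op E"
proof -
  obtain X0 where X0: "X0 \<in> supp E \<mu>" using prob_supp by fastforce
  obtain C B where CB: "supp E \<mu> \<subseteq> T.mcball C B" using bounded_prob_props(4) by (auto simp: T.mbounded_def)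
  then have C: "C \<in> \<P> E" using X0 by auto
  obtain a where a: "0 < a" "a *\<^sub>R id_op E \<sqsubseteq>\<^sub>L C" by (rule pos_ops_lower[OF E C])
  obtain b where b: "0 < b" "C \<sqsubseteq>\<^sub>L b *\<^sub>R id_op E" by (rule pos_ops_upper[OF E C])
  define m where "m = a / exp B"
  \<comment> \<open>The summand m makes m < M strict.\<close>
  define M where "M = exp B * b + m"
  have m: "0 < m" using a by (simp add: m_def)
  show thesis
  proof (rule that[OF m])
    show "m < M" using b by (simp add: M_def)
    fix X assume "X \<in> supp E \<mu>"
    then have X: "X \<in> \<P> E" "thompson E C X \<le> B" using CB by auto
    note up = thompson_upper[OF E C X]
    have "a *\<^sub>R id_op E \<sqsubseteq>\<^sub>L exp B *\<^sub>R X" using loewner_trans[OF a(2) up(1)] .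
    from loewner_scaleR_mono[OF this, of "1 / exp B"] show "m *\<^sub>R id_op E \<sqsubseteq>\<^sub>L X" by (simp add: m_def)
    have "X \<sqsubseteq>\<^sub>L (exp B * b) *\<^sub>R id_op E"
      using loewner_trans[OF up(2) loewner_scaleR_mono[OF b(2), of "exp B"]] by simp
    also have "\<dots> \<sqsubseteq>\<^sub>L M *\<^sub>R id_op E"
      by (rule scaleR_pos_mono[OF pos_opsD(4)[OF E id_op_pos[OF E]]]) (use m in \<open>simp add: M_def\<close>)
    finally show "X \<sqsubseteq>\<^sub>L M *\<^sub>R id_op E" .
  qed
qed

text \<open>
  A maximal \<open>r\<close>-separated subset of the support is countable, since the balls of radius \<open>r / 2\<close>
  around its points are disjoint and have positive measure.
\<close>

lemma finite_cover:
  assumes r: "0 < r" and d: "0 < d"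
  obtains c :: "nat \<Rightarrow> 'h operator" and N where "\<And>i. c i \<in> supp E \<mu>" "1 - d < prob (\<Union>i<N. T.mball (c i) r)"
proof -
  let ?S = "supp E \<mu>"
  let ?A = "{D. D \<subseteq> ?S \<and> pairwise (\<lambda>x y. r \<le> thompson E x y) D}"
  have "\<exists>M\<in>?A. \<forall>X\<in>?A. M \<subseteq> X \<longrightarrow> X = M"
  proof (rule subset_Zorn')
    fix C assume C: "subset.chain ?A C"
    have "pairwise (\<lambda>x y. r \<le> thompson E x y) (\<Union>C)"
      unfolding pairwise_def
    proof (intro ballI impI)
      fix a b assume "a \<in> \<Union>C" "b \<in> \<Union>C" and ne: "a \<noteq> b"
      then obtain X Y where XY: "X \<in> C" "Y \<in> C" "a \<in> X" "b \<in> Y" by blast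
      then have "X \<subseteq> Y \<or> Y \<subseteq> X" using C by (auto simp: subset_chain_def)
      then obtain Z where Z: "Z \<in> C" "a \<in> Z" "b \<in> Z" using XY by blast
      have "pairwise (\<lambda>x y. r \<le> thompson E x y) Z" using C Z(1) by (auto simp: subset_chain_def)
      then show "r \<le> thompson E a b" using Z(2,3) ne by (auto simp: pairwise_def)
    qed
    moreover have "\<Union>C \<subseteq> ?S" using C by (auto simp: subset_chain_def)
    ultimately show "\<Union>C \<in> ?A" by blast
  qed
  then obtain D where "D \<in> ?A" and max: "\<forall>X\<in>?A. D \<subseteq> X \<longrightarrow> X = D" by (elim bexE)
  then have D: "D \<subseteq> ?S" "pairwise (\<lambda>x y. r \<le> thompson E x y) D" by simp_all
  have DP: "x \<in> \<P> E" if "x \<in> D" for x using that D(1) bounded_prob_props(5) by blast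
  have cover: "\<exists>x\<in>D. y \<in> T.mball x r" if y: "y \<in> ?S" for y
  proof (rule ccontr)
    assume no: "\<not> ?thesis"
    have yP: "y \<in> \<P> E" using y bounded_prob_props(5) by blast
    have far: "r \<le> thompson E x y" "r \<le> thompson E y x" if "x \<in> D" for x
      using no that DP yP T.commute by (auto simp: not_less)
    have "insert y D \<in> ?A" using D y far by (auto simp: pairwise_insert)
    then have "y \<in> D" using max by blast
    then have "y \<in> T.mball y r" using r yP by simp
    then show False using no \<open>y \<in> D\<close> by blast
  qed
  have "D \<noteq> {}" using cover prob_supp by fastforce
  let ?f = "\<lambda>x. prob (T.mball x (r / 2))"
  have "?f summable_on D"
  proof (rule nonneg_bdd_above_summable_on)
    show "bdd_above (sum ?f ` {F. F \<subseteq> D \<and> finite F})"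
    proof (rule bdd_aboveI2)
      fix F assume F: "F \<in> {F. F \<subseteq> D \<and> finite F}"
      have "disjoint_family_on (\<lambda>x. T.mball x (r / 2)) F"
        unfolding disjoint_family_on_def
      proof (intro ballI impI)
        fix x y assume "x \<in> F" "y \<in> F" "x \<noteq> y"
        then have "r / 2 + r / 2 \<le> thompson E x y" using D(2) F by (auto simp: pairwise_def)
        then show "T.mball x (r / 2) \<inter> T.mball y (r / 2) = {}" using T.disjoint_mball by (simp add: disjnt_def)
      qed
      then have "sum ?f F = prob (\<Union>x\<in>F. T.mball x (r / 2))"
        using F open_sets by (intro finite_measure_finite_Union[symmetric]) auto
      then show "sum ?f F \<le> 1" by simp
    qed
  qed simp
  \<comment> \<open>A summable family has only countably many nonzero terms; all terms here are
    nonzero because D lies in the support.\<close>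
  then have "countable {x \<in> D. ?f x \<noteq> 0}" by (rule summable_countable_real)
  moreover have "?f x \<noteq> 0" if "x \<in> D" for x
  proof -
    have "x \<in> ?S" using that D(1) by blast
    moreover have "x \<in> T.mball x (r / 2)" using DP[OF that] r by simp
    ultimately have "0 < emeasure \<mu> (T.mball x (r / 2))" unfolding supp_def by blast
    then show ?thesis by (simp add: emeasure_eq_measure)
  qed
  ultimately have "countable D" by (metis (mono_tags, lifting) Collect_cong Collect_mem_eq)
  define c where "c = from_nat_into D"
  have c: "range c = D" using \<open>D \<noteq> {}\<close> \<open>countable D\<close> by (simp add: c_def range_from_nat_into)
  let ?U = "\<lambda>N. \<Union>i<N. T.mball (c i) r"
  have U: "?U N \<in> sets \<mu>" for N by (intro sets.finite_UN open_sets) auto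
  have "(\<lambda>N. prob (?U N)) \<longlonglongrightarrow> prob (\<Union>N. ?U N)"
    using U by (intro finite_Lim_measure_incseq) (auto simp: incseq_def intro: less_le_trans)
  moreover have "prob (\<Union>N. ?U N) = 1"
  proof (rule antisym)
    have "?S \<subseteq> (\<Union>N. ?U N)"
    proof
      fix y assume "y \<in> ?S"
      then obtain x where "x \<in> D" "y \<in> T.mball x r" using cover by blast
      then obtain i where "y \<in> T.mball (c i) r" using c by (metis imageE)
      then show "y \<in> (\<Union>N. ?U N)" by blast
    qed
    then have "prob ?S \<le> prob (\<Union>N. ?U N)" using U by (intro finite_measure_mono) auto
    then show "1 \<le> prob (\<Union>N. ?U N)" by (simp add: prob_supp)
  qed simp
  ultimately have "\<forall>\<^sub>F N in sequentially. 1 - d < prob (?U N)"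
    using d by (intro order_tendstoD) auto
  then obtain N where "1 - d < prob (?U N)" by (meson eventually_sequentially order_refl)
  moreover have "c i \<in> ?S" for i using c D(1) by blast
  ultimately show thesis using that by blast
qed

text \<open>The balls of the finite cover are made disjoint and intersected with the support; the
  intersection loses no mass, as the complement of the support is a null set.\<close>

lemma finite_partition:
  assumes r: "0 < r" and d: "0 < d"
  obtains c :: "nat \<Rightarrow> 'h operator" and P :: "nat \<Rightarrow> 'h operator set" and N where
    "\<And>i. c i \<in> supp E \<mu>" "\<And>i. P i \<in> sets \<mu>" "disjoint_family P"
    "\<And>i X. X \<in> P i \<Longrightarrow> X \<in> supp E \<mu> \<and> thompson E (c i) X < r" "1 - d < (\<Sum>i<N. prob (P i))"
proof -
  obtain c :: "nat \<Rightarrow> 'h operator" and N where c: "\<And>i. c i \<in> supp E \<mu>" "1 - d < prob (\<Union>i<N. T.mball (c i) r)"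
    by (rule finite_cover[OF r d]) (rule that)
  define A where "A i = T.mball (c i) r \<inter> supp E \<mu>" for i
  have A: "A i \<in> sets \<mu>" for i unfolding A_def using open_sets supp_sets by blast
  show thesis
  proof (rule that[of c "disjointed A" N])
    show D: "disjointed A i \<in> sets \<mu>" for i using sets.range_disjointed_sets[of A \<mu>] A by blast
    show dis: "disjoint_family (disjointed A)" by (rule disjoint_family_disjointed)
    show "X \<in> supp E \<mu> \<and> thompson E (c i) X < r" if "X \<in> disjointed A i" for i X
      using disjointed_subset[of A i] that by (auto simp: A_def)
    have "(\<Sum>i<N. prob (disjointed A i)) = prob (\<Union>i<N. disjointed A i)"
      using D dis by (intro finite_measure_finite_Union[symmetric]) (auto simp: disjoint_family_on_def)
    also have "(\<Union>i<N. disjointed A i) = (\<Union>i<N. T.mball (c i) r) \<inter> supp E \<mu>"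
      using finite_UN_disjointed_eq[of A N] by (auto simp: A_def atLeast0LessThan)
    also have "prob \<dots> = prob (\<Union>i<N. T.mball (c i) r)"
    proof -
      let ?A = "\<Union>i<N. T.mball (c i) r"
      have A: "?A \<in> sets \<mu>" by (intro sets.finite_UN open_sets) auto
      have "prob (?A - supp E \<mu>) \<le> prob (space \<mu> - supp E \<mu>)"
        using A supp_sets sets.sets_into_space[OF A] by (intro finite_measure_mono) auto
      then have "prob (?A - supp E \<mu>) = 0"
        using prob_compl[OF supp_sets] prob_supp measure_nonneg[of \<mu> "?A - supp E \<mu>"] by simp
      then show ?thesis using finite_measure_Diff'[OF A supp_sets] by simp
    qed
    finally show "1 - d < (\<Sum>i<N. prob (disjointed A i))" using c(2) by simp
  qed (rule c(1))
qed

text \<open>A piece of mass w near a centre is replaced by floor (n w) copies of the centre, scaled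
  down by exp (- r) on one side and up by exp r on the other. The atoms left over by rounding and by
  the uncovered mass go to m and to M.\<close>

lemma order_approximation:
  assumes inf: "\<not> (\<exists>B :: 'h set. finite B \<and> span B = UNIV)" and mean: "operator_mean F" and e: "0 < e"
  obtains n Xs Ys where "0 < n" "Xs \<in> tuples n E" "Ys \<in> tuples n E"
    "stoch_le E (empirical E Xs) \<mu>" "stoch_le E \<mu> (empirical E Ys)" "F n E Ys \<sqsubseteq>\<^sub>L (1 + e) *\<^sub>R F n E Xs"
proof -
  let ?S = "supp E \<mu>" and ?I = "\<lambda>r::real. r *\<^sub>R id_op E"
  obtain m0 M where m0: "0 < m0" "m0 < M" and S: "\<And>X. X \<in> ?S \<Longrightarrow> ?I m0 \<sqsubseteq>\<^sub>L X" "\<And>X. X \<in> ?S \<Longrightarrow> X \<sqsubseteq>\<^sub>L ?I M"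
    using supp_order_bounds by metis
  have SP: "X \<in> \<P> E" if "X \<in> ?S" for X using that bounded_prob_props(5) by blast
  \<comment> \<open>Room for the lowered centres: they lie above exp (- r) m0, and r \<le>
    1.\<close>
  define m where "m = m0 / exp 1"
  have "m \<le> m0" using m0(1) one_le_exp_iff[of "1::real"] by (simp add: m_def pos_divide_le_eq)
  then have m: "0 < m" "m \<le> m0" "m < M" using m0 by (auto simp: m_def)
  have IP: "?I s \<in> \<P> E" if "0 < s" for s by (rule scaleR_pos[OF E id_op_pos[OF E] that])
  have Imono: "?I s \<sqsubseteq>\<^sub>L ?I s'" if "s \<le> s'" for s s'
    by (rule scaleR_pos_mono[OF pos_opsD(4)[OF E id_op_pos[OF E]] that])
  define C where "C = 4 * M\<^sup>2 / m\<^sup>2"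
  have C: "0 \<le> C" by (simp add: C_def)
  \<comment> \<open>The scaling between upper and lower atoms is exp (2 r), which uses at most half
    of ln (1 + e).\<close>
  define r where "r = min 1 (ln (1 + e) / 4)"
  have r: "0 < r" "r \<le> 1" "4 * r \<le> ln (1 + e)" using e by (auto simp: r_def)
  \<comment> \<open>The fraction of leftover atoms will be at most 2 d, and C 2 d uses at most the
    other half of ln (1 + e).\<close>
  define d where "d = ln (1 + e) / (4 * (C + 1))"
  have d: "0 < d" using e C by (simp add: d_def)
  have dC: "2 * d * C \<le> ln (1 + e) / 2"
  proof -
    have "4 * d * C \<le> 4 * d * (C + 1)" using d by simp
    also have "\<dots> = d * (4 * (C + 1))" by simp
    also have "\<dots> = ln (1 + e)"
      unfolding d_def by (rule nonzero_divide_eq_eq[THEN iffD1, OF _ refl, symmetric]) (use C in simp)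
    finally show ?thesis by simp
  qed
  obtain c :: "nat \<Rightarrow> 'h operator" and P :: "nat \<Rightarrow> 'h operator set" and N where
    c: "\<And>i. c i \<in> ?S" and P: "\<And>i. P i \<in> sets \<mu>" "disjoint_family P"
      "\<And>i X. X \<in> P i \<Longrightarrow> X \<in> ?S \<and> thompson E (c i) X < r" and Pd: "1 - d < (\<Sum>i<N. prob (P i))"
    by (rule finite_partition[OF r(1) d]) (rule that)
  define w where "w i = prob (P i)" for i
  \<comment> \<open>Rounding down loses at most one atom for each of the N pieces, so this n keeps
    the rounding loss at a fraction of at most d.\<close>
  obtain n where n: "real N / d < real n" using reals_Archimedean2 by blast
  have n0: "0 < n" using n d by (metis divide_nonneg_pos not_less_zero of_nat_0 of_nat_0_le_iff gr0I order_less_irrefl order_le_less_trans)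
  define k where "k i = nat \<lfloor>real n * w i\<rfloor>" for i
  have k: "real (k i) \<le> real n * w i" "real n * w i - 1 < real (k i)" for i
    by (simp_all add: k_def w_def)
  \<comment> \<open>The indices of the pieces with multiplicity. Both tuples are built on this one
    list, so they can be compared coordinatewise.\<close>
  define L where "L = concat (map (\<lambda>i. replicate (k i) i) [0..<N])"
  have count_L: "length (filter Q L) = (\<Sum>i | i < N \<and> Q i. k i)" for Q
  proof -
    have "length (filter Q (concat (map (\<lambda>i. replicate (k i) i) [0..<N']))) = (\<Sum>i<N'. if Q i then k i else 0)" for N'
      by (induction N') auto
    then show ?thesis
      unfolding L_def by (simp add: sum.If_cases Int_def conj_commute lessThan_def)
  qed
  have len_L: "length L = (\<Sum>i<N. k i)"
    using count_L[of "\<lambda>_. True"] by (simp add: lessThan_def)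
  have union: "(\<Sum>i\<in>J. w i) = prob (\<Union>i\<in>J. P i)" if "finite J" for J
    unfolding w_def using that P(1,2) by (intro finite_measure_finite_Union[symmetric]) (auto simp: disjoint_family_on_def)
  have k_le: "real (\<Sum>i\<in>J. k i) \<le> real n * prob (\<Union>i\<in>J. P i)" if "finite J" for J
  proof -
    have "real (\<Sum>i\<in>J. k i) \<le> (\<Sum>i\<in>J. real n * w i)" unfolding of_nat_sum by (intro sum_mono k)
    then show ?thesis by (simp add: sum_distrib_left[symmetric] union[OF that])
  qed
  have L_le: "length L \<le> n"
  proof -
    have "real (length L) \<le> real n * 1"
      unfolding len_L using k_le[of "{..<N}"] prob_le_1[of "\<Union>i<N. P i"] by (meson finite_lessThan mult_left_mono of_nat_0_le_iff order_trans)
    then show ?thesis by simp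
  qed
  define q where "q = n - length L"
  have nq: "length L + q = n" using L_le by (simp add: q_def)
  have q_small: "real q / real n \<le> 2 * d"
  proof -
    have "real n * (1 - d) - real N \<le> real n * (\<Sum>i<N. w i) - real N"
      using Pd by (intro diff_right_mono mult_left_mono) (auto simp: w_def)
    also have "\<dots> = (\<Sum>i<N. real n * w i - 1)" by (simp add: sum_subtractf sum_distrib_left)
    also have "\<dots> \<le> (\<Sum>i<N. real (k i))" by (intro sum_mono less_imp_le k)
    also have "\<dots> = real n - real q" using nq len_L by (metis add_diff_cancel_right' of_nat_add of_nat_sum)
    finally have "real q \<le> real n * d + real N" by (simp add: algebra_simps)
    moreover have "real N \<le> real n * d" using n d by (simp add: field_simps)
    ultimately show ?thesis using n0 by (simp add: field_simps)
  qed
  define lo where "lo i = exp (- r) *\<^sub>R c i" for i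
  define up where "up i = exp r *\<^sub>R c i" for i
  have loP: "lo i \<in> \<P> E" and upP: "up i \<in> \<P> E" for i
    using SP[OF c] by (auto simp: lo_def up_def intro!: scaleR_pos[OF E])
  have up_lo: "up i = exp (2 * r) *\<^sub>R lo i" for i by (simp add: up_def lo_def exp_add[symmetric])
  have lo_bounds: "?I m \<sqsubseteq>\<^sub>L lo i" "lo i \<sqsubseteq>\<^sub>L ?I M" for i
  proof -
    have "?I m \<sqsubseteq>\<^sub>L ?I (exp (- r) * m0)"
    proof (rule Imono)
      have "exp (- 1) \<le> exp (- r)" using r by simp
      then show "m \<le> exp (- r) * m0" using m0(1) by (simp add: m_def exp_minus field_simps)
    qed
    also have "\<dots> \<sqsubseteq>\<^sub>L lo i" using loewner_scaleR_mono[OF S(1)[OF c[of i]], of "exp (- r)"] by (simp add: lo_def)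
    finally show "?I m \<sqsubseteq>\<^sub>L lo i" .
    have "lo i \<sqsubseteq>\<^sub>L 1 *\<^sub>R c i"
      unfolding lo_def using r by (intro scaleR_pos_mono[OF pos_opsD(4)[OF E SP[OF c]]]) auto
    also have "1 *\<^sub>R c i \<sqsubseteq>\<^sub>L ?I M" using S(2)[OF c] by simp
    finally show "lo i \<sqsubseteq>\<^sub>L ?I M" .
  qed
  have lo_P: "lo i \<sqsubseteq>\<^sub>L X" and P_up: "X \<sqsubseteq>\<^sub>L up i" if X: "X \<in> P i" for i X
  proof -
    have "X \<in> \<P> E" "thompson E (c i) X \<le> r" using P(3)[OF X] SP by auto
    note t = thompson_upper[OF E SP[OF c] this]
    show "X \<sqsubseteq>\<^sub>L up i" unfolding up_def by (rule t(2))
    from loewner_scaleR_mono[OF t(1), of "exp (- r)"] show "lo i \<sqsubseteq>\<^sub>L X" by (simp add: lo_def exp_minus)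
  qed
  define Xs where "Xs = map lo L @ replicate q (?I m)"
  define Ys where "Ys = map up L @ replicate q (?I M)"
  have Xs: "Xs \<in> tuples n E" and Ys: "Ys \<in> tuples n E"
    using nq loP upP IP[OF m(1)] IP[of M] m by (auto simp: tuples_def Xs_def Ys_def)
  have setsU: "U \<in> sets (borel_pos E)" "U \<in> sets \<mu>" if "closedin T.mtopology U" for U
    using closed_in_borel[OF E that] closed_sets[OF that] by auto
  have lower: "stoch_le E (empirical E Xs) \<mu>"
    unfolding stoch_le_def
  proof (intro allI impI)
    fix U assume U: "closedin T.mtopology U \<and> upper_set E U"
    have up: "Y \<in> U" if "X \<in> U" "Y \<in> \<P> E" "X \<sqsubseteq>\<^sub>L Y" for X Y using U that unfolding upper_set_def by blast
    \<comment> \<open>If m is in U, then U contains the support and has mass 1. Otherwise only the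
      atoms \<open>lo i\<close> count, and \<open>lo i\<close> in U puts the whole piece
      \<open>P i\<close> into U.\<close>
    have "real (count_in U Xs) \<le> real n * prob U"
    proof (cases "?I m \<in> U")
      case True
      have "?S \<subseteq> U"
        using up[OF True SP] S(1) loewner_trans[OF Imono[OF m(2)]] by blast
      then have "prob ?S \<le> prob U" using setsU U by (intro finite_measure_mono) auto
      then have "prob U = 1" using prob_supp prob_le_1[of U] by simp
      moreover have "count_in U Xs \<le> n" using Xs length_filter_le[of _ Xs] by (auto simp: tuples_def)
      ultimately show ?thesis by simp
    next
      case False
      let ?J = "{i. i < N \<and> lo i \<in> U}"
      have "count_in U Xs = (\<Sum>i\<in>?J. k i)"
        using False by (simp add: Xs_def filter_map o_def count_L filter_replicate)
      also have "real \<dots> \<le> real n * prob (\<Union>i\<in>?J. P i)" by (rule k_le) simp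
      also have "\<dots> \<le> real n * prob U"
      proof (intro mult_left_mono finite_measure_mono)
        show "(\<Union>i\<in>?J. P i) \<subseteq> U" using up[OF _ SP lo_P] P(3) by blast
      qed (use setsU U in auto)
      finally show ?thesis .
    qed
    then have "real (count_in U Xs) / real n \<le> prob U" using n0 by (simp add: field_simps)
    then show "emeasure (empirical E Xs) U \<le> emeasure \<mu> U"
      using U by (simp add: emeasure_empirical[OF E n0 Xs setsU(1)] emeasure_eq_measure ennreal_leI)
  qed
  have upper: "stoch_le E \<mu> (empirical E Ys)"
    unfolding stoch_le_def
  proof (intro allI impI)
    fix U assume U: "closedin T.mtopology U \<and> upper_set E U"
    have up: "Y \<in> U" if "X \<in> U" "Y \<in> \<P> E" "X \<sqsubseteq>\<^sub>L Y" for X Y using U that unfolding upper_set_def by blast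
    have Um: "U \<in> sets \<mu>" using setsU U by blast
    \<comment> \<open>If M is not in U, then U misses the support. Otherwise the complement is
      counted: the pieces with \<open>up i\<close> outside U are disjoint from U, so their mass is
      at most 1 - prob U.\<close>
    have "real n * prob U \<le> real (count_in U Ys)"
    proof (cases "?I M \<in> U")
      case False
      have "U \<inter> ?S = {}" using up[OF _ IP S(2)] False m by fastforce
      then have "prob U + prob ?S = prob (U \<union> ?S)" using Um supp_sets by (intro finite_measure_Union[symmetric]) auto
      then have "prob U = 0" using prob_supp prob_le_1[of "U \<union> ?S"] measure_nonneg[of \<mu> U] by linarith
      then show ?thesis by simp
    next
      case True
      let ?J = "{i. i < N \<and> up i \<notin> U}"
      have "count_in U Ys = length (filter (\<lambda>i. up i \<in> U) L) + q"
        using True by (simp add: Ys_def filter_map o_def filter_replicate)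
      moreover have "length (filter (\<lambda>i. up i \<in> U) L) + length (filter (\<lambda>i. up i \<notin> U) L) = length L"
        by (rule sum_length_filter_compl)
      ultimately have "count_in U Ys + (\<Sum>i\<in>?J. k i) = n" using nq by (simp add: count_L)
      then have "real (count_in U Ys) = real n - real (\<Sum>i\<in>?J. k i)" by linarith
      moreover have "real (\<Sum>i\<in>?J. k i) \<le> real n * prob (\<Union>i\<in>?J. P i)" by (rule k_le) simp
      moreover have "prob U + prob (\<Union>i\<in>?J. P i) \<le> 1"
      proof -
        have "X \<notin> U" if "i \<in> ?J" "X \<in> P i" for i X using up[OF _ upP P_up[OF that(2)]] that(1) by blast
        then have "U \<inter> (\<Union>i\<in>?J. P i) = {}" by blast
        then have "prob U + prob (\<Union>i\<in>?J. P i) = prob (U \<union> (\<Union>i\<in>?J. P i))"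
          using Um P(1) by (intro finite_measure_Union[symmetric] sets.finite_UN) auto
        then show ?thesis by simp
      qed
      then have "real n * (prob U + prob (\<Union>i\<in>?J. P i)) \<le> real n * 1" by (intro mult_left_mono) auto
      ultimately show ?thesis by (simp add: distrib_left)
    qed
    then have "prob U \<le> real (count_in U Ys) / real n" using n0 by (simp add: field_simps)
    then show "emeasure \<mu> U \<le> emeasure (empirical E Ys) U"
      using U by (simp add: emeasure_empirical[OF E n0 Ys setsU(1)] emeasure_eq_measure ennreal_leI)
  qed
  have "F n E Ys \<sqsubseteq>\<^sub>L (1 + e) *\<^sub>R F n E Xs"
  proof -
    interpret symmetric_mean E n "\<lambda>x. F n E (map x [0..<n])"
      by (rule operator_mean_symmetric_mean[OF inf mean E n0])
    let ?R = "{length L..<n}"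
    have R: "?R \<subseteq> {..<n}" "card ?R = q" using nq by auto
    \<comment> \<open>The lower tuple as a function of the index. The upper atoms may exceed M, so
      they enter \<open>comparison\<close> as exp (2 r) times the lower ones, which stay between m
      and M.\<close>
    define v where "v i = (if i < length L then lo (L ! i) else ?I m)" for i
    have v: "v i \<in> \<P> E" "?I m \<sqsubseteq>\<^sub>L v i" "v i \<sqsubseteq>\<^sub>L ?I M" for i
      using loP IP[OF m(1)] lo_bounds Imono[of m M] m(3) by (auto simp: v_def)
    have le: "F n E (map (\<lambda>i. if i \<in> ?R then ?I M else exp (2 * r) *\<^sub>R v i) [0..<n])
      \<sqsubseteq>\<^sub>L (exp (2 * r) * exp (4 * M\<^sup>2 / m\<^sup>2 * (real (card ?R) / real n))) *\<^sub>R
        F n E (map (\<lambda>i. if i \<in> ?R then ?I m else v i) [0..<n])"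
      using r by (intro comparison[OF m(1,3) R(1)] v) auto
    have Ys_eq: "map (\<lambda>i. if i \<in> ?R then ?I M else exp (2 * r) *\<^sub>R v i) [0..<n] = Ys"
      using nq by (intro nth_equalityI) (auto simp: Ys_def v_def nth_append up_lo)
    have Xs_eq: "map (\<lambda>i. if i \<in> ?R then ?I m else v i) [0..<n] = Xs"
      using nq by (intro nth_equalityI) (auto simp: Xs_def v_def nth_append)
    have "F n E Ys \<sqsubseteq>\<^sub>L exp (2 * r + C * (real q / real n)) *\<^sub>R F n E Xs"
      using le unfolding Xs_eq Ys_eq R(2) C_def exp_add .
    also have "\<dots> \<sqsubseteq>\<^sub>L (1 + e) *\<^sub>R F n E Xs"
    proof (rule scaleR_pos_mono)
      have "C * (real q / real n) \<le> C * (2 * d)" by (rule mult_left_mono[OF q_small C])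
      then have "2 * r + C * (real q / real n) \<le> ln (1 + e)" using r(3) dC by (simp add: mult.commute)
      then have "exp (2 * r + C * (real q / real n)) \<le> exp (ln (1 + e))" by simp
      then show "exp (2 * r + C * (real q / real n)) \<le> 1 + e" using e by simp
      have "free_function n (F n)" using conjunct1[OF mean[unfolded operator_mean_def]] n0 by simp
      then have "F n E Xs \<in> \<P> E" using E Xs unfolding free_function_def by blast
      then show "0 \<sqsubseteq>\<^sub>L F n E Xs" by (rule pos_opsD(4)[OF E])
    qed
    finally show ?thesis .
  qed
  then show thesis using that n0 Xs Ys lower upper by blast
qed

end

end

section \<open>The extension\<close>

text \<open>The extensional function space fixes the values outside
  \<open>bounded_prob_measures E\<close>, so that uniqueness concerns exactly the function on
  measures of bounded support.\<close>

theorem theorem4p7: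
  fixes F :: "nat \<Rightarrow> 'h::chilbert_space op_family"
    and E :: "'h set"
  assumes infinite_dim: "\<not> (\<exists>B :: 'h set. finite B \<and> span B = UNIV)"
    and mean: "operator_mean F"
    and E: "hilbert E"
  shows "\<exists>!\<Phi>. \<Phi> \<in> bounded_prob_measures E \<rightarrow>\<^sub>E \<P> E \<and>
           preserves_stoch_order E \<Phi> \<and> extends_mean E F \<Phi>"
proof -
  \<comment> \<open>The values of the mean at uniform discrete measures below and above \<mu>. An
    order preserving extension must take a value satisfying \<open>between\<close>; the proof shows
    that there is exactly one.\<close>
  define lower where "lower \<mu> T \<longleftrightarrow> (\<exists>n Xs. 0 < n \<and> Xs \<in> tuples n E \<and> stoch_le E (empirical E Xs) \<mu> \<and> T = F n E Xs)" for \<mu> T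
  define upper where "upper \<mu> T \<longleftrightarrow> (\<exists>n Xs. 0 < n \<and> Xs \<in> tuples n E \<and> stoch_le E \<mu> (empirical E Xs) \<and> T = F n E Xs)" for \<mu> T
  define between where "between \<mu> T \<longleftrightarrow> T \<in> \<P> E \<and> (\<forall>A. lower \<mu> A \<longrightarrow> A \<sqsubseteq>\<^sub>L T) \<and> (\<forall>B. upper \<mu> B \<longrightarrow> T \<sqsubseteq>\<^sub>L B)" for \<mu> T
  have stoch_trans: "stoch_le E \<mu> \<rho>" if "stoch_le E \<mu> \<nu>" "stoch_le E \<nu> \<rho>" for \<mu> \<nu> \<rho>
    using that unfolding stoch_le_def by (meson order_trans)
  have F_pos: "F n E Xs \<in> \<P> E" if "0 < n" "Xs \<in> tuples n E" for n Xs
  proof -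
    have "free_function n (F n)" using conjunct1[OF mean[unfolded operator_mean_def]] that(1) by simp
    then show ?thesis using E that(2) unfolding free_function_def by blast
  qed
  have lower_pos: "A \<in> \<P> E" if "lower \<mu> A" for \<mu> A using that F_pos unfolding lower_def by blast
  have upper_pos: "A \<in> \<P> E" if "upper \<mu> A" for \<mu> A using that F_pos unfolding upper_def by blast
  have lower_upper: "A \<sqsubseteq>\<^sub>L B" if "lower \<mu> A" "upper \<mu> B" for \<mu> A B
  proof -
    obtain n Xs where X: "0 < n" "Xs \<in> tuples n E" "stoch_le E (empirical E Xs) \<mu>" "A = F n E Xs"
      using \<open>lower \<mu> A\<close> unfolding lower_def by blast
    obtain k Ys where Y: "0 < k" "Ys \<in> tuples k E" "stoch_le E \<mu> (empirical E Ys)" "B = F k E Ys"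
      using \<open>upper \<mu> B\<close> unfolding upper_def by blast
    show ?thesis
      unfolding X(4) Y(4) by (rule empirical_mono[OF E mean X(1) Y(1) X(2) Y(2) stoch_trans[OF X(3) Y(3)]])
  qed
  have close: "\<exists>A B. lower \<mu> A \<and> upper \<mu> B \<and> B \<sqsubseteq>\<^sub>L (1 + e) *\<^sub>R A" if \<mu>: "\<mu> \<in> bounded_prob_measures E" and e: "0 < e" for \<mu> e
  proof -
    obtain n Xs Ys where "0 < n" "Xs \<in> tuples n E" "Ys \<in> tuples n E"
      "stoch_le E (empirical E Xs) \<mu>" "stoch_le E \<mu> (empirical E Ys)" "F n E Ys \<sqsubseteq>\<^sub>L (1 + e) *\<^sub>R F n E Xs"
      by (rule order_approximation[OF E \<mu> infinite_dim mean e])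
    then show ?thesis unfolding lower_def upper_def by blast
  qed
  \<comment> \<open>Stated for unrelated T and T', since it serves both uniqueness of the value and
    preservation of the order.\<close>
  have squeeze: "T \<sqsubseteq>\<^sub>L T'" if \<mu>: "\<mu> \<in> bounded_prob_measures E"
    and T: "\<And>B. upper \<mu> B \<Longrightarrow> T \<sqsubseteq>\<^sub>L B" and T': "\<And>A. lower \<mu> A \<Longrightarrow> A \<sqsubseteq>\<^sub>L T'" for \<mu> T T'
  proof (rule loewner_le_epsilon)
    fix e :: real assume e: "0 < e"
    obtain A B where AB: "lower \<mu> A" "upper \<mu> B" "B \<sqsubseteq>\<^sub>L (1 + e) *\<^sub>R A" using close[OF \<mu> e] by blast
    have "(1 + e) *\<^sub>R A \<sqsubseteq>\<^sub>L (1 + e) *\<^sub>R T'" using T'[OF AB(1)] e by (intro loewner_scaleR_mono) auto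
    then show "T \<sqsubseteq>\<^sub>L (1 + e) *\<^sub>R T'" using T[OF AB(2)] AB(3) loewner_trans by blast
  qed
  have between_unique: "T = T'" if "\<mu> \<in> bounded_prob_measures E" "between \<mu> T" "between \<mu> T'" for \<mu> T T'
  proof (rule loewner_antisym)
    show "clin T" "clin T'" using that pos_opsD(2)[OF E] unfolding between_def by blast+
    show "T \<sqsubseteq>\<^sub>L T'" "T' \<sqsubseteq>\<^sub>L T" using that unfolding between_def by (blast intro: squeeze)+
  qed
  have between_exists: "\<exists>T. between \<mu> T" if \<mu>: "\<mu> \<in> bounded_prob_measures E" for \<mu>
  proof -
    have "\<forall>k. \<exists>A B. lower \<mu> A \<and> upper \<mu> B \<and> B \<sqsubseteq>\<^sub>L (1 + inverse (real (Suc k))) *\<^sub>R A"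
      by (intro allI close[OF \<mu>]) simp
    then obtain A B where AB: "\<And>k. lower \<mu> (A k)" "\<And>k. upper \<mu> (B k)"
      "\<And>k. B k \<sqsubseteq>\<^sub>L (1 + inverse (real (Suc k))) *\<^sub>R A k" by metis
    obtain b where b: "0 < b" "B 0 \<sqsubseteq>\<^sub>L b *\<^sub>R id_op E" by (rule pos_ops_upper[OF E upper_pos[OF AB(2)]])
    have Ab: "A k \<sqsubseteq>\<^sub>L b *\<^sub>R id_op E" for k by (rule loewner_trans[OF lower_upper[OF AB(1) AB(2)] b(2)])
    \<comment> \<open>The chain A j \<le> B k \<le> (1 + 1/(k+1)) A k with the common bound b. Used
      in both directions, it bounds the norm of the difference, so the lower values form a Cauchy
      sequence without being monotone.\<close>
    have diff: "A j - A k \<sqsubseteq>\<^sub>L (inverse (real (Suc k)) * b) *\<^sub>R id_op E" for j k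
    proof -
      let ?d = "inverse (real (Suc k))"
      have "A j \<sqsubseteq>\<^sub>L (1 + ?d) *\<^sub>R A k" by (rule loewner_trans[OF lower_upper[OF AB(1) AB(2)] AB(3)])
      also have "\<dots> = A k + ?d *\<^sub>R A k" by (simp add: scaleR_add_left)
      also have "\<dots> \<sqsubseteq>\<^sub>L A k + ?d *\<^sub>R b *\<^sub>R id_op E" by (intro loewner_add_mono loewner_refl loewner_scaleR_mono Ab) simp
      finally show ?thesis by (simp add: loewner_le_def algebra_simps)
    qed
    have norm_diff: "norm (A j - A k) \<le> inverse (real (Suc N)) * b" if "j \<ge> N" "k \<ge> N" for j k N
    proof (rule norm_le_of_loewner[OF E])
      note p = pos_opsD[OF E lower_pos[OF AB(1)[of j]]] pos_opsD[OF E lower_pos[OF AB(1)[of k]]]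
      show "A j - A k \<in> bounded_ops E E" "selfadj (A j - A k)"
        using p by (auto simp: bops_diff[OF E] selfadj_diff)
      show "0 \<le> inverse (real (Suc N)) * b" using b by simp
      have mono: "(inverse (real (Suc i)) * b) *\<^sub>R id_op E \<sqsubseteq>\<^sub>L (inverse (real (Suc N)) * b) *\<^sub>R id_op E" if "i \<ge> N" for i
        using that b by (intro scaleR_pos_mono[OF pos_opsD(4)[OF E id_op_pos[OF E]]] mult_right_mono le_imp_inverse_le) auto
      show "A j - A k \<sqsubseteq>\<^sub>L (inverse (real (Suc N)) * b) *\<^sub>R id_op E"
        by (rule loewner_trans[OF diff mono[OF that(2)]])
      have "A k - A j \<sqsubseteq>\<^sub>L (inverse (real (Suc N)) * b) *\<^sub>R id_op E"
        by (rule loewner_trans[OF diff mono[OF that(1)]])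
      then show "(- (inverse (real (Suc N)) * b)) *\<^sub>R id_op E \<sqsubseteq>\<^sub>L A j - A k"
        by (simp add: loewner_le_def algebra_simps)
    qed
    have "Cauchy A"
    proof (rule CauchyI)
      fix e :: real assume e: "0 < e"
      then have "0 < e / b" using b by simp
      then obtain N where N: "inverse (real (Suc N)) < e / b" using reals_Archimedean by blast
      then have "inverse (real (Suc N)) * b < e" using b by (simp add: pos_less_divide_eq)
      then have "norm (A j - A k) < e" if "j \<ge> N" "k \<ge> N" for j k using norm_diff[OF that] by linarith
      then show "\<exists>N. \<forall>j\<ge>N. \<forall>k\<ge>N. norm (A j - A k) < e" by blast
    qed
    then obtain T where T: "A \<longlonglongrightarrow> T" using Cauchy_convergent convergent_def by blast
    have low: "C \<sqsubseteq>\<^sub>L T" if C: "lower \<mu> C" for C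
    proof (rule loewner_limit[OF tendsto_const])
      have "(\<lambda>k. (1 + inverse (real (Suc k))) *\<^sub>R A k) \<longlonglongrightarrow> (1 + 0) *\<^sub>R T"
        by (intro tendsto_intros LIMSEQ_inverse_real_of_nat T)
      then show "(\<lambda>k. (1 + inverse (real (Suc k))) *\<^sub>R A k) \<longlonglongrightarrow> T" by simp
      show "C \<sqsubseteq>\<^sub>L (1 + inverse (real (Suc k))) *\<^sub>R A k" for k
        by (rule loewner_trans[OF lower_upper[OF C AB(2)] AB(3)])
    qed
    moreover have "T \<sqsubseteq>\<^sub>L D" if D: "upper \<mu> D" for D
      by (rule loewner_limit[OF T tendsto_const]) (rule lower_upper[OF AB(1) D])
    moreover have "T \<in> bounded_ops E E"
      by (rule bops_limit[OF E _ T]) (rule pos_opsD(1)[OF E lower_pos[OF AB(1)]])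
    then have "T \<in> \<P> E" by (rule pos_ops_mono[OF E lower_pos[OF AB(1)] _ low[OF AB(1)]])
    ultimately show ?thesis unfolding between_def by blast
  qed
  \<comment> \<open>An empirical measure lies below and above itself, so its own value is both a
    lower and an upper one.\<close>
  have between_empirical: "between (empirical E Xs) T \<Longrightarrow> T = F n E Xs" if n: "0 < n" and Xs: "Xs \<in> tuples n E" for n Xs T
  proof -
    assume T: "between (empirical E Xs) T"
    have "stoch_le E (empirical E Xs) (empirical E Xs)" by (simp add: stoch_le_def)
    then have "lower (empirical E Xs) (F n E Xs)" "upper (empirical E Xs) (F n E Xs)"
      unfolding lower_def upper_def using n Xs by blast+
    then have "F n E Xs \<sqsubseteq>\<^sub>L T" "T \<sqsubseteq>\<^sub>L F n E Xs" using T unfolding between_def by blast+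
    moreover have "clin T" "clin (F n E Xs)"
      using T F_pos[OF n Xs] pos_opsD(2)[OF E] unfolding between_def by blast+
    ultimately show "T = F n E Xs" using loewner_antisym by blast
  qed
  have bounded: "empirical E Xs \<in> bounded_prob_measures E" if "0 < n" "Xs \<in> tuples n E" for n Xs
    by (rule empirical_bounded[OF E that])
  define \<Psi> where "\<Psi> = restrict (\<lambda>\<mu>. SOME T. between \<mu> T) (bounded_prob_measures E)"
  have \<Psi>: "between \<mu> (\<Psi> \<mu>)" if "\<mu> \<in> bounded_prob_measures E" for \<mu>
    using someI_ex[OF between_exists[OF that]] that by (simp add: \<Psi>_def)
  have \<Psi>_PiE: "\<Psi> \<in> bounded_prob_measures E \<rightarrow>\<^sub>E \<P> E"
  proof (rule PiE_I)
    show "\<Psi> \<mu> \<in> \<P> E" if "\<mu> \<in> bounded_prob_measures E" for \<mu>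
      using \<Psi>[OF that] unfolding between_def by blast
  qed (simp add: \<Psi>_def)
  show ?thesis
  proof (rule ex1I)
    show "\<Psi> \<in> bounded_prob_measures E \<rightarrow>\<^sub>E \<P> E \<and> preserves_stoch_order E \<Psi> \<and> extends_mean E F \<Psi>"
    proof (intro conjI)
      show "\<Psi> \<in> bounded_prob_measures E \<rightarrow>\<^sub>E \<P> E" by (rule \<Psi>_PiE)
      show "extends_mean E F \<Psi>"
        unfolding extends_mean_def using between_empirical[OF _ _ \<Psi>[OF bounded]] by blast
      show "preserves_stoch_order E \<Psi>"
        unfolding preserves_stoch_order_def
      proof (intro ballI impI)
        fix \<mu> \<nu> assume \<mu>: "\<mu> \<in> bounded_prob_measures E" and \<nu>: "\<nu> \<in> bounded_prob_measures E" and le: "stoch_le E \<mu> \<nu>"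
        \<comment> \<open>Lower values of \<mu> are lower values of \<nu> by transitivity, so
          \<open>squeeze\<close> at \<mu> compares the two images.\<close>
        have "lower \<nu> A" if "lower \<mu> A" for A
          using that stoch_trans[OF _ le] unfolding lower_def by blast
        then have "A \<sqsubseteq>\<^sub>L \<Psi> \<nu>" if "lower \<mu> A" for A using \<Psi>[OF \<nu>] that unfolding between_def by blast
        moreover have "\<Psi> \<mu> \<sqsubseteq>\<^sub>L B" if "upper \<mu> B" for B using \<Psi>[OF \<mu>] that unfolding between_def by blast
        ultimately show "\<Psi> \<mu> \<sqsubseteq>\<^sub>L \<Psi> \<nu>" using squeeze[OF \<mu>] by simp
      qed
    qed
  next
    fix \<Phi> assume \<Phi>: "\<Phi> \<in> bounded_prob_measures E \<rightarrow>\<^sub>E \<P> E \<and> preserves_stoch_order E \<Phi> \<and> extends_mean E F \<Phi>"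
    have ext: "\<Phi> (empirical E Xs) = F n E Xs" if "0 < n" "Xs \<in> tuples n E" for n Xs
      using \<Phi> that unfolding extends_mean_def by blast
    have pres: "\<Phi> \<mu> \<sqsubseteq>\<^sub>L \<Phi> \<nu>" if "\<mu> \<in> bounded_prob_measures E" "\<nu> \<in> bounded_prob_measures E" "stoch_le E \<mu> \<nu>" for \<mu> \<nu>
      using \<Phi> that unfolding preserves_stoch_order_def by blast
    \<comment> \<open>Order preservation, applied to \<mu> and the empirical measures comparable
      with it, on which the values of \<Phi> are prescribed.\<close>
    have "between \<mu> (\<Phi> \<mu>)" if \<mu>: "\<mu> \<in> bounded_prob_measures E" for \<mu>
      unfolding between_def
    proof (intro conjI allI impI)
      show "\<Phi> \<mu> \<in> \<P> E" using \<Phi> \<mu> by auto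
      fix A assume "lower \<mu> A"
      then obtain n Xs where X: "0 < n" "Xs \<in> tuples n E" "stoch_le E (empirical E Xs) \<mu>" "A = F n E Xs"
        unfolding lower_def by blast
      then show "A \<sqsubseteq>\<^sub>L \<Phi> \<mu>" using pres[OF bounded[OF X(1,2)] \<mu> X(3)] ext[OF X(1,2)] by simp
    next
      fix A assume "upper \<mu> A"
      then obtain n Xs where X: "0 < n" "Xs \<in> tuples n E" "stoch_le E \<mu> (empirical E Xs)" "A = F n E Xs"
        unfolding upper_def by blast
      then show "\<Phi> \<mu> \<sqsubseteq>\<^sub>L A" using pres[OF \<mu> bounded[OF X(1,2)] X(3)] ext[OF X(1,2)] by simp
    qed
    then have "\<Phi> \<mu> = \<Psi> \<mu>" if "\<mu> \<in> bounded_prob_measures E" for \<mu>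
      using between_unique[OF that _ \<Psi>[OF that]] that by blast
    then show "\<Phi> = \<Psi>" using \<Phi> \<Psi>_PiE by (intro PiE_ext[of \<Phi>]) auto
  qed
qed

end
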